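(* Let $H=([t],E)$ be a $3$-uniform hypergraph on $[t]$. For $f:\{0,1\}^n\to\{-1,1\}$ consider the test: choose $x_1,\dots,x_t\in\{0,1\}^n$ independently and uniformly, and accept iff for every edge $e=\{i,j,k\}\in E$, $$f(x_i)f(x_j)f(x_k)f(x_i+x_j)f(x_i+x_k)f(x_j+x_k)f(x_i+x_j+x_k)=f(0).$$ Then (i) if $f=(-1)^{P}$ for a polynomial $P$ over $\mathbb F_2$ of degree at most $2$, the test accepts $f$ with probability $1$; and (ii) there is a function $\phi:(0,1/2]\to[0,\infty)$ with $\phi(\epsilon)\to0$ as $\epsilon\to0$, independent of $n$, $t$ and $H$, such that whenever $f$ is at distance at least $\frac12-\epsilon$ from every quadratic polynomial function, the test accepts $f$ with probability at most $\frac{1}{2^{|E|}}+\phi(\epsilon)$.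
   Context: $\{0,1\}^n$ is identified with $\mathbb F_2^n$. A quadratic polynomial function is $g(x)=(-1)^{P(x)}$ with $P$ an $n$-variate polynomial over $\mathbb F_2$ of degree at most $2$. The distance between two functions $\{0,1\}^n\to\{-1,1\}$ is the fraction of points where they differ. *)

theory Defs
  imports "HOL-Analysis.Analysis" "HOL-Library.FuncSet"
begin

definition cube :: "nat \<Rightarrow> (nat \<Rightarrow> bool) set" where
  "cube n = {x. \<forall>i. n \<le> i \<longrightarrow> \<not> x i}"

definition vadd :: "(nat \<Rightarrow> bool) \<Rightarrow> (nat \<Rightarrow> bool) \<Rightarrow> (nat \<Rightarrow> bool)" where
  "vadd x y = (\<lambda>i. x i \<noteq> y i)"

definition vzero :: "nat \<Rightarrow> bool" where
  "vzero = (\<lambda>_. False)"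

text \<open>P : F_2^n -> F_2 (F_2 = bool, True = 1) is given by a polynomial of degree at most 2:
  P(x) = c + sum_i a_i x_i + sum_{i<=j} b_ij x_i x_j  (mod 2).\<close>
definition quad_poly :: "nat \<Rightarrow> ((nat \<Rightarrow> bool) \<Rightarrow> bool) \<Rightarrow> bool" where
  "quad_poly n P \<longleftrightarrow> (\<exists>(c::bool) (a::nat \<Rightarrow> bool) (b::nat \<Rightarrow> nat \<Rightarrow> bool).
     \<forall>x\<in>cube n. P x = odd (of_bool c
        + (\<Sum>i<n. of_bool (a i \<and> x i))
        + (\<Sum>i<n. \<Sum>j<n. of_bool (i \<le> j \<and> b i j \<and> x i \<and> x j)) :: nat))"

definition sgn_fun :: "((nat \<Rightarrow> bool) \<Rightarrow> bool) \<Rightarrow> (nat \<Rightarrow> bool) \<Rightarrow> real" where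
  "sgn_fun P x = (if P x then -1 else 1)"

definition fdist :: "nat \<Rightarrow> ((nat \<Rightarrow> bool) \<Rightarrow> real) \<Rightarrow> ((nat \<Rightarrow> bool) \<Rightarrow> real) \<Rightarrow> real" where
  "fdist n f g = real (card {x\<in>cube n. f x \<noteq> g x}) / 2 ^ n"

definition three_uniform :: "nat \<Rightarrow> nat set set \<Rightarrow> bool" where
  "three_uniform t E \<longleftrightarrow> (\<forall>e\<in>E. e \<subseteq> {1..t} \<and> card e = 3)"

definition test_accepts :: "nat set set \<Rightarrow> ((nat \<Rightarrow> bool) \<Rightarrow> real) \<Rightarrow> (nat \<Rightarrow> nat \<Rightarrow> bool) \<Rightarrow> bool" where
  "test_accepts E f xs \<longleftrightarrow> (\<forall>e\<in>E. \<forall>i j k. e = {i, j, k} \<longrightarrow>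
      f (xs i) * f (xs j) * f (xs k) * f (vadd (xs i) (xs j)) * f (vadd (xs i) (xs k))
      * f (vadd (xs j) (xs k)) * f (vadd (vadd (xs i) (xs j)) (xs k)) = f vzero)"

definition accept_prob :: "nat \<Rightarrow> nat \<Rightarrow> nat set set \<Rightarrow> ((nat \<Rightarrow> bool) \<Rightarrow> real) \<Rightarrow> real" where
  "accept_prob n t E f =
     real (card {xs \<in> Pi\<^sub>E {1..t} (\<lambda>_. cube n). test_accepts E f xs})
     / real (card (Pi\<^sub>E {1..t} (\<lambda>_. cube n)))"

end

theory Submission
  imports Defs "HOL-Library.Function_Algebras" "HOL-Library.Set_Algebras"
begin

text \<open>Expanding \<open>\<Prod>\<^sub>e (1 + \<psi>\<^sub>e) / 2\<close> over the edges, every nonempty set of edges contributes an average of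
  the form \<open>f(x + y + z) A(x, y) B(x, z) C(y, z)\<close>, because distinct edges share at most two
  vertices. By Cauchy--Schwarz such an average is small unless
  \<open>F(h, a) = (E\<^sub>x f(x) f(x + h) (-1)\<^bsup>a \<cdot> x\<^esup>)\<^sup>2\<close> is at least \<open>\<gamma>\<close> on a set \<open>S\<close> of at least \<open>\<gamma> N\<close> pairs
  \<open>(h, a)\<close>, where \<open>N = 2\<^sup>n\<close>; so everything reduces to an inverse theorem for the Gowers \<open>U\<^sup>3\<close> norm.

  The function \<open>F\<close> equals its own symplectic Fourier transform, hence is positive definite, and it
  sums to \<open>N\<close>. Sifting \<open>S\<close> by random characters drawn from the density \<open>F\<close> yields a large subset with
  small doubling, and a Ruzsa covering argument a subgroup \<open>V\<close> of size \<open>O(N)\<close> on which \<open>F\<close> has mass of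
  order \<open>N\<close>. The inequality \<open>F(V)\<^sup>2 \<le> |V| F(V \<inter> V\<^sup>\<perp>)\<close> moves the mass to an isotropic subgroup, which is
  cut down and extended to the graph of an alternating linear map \<open>L\<close>. The quadratic form polarising
  \<open>L\<close>, corrected by a linear form, then correlates with \<open>f\<close>.\<close>

section \<open>Additive combinatorics in groups of exponent two\<close>

text \<open>The error must not grow with the number of edges. The expansion has
  \<open>2 ^ card E\<close> terms and the prefactor \<open>1 / 2 ^ card E\<close>, so a uniform
  bound for each nonempty term already bounds the whole error. Self-duality of \<open>F\<close>
  reflects the symmetry between \<open>h\<close> and \<open>k\<close> in the parallelogram
  \<open>x, x + h, x + k, x + h + k\<close>. It makes \<open>F / N\<close> a probability density
  whose random characters have correlation exactly \<open>F (u + v)\<close> at \<open>u\<close> and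
  \<open>v\<close>. On every subset of \<open>S\<close> the average of \<open>F (a + b)\<close> is
  therefore at least \<open>\<gamma>\<^sup>2\<close>, but this only yields a small positive
  proportion of sums at which \<open>F\<close> is large. Sifting pushes that proportion up to 15/16,
  enough to turn it into small doubling. In characteristic two a symmetric form need not polarise a
  quadratic one: it has to be alternating. This property is inherited from \<open>F\<close>, which
  vanishes at \<open>(h, a)\<close> unless \<open>dot h a = 0\<close>.\<close>

class exponent_two = comm_monoid_add +
  assumes add_self [simp]: "x + x = 0"
begin

lemma add_self_left [simp]: "x + (x + y) = y"
  by (simp flip: add.assoc)

lemma add_self_right [simp]: "x + (y + x) = y"
  by (simp add: add.commute[of y])

lemma add_self_right' [simp]: "(y + x) + x = y"
  by (simp add: add.assoc)

lemma add_left_inj [simp]: "a + x = a + y \<longleftrightarrow> x = y"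
  by (metis add_self_left)

lemma add_eq_iff: "x + y = z \<longleftrightarrow> y = x + z"
  by (metis add_self_left)

end

instantiation bool :: exponent_two
begin

definition plus_bool :: "bool \<Rightarrow> bool \<Rightarrow> bool"
  where "plus_bool a b \<longleftrightarrow> a \<noteq> b"

definition zero_bool :: bool
  where "zero_bool = False"

instance
  by standard (auto simp: plus_bool_def zero_bool_def)

end

instance "fun" :: (type, exponent_two) exponent_two
  by standard (simp add: fun_eq_iff)

instance prod :: (exponent_two, exponent_two) exponent_two
  by standard (simp add: plus_prod_def zero_prod_def)

section \<open>Signs, finite subgroups and character sums\<close>

definition sg :: "bool \<Rightarrow> real"
  where "sg b = (if b then -1 else 1)"

lemma sg_add [simp]: "sg (a + b) = sg a * sg b"
  by (simp add: sg_def plus_bool_def)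

lemma sg_0 [simp]: "sg 0 = 1"
  by (simp add: sg_def zero_bool_def)

lemma sg_square [simp]: "sg a * sg a = 1" "(sg a)\<^sup>2 = 1"
  by (auto simp: sg_def)

lemma abs_sg [simp]: "\<bar>sg a\<bar> = 1"
  by (simp add: sg_def)

lemma sg_cases: "sg a = 1 \<or> sg a = -1"
  by (simp add: sg_def)

text \<open>Finiteness is built in because these groups live inside infinite types such as
  \<open>nat \<Rightarrow> bool\<close>. Closure under inverses is automatic in exponent
  two.\<close>

definition subgrp :: "'a::exponent_two set \<Rightarrow> bool"
  where "subgrp V \<longleftrightarrow> finite V \<and> 0 \<in> V \<and> (\<forall>x\<in>V. \<forall>y\<in>V. x + y \<in> V)"

lemma subgrpD:
  assumes "subgrp V"
  shows "finite V" "0 \<in> V" "x \<in> V \<Longrightarrow> y \<in> V \<Longrightarrow> x + y \<in> V" "V \<noteq> {}"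
  using assms by (auto simp: subgrp_def)

lemma subgrp_add_iff:
  assumes "subgrp V" "x \<in> V"
  shows "x + y \<in> V \<longleftrightarrow> y \<in> V" "y + x \<in> V \<longleftrightarrow> y \<in> V"
  using subgrpD[OF assms(1)] assms(2) by (metis add_self_left, metis add_self_right')

lemma subgrp_card_pos: "subgrp V \<Longrightarrow> card V > 0"
  by (auto simp: subgrp_def card_gt_0_iff)

lemma subgrp_translate_bij:
  assumes "subgrp V" "a \<in> V"
  shows "bij_betw (\<lambda>x. x + a) V V"
  by (rule bij_betwI[where g = "\<lambda>x. x + a"]) (use subgrp_add_iff[OF assms] in auto)

lemma sum_translate:
  assumes "subgrp V" "a \<in> V"
  shows "(\<Sum>x\<in>V. f (x + a)) = (\<Sum>x\<in>V. f x)"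
  by (rule sum.reindex_bij_betw[OF subgrp_translate_bij[OF assms]])

lemma sum_translate':
  assumes "subgrp V" "a \<in> V"
  shows "(\<Sum>x\<in>V. f (a + x)) = (\<Sum>x\<in>V. f x)"
  using sum_translate[OF assms, of f] by (simp add: add.commute)

text \<open>If \<open>\<phi> a \<noteq> 0\<close>, translation by \<open>a\<close> flips the sign of
  every term, so the sum equals its own negative.\<close>

lemma sum_character:
  assumes V: "subgrp V" and hom: "\<And>x y. x \<in> V \<Longrightarrow> y \<in> V \<Longrightarrow> \<phi> (x + y) = \<phi> x + \<phi> y"
  shows "(\<Sum>x\<in>V. sg (\<phi> x)) = (if \<forall>x\<in>V. \<phi> x = 0 then real (card V) else 0)"
proof (cases "\<forall>x\<in>V. \<phi> x = 0")
  case False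
  then obtain a where a: "a \<in> V" "\<phi> a \<noteq> 0" by blast
  then have "sg (\<phi> a) = -1" by (auto simp: sg_def zero_bool_def)
  moreover have "(\<Sum>x\<in>V. sg (\<phi> x)) = (\<Sum>x\<in>V. sg (\<phi> (x + a)))"
    using sum_translate[OF V a(1), of "\<lambda>x. sg (\<phi> x)"] by simp
  ultimately have "(\<Sum>x\<in>V. sg (\<phi> x)) = - (\<Sum>x\<in>V. sg (\<phi> x))"
    using a by (simp add: hom sum_negf)
  then show ?thesis using False by auto
qed simp

lemma subgrp_adjoin:
  assumes "subgrp W"
  shows "subgrp (W \<union> (\<lambda>w. x + w) ` W)"
proof -
  have *: "a + (x + b) \<in> (\<lambda>w. x + w) ` W" "(x + a) + b \<in> (\<lambda>w. x + w) ` W" if "a \<in> W" "b \<in> W" for a b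
    using subgrpD(3)[OF assms that] by (auto simp: image_iff add.assoc intro!: bexI[of _ "a + b"] add.left_commute)
  have "(x + a) + (x + b) \<in> W" if "a \<in> W" "b \<in> W" for a b
    using subgrpD(3)[OF assms that] by (simp add: add.left_commute add.assoc)
  then show ?thesis
    using subgrpD[OF assms] * unfolding subgrp_def by auto
qed

text \<open>Adjoining one element to a subgroup adds at most one coset, hence at most doubles
  it.\<close>

lemma exists_subgrp_superset:
  assumes "finite X"
  shows "\<exists>W. subgrp W \<and> X \<subseteq> W \<and> card W \<le> 2 ^ card X"
  using assms
proof induction
  case empty
  have "subgrp {0::'a}" by (simp add: subgrp_def)
  then show ?case by (intro exI[of _ "{0}"]) simp
next
  case (insert x X)
  then obtain W where W: "subgrp W" "X \<subseteq> W" "card W \<le> 2 ^ card X" by blast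
  let ?W = "W \<union> (\<lambda>w. x + w) ` W"
  have "card ?W \<le> card W + card W"
    using card_Un_le[of W "(\<lambda>w. x + w) ` W"] card_image_le[OF subgrpD(1)[OF W(1)]]
    by (meson add_left_mono order_trans)
  moreover have "x \<in> ?W"
    using subgrpD(2)[OF W(1)] by (auto simp: image_iff intro!: bexI[of _ 0])
  ultimately show ?case
    using W insert.hyps subgrp_adjoin[OF W(1), of x] by (intro exI[of _ ?W]) auto
qed

lemma card_set_plus_le:
  assumes "finite A" "finite B"
  shows "finite (A + B)" "card (A + B) \<le> card A * card B"
proof -
  have eq: "A + B = (\<lambda>(a, b). a + b) ` (A \<times> B)" by (auto simp: set_plus_def)
  show "finite (A + B)" using assms by (simp add: eq)
  show "card (A + B) \<le> card A * card B"
    using card_image_le[of "A \<times> B" "\<lambda>(a, b). a + b"] assms by (simp add: eq card_cartesian_product)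
qed

section \<open>Popular sums, Ruzsa covering and small doubling\<close>

definition rep :: "'a::exponent_two set \<Rightarrow> 'a \<Rightarrow> nat"
  where "rep A d = card {a \<in> A. a + d \<in> A}"

lemma rep_le: "finite A \<Longrightarrow> rep A d \<le> card A"
  unfolding rep_def by (intro card_mono) auto

lemma card_eq_sum_fibres:
  assumes "finite P" "f ` P \<subseteq> B" "finite B"
  shows "card P = (\<Sum>b\<in>B. card {p \<in> P. f p = b})"
  using sum.group[OF assms(1) assms(3) assms(2), of "\<lambda>_. 1::nat"] by simp

lemma sum_rep:
  assumes "finite A" "finite D"
  shows "card {(a, b) \<in> A \<times> A. a + b \<in> D} = (\<Sum>d\<in>D. rep A d)"
proof -
  let ?P = "{(a, b) \<in> A \<times> A. a + b \<in> D}"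
  have fin: "finite ?P" using assms by (auto intro: finite_subset[of _ "A \<times> A"])
  have "card {p \<in> ?P. fst p + snd p = d} = rep A d" if "d \<in> D" for d
    unfolding rep_def
    by (rule bij_betw_same_card[where f = fst], rule bij_betwI[where g = "\<lambda>a. (a, a + d)"])
      (use that in \<open>auto simp: add_eq_iff\<close>)
  moreover have "(\<lambda>p. fst p + snd p) ` ?P \<subseteq> D" by auto
  ultimately show ?thesis
    using card_eq_sum_fibres[OF fin, of "\<lambda>p. fst p + snd p" D] assms by simp
qed

lemma sum_card_fibres_le:
  assumes "finite P" "finite B"
  shows "(\<Sum>b\<in>B. card {p \<in> P. f p = b}) \<le> card P"
proof -
  have "(\<Sum>b\<in>B. card {p \<in> P. f p = b}) = card (\<Union>b\<in>B. {p \<in> P. f p = b})"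
    using assms by (intro card_UN_disjoint[symmetric]) auto
  also have "\<dots> \<le> card P" using assms by (intro card_mono) auto
  finally show ?thesis .
qed

text \<open>Every \<open>d = a + a'\<close> splits \<open>p + d + q\<close> as \<open>(p + a) + (a' + q)\<close>, so popular sums can be
  inserted at bounded cost.\<close>

lemma popular_sumset:
  fixes P Q A D :: "'a::exponent_two set"
  assumes fin: "finite P" "finite A" "finite Q" "finite D"
    and pop: "\<And>d. d \<in> D \<Longrightarrow> \<rho> \<le> real (rep A d)"
  shows "\<rho> * real (card (P + D + Q)) \<le> real (card (P + A)) * real (card (A + Q))"
proof -
  let ?T = "(P + A) \<times> (A + Q)"
  have finT: "finite ?T" using fin by (simp add: card_set_plus_le)
  have finS: "finite (P + D + Q)" using fin by (simp add: card_set_plus_le)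
  have fib: "\<rho> \<le> real (card {t \<in> ?T. fst t + snd t = z})" if z: "z \<in> P + D + Q" for z
  proof -
    obtain p d q where pdq: "p \<in> P" "d \<in> D" "q \<in> Q" "z = p + d + q"
      using z by (auto simp: set_plus_def)
    have "rep A d \<le> card {t \<in> ?T. fst t + snd t = z}"
      unfolding rep_def
    proof (rule card_inj_on_le[where f = "\<lambda>a. (p + a, (a + d) + q)"])
      show "inj_on (\<lambda>a. (p + a, (a + d) + q)) {a \<in> A. a + d \<in> A}"
        by (auto simp: inj_on_def)
      have "p + a + (a + d + q) = z" for a
        using pdq by (simp add: add.assoc)
      then show "(\<lambda>a. (p + a, (a + d) + q)) ` {a \<in> A. a + d \<in> A} \<subseteq> {t \<in> ?T. fst t + snd t = z}"
        using pdq by (auto intro!: set_plus_intro)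
      show "finite {t \<in> ?T. fst t + snd t = z}" using finT by simp
    qed
    then show ?thesis using pop[OF pdq(2)] by linarith
  qed
  have "\<rho> * real (card (P + D + Q)) = (\<Sum>z\<in>P + D + Q. \<rho>)" by simp
  also have "\<dots> \<le> (\<Sum>z\<in>P + D + Q. real (card {t \<in> ?T. fst t + snd t = z}))"
    by (intro sum_mono fib)
  also have "\<dots> \<le> real (card ?T)"
    using sum_card_fibres_le[OF finT finS, of "\<lambda>t. fst t + snd t"] by (simp flip: of_nat_sum)
  finally show ?thesis by (simp add: card_cartesian_product)
qed

text \<open>Take \<open>X\<close> maximal such that the translates \<open>x + Y\<close> are pairwise
  disjoint. They are packed into \<open>B + Y\<close>, which bounds \<open>card X\<close>; by
  maximality every \<open>b + Y\<close> meets some \<open>x + Y\<close>, which puts \<open>b\<close>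
  into \<open>x + (Y + Y)\<close>.\<close>

lemma ruzsa_covering:
  fixes B Y :: "'a::exponent_two set"
  assumes fin: "finite B" "finite Y" and "Y \<noteq> {}"
  shows "\<exists>X\<subseteq>B. card X * card Y \<le> card (B + Y) \<and> B \<subseteq> X + (Y + Y)"
proof -
  define ok where "ok X \<longleftrightarrow> X \<subseteq> B \<and> (\<forall>x\<in>X. \<forall>x'\<in>X. \<forall>y\<in>Y. \<forall>y'\<in>Y. x + y = x' + y' \<longrightarrow> x = x')" for X
  have "ok {}" by (simp add: ok_def)
  moreover have "\<forall>X. ok X \<longrightarrow> card X \<le> card B"
    using fin by (auto simp: ok_def intro: card_mono)
  ultimately obtain X where X: "ok X" "\<And>X'. ok X' \<Longrightarrow> card X' \<le> card X"
    using ex_has_greatest_nat[of ok "{}" card "Suc (card B)"] by (auto simp: less_Suc_eq_le)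
  have finX: "finite X" using X(1) fin by (auto simp: ok_def intro: finite_subset)
  have "inj_on (\<lambda>(x, y). x + y) (X \<times> Y)"
  proof (rule inj_onI, clarify)
    fix x y x' y' assume *: "x \<in> X" "y \<in> Y" "x' \<in> X" "y' \<in> Y" "x + y = x' + y'"
    then have "x = x'" using X(1) unfolding ok_def by blast
    then show "x = x' \<and> y = y'" using *(5) by simp
  qed
  then have "card X * card Y = card ((\<lambda>(x, y). x + y) ` (X \<times> Y))"
    by (simp add: card_image card_cartesian_product)
  also have "\<dots> \<le> card (B + Y)"
    using X(1) fin by (intro card_mono card_set_plus_le) (auto simp: ok_def)
  finally have 1: "card X * card Y \<le> card (B + Y)" .
  have "b \<in> X + (Y + Y)" if b: "b \<in> B" for b
  proof -
    have "\<exists>x\<in>X. \<exists>y\<in>Y. \<exists>y'\<in>Y. b + y = x + y'"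
    proof (rule ccontr)
      assume no: "\<not> ?thesis"
      have "b \<notin> X"
      proof
        assume "b \<in> X"
        moreover obtain y where "y \<in> Y" using \<open>Y \<noteq> {}\<close> by blast
        ultimately show False using no by blast
      qed
      have "ok (insert b X)" unfolding ok_def
      proof (intro conjI ballI impI)
        show "insert b X \<subseteq> B" using X(1) b by (simp add: ok_def)
      next
        fix x x' y y' assume *: "x \<in> insert b X" "x' \<in> insert b X" "y \<in> Y" "y' \<in> Y" "x + y = x' + y'"
        then consider "x = x'" | "x \<in> X" "x' \<in> X" | "x = b" "x' \<in> X" | "x \<in> X" "x' = b" by blast
        then show "x = x'"
        proof cases
          case 2
          then show ?thesis using X(1) * unfolding ok_def by blast
        next
          case 3
          then show ?thesis using no *(3-5) by blast
        next
          case 4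
          then show ?thesis using no *(3,4) *(5)[symmetric] by blast
        qed
      qed
      then show False using X(2)[of "insert b X"] \<open>b \<notin> X\<close> finX by simp
    qed
    then obtain x y y' where *: "x \<in> X" "y \<in> Y" "y' \<in> Y" "b + y = x + y'" by blast
    then have "b = x + (y' + y)" by (metis add.assoc add_self_right')
    then show ?thesis using * by blast
  qed
  then show ?thesis using 1 X(1) by (auto simp: ok_def)
qed


text \<open>Popular sums stand in for Pluennecke's inequality. Three copies of \<open>D\<close> are
  inserted next to a copy of \<open>A\<close> by \<open>popular_sumset\<close>, each at cost
  \<open>card (A + A) / \<rho>\<close>; the fourth replaces that copy of \<open>A\<close> at cost
  \<open>card A / \<rho>\<close>.\<close>

lemma popular_four_sumset:
  fixes A D :: "'a::exponent_two set"
  assumes fin: "finite A" "finite D" and \<rho>: "0 < \<rho>"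
    and pop: "\<And>d. d \<in> D \<Longrightarrow> \<rho> \<le> real (rep A d)"
  shows "\<rho> ^ 4 * real (card (D + (D + (D + D)))) \<le> real (card A) ^ 2 * real (card (A + A)) ^ 3"
proof -
  let ?c = "\<lambda>X. real (card X)"
  have 1: "\<rho> * ?c (A + D) \<le> ?c (A + A) * ?c A"
    using popular_sumset[OF fin(1) fin(1) _ fin(2), of "{0}"] pop by simp
  have 2: "\<rho> * ?c (A + (D + D)) \<le> ?c (A + A) * ?c (A + D)"
    using popular_sumset[OF fin(1) fin(1) fin(2) fin(2)] pop by (simp add: add.assoc)
  have 3: "\<rho> * ?c (A + (D + (D + D))) \<le> ?c (A + A) * ?c (A + (D + D))"
    using popular_sumset[OF fin(1) fin(1) _ fin(2), of "D + D"] fin pop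
    by (simp add: card_set_plus_le add.assoc)
  have 4: "\<rho> * ?c (D + (D + (D + D))) \<le> ?c A * ?c (A + (D + (D + D)))"
    using popular_sumset[OF _ fin(1) _ fin(2), of "{0}" "D + (D + D)"] fin pop
    by (simp add: card_set_plus_le)
  have "\<rho> ^ 4 * ?c (D + (D + (D + D))) = \<rho> ^ 3 * (\<rho> * ?c (D + (D + (D + D))))"
    by (simp add: eval_nat_numeral)
  also have "\<dots> \<le> \<rho> ^ 3 * (?c A * ?c (A + (D + (D + D))))"
    using 4 \<rho> by (intro mult_left_mono) auto
  also have "\<dots> = \<rho> ^ 2 * ?c A * (\<rho> * ?c (A + (D + (D + D))))"
    by (simp add: eval_nat_numeral)
  also have "\<dots> \<le> \<rho> ^ 2 * ?c A * (?c (A + A) * ?c (A + (D + D)))"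
    using 3 \<rho> by (intro mult_left_mono) auto
  also have "\<dots> = \<rho> * ?c A * ?c (A + A) * (\<rho> * ?c (A + (D + D)))"
    by (simp add: eval_nat_numeral)
  also have "\<dots> \<le> \<rho> * ?c A * ?c (A + A) * (?c (A + A) * ?c (A + D))"
    using 2 \<rho> by (intro mult_left_mono) auto
  also have "\<dots> = ?c A * ?c (A + A) ^ 2 * (\<rho> * ?c (A + D))"
    by (simp add: eval_nat_numeral)
  also have "\<dots> \<le> ?c A * ?c (A + A) ^ 2 * (?c (A + A) * ?c A)"
    using 1 by (intro mult_left_mono) auto
  finally show ?thesis by (simp add: eval_nat_numeral algebra_simps)
qed

text \<open>Ruzsa's argument for groups of bounded exponent: \<open>D + D + D\<close> is covered by
  \<open>X + (D + D)\<close> with at most \<open>M\<close> centres. With a small subgroup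
  \<open>W\<close> containing \<open>X\<close>, the set \<open>W + (D + D)\<close> absorbs a further
  copy of \<open>D\<close>, hence is closed under addition.\<close>

lemma exists_subgrp_of_quadrupling:
  fixes D :: "'a::exponent_two set"
  assumes fin: "finite D" and "0 \<in> D"
    and card: "real (card (D + (D + (D + D)))) \<le> M * real (card D)"
  shows "\<exists>V. subgrp V \<and> D \<subseteq> V \<and> real (card V) \<le> 2 powr M * real (card (D + (D + (D + D))))"
proof -
  have "D \<noteq> {}" using \<open>0 \<in> D\<close> by blast
  then have Dpos: "real (card D) > 0" using fin by (simp add: card_gt_0_iff)
  obtain X where X: "X \<subseteq> D + (D + D)" "card X * card D \<le> card (D + (D + D) + D)"
    "D + (D + D) \<subseteq> X + (D + D)"
    using ruzsa_covering[OF _ fin \<open>D \<noteq> {}\<close>, of "D + (D + D)"] fin card_set_plus_le by metis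
  have "real (card X) * real (card D) \<le> real (card (D + (D + (D + D))))"
    using X(2) by (simp add: add.assoc flip: of_nat_mult)
  then have cX: "real (card X) \<le> M" using card Dpos by (meson mult_le_cancel_right_pos order_trans)
  have finX: "finite X" using X(1) fin by (meson card_set_plus_le(1) finite_subset)
  obtain W where W: "subgrp W" "X \<subseteq> W" "card W \<le> 2 ^ card X"
    using exists_subgrp_superset[OF finX] by blast
  let ?V = "W + (D + D)"
  have WW: "W + W \<subseteq> W" using subgrpD(3)[OF W(1)] by (auto simp: set_plus_def)
  have DD: "D \<subseteq> D + D" using \<open>0 \<in> D\<close> by (metis add.right_neutral set_plus_intro subsetI)
  have step: "?V + D \<subseteq> ?V"
  proof -
    have "?V + D = W + (D + (D + D))" by (simp add: add_ac)
    also have "\<dots> \<subseteq> W + (X + (D + D))" by (intro set_plus_mono2 order_refl X(3))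
    also have "\<dots> \<subseteq> W + (W + (D + D))" by (intro set_plus_mono2 order_refl W(2))
    also have "\<dots> = (W + W) + (D + D)" by (simp add: add_ac)
    also have "\<dots> \<subseteq> ?V" by (intro set_plus_mono2 order_refl WW)
    finally show ?thesis .
  qed
  have "?V + ?V \<subseteq> ?V"
  proof -
    have "?V + ?V = (W + W) + (D + D) + D + D" by (simp add: add_ac)
    also have "\<dots> \<subseteq> ?V + D + D" by (intro set_plus_mono2 order_refl WW)
    also have "\<dots> \<subseteq> ?V + D" by (intro set_plus_mono2 order_refl step)
    also have "\<dots> \<subseteq> ?V" by (rule step)
    finally show ?thesis .
  qed
  moreover have "0 \<in> ?V" using subgrpD(2)[OF W(1)] \<open>0 \<in> D\<close> by (metis add.right_neutral set_plus_intro)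
  moreover have "finite ?V" using subgrpD(1)[OF W(1)] fin by (simp add: card_set_plus_le)
  ultimately have V: "subgrp ?V" unfolding subgrp_def by blast
  have "D \<subseteq> ?V"
    using DD subgrpD(2)[OF W(1)] by (metis (no_types, lifting) add.left_neutral set_plus_intro subset_iff)
  have D24: "D + D \<subseteq> D + (D + (D + D))"
    using DD by (metis (no_types, opaque_lifting) order_refl order_trans set_plus_mono2)
  have "real (card ?V) \<le> real (card W) * real (card (D + D))"
    using card_set_plus_le(2)[of W "D + D"] subgrpD(1)[OF W(1)] fin
    by (simp add: card_set_plus_le flip: of_nat_mult)
  also have "\<dots> \<le> 2 powr M * real (card (D + (D + (D + D))))"
  proof (intro mult_mono)
    have "real (card W) \<le> 2 ^ card X" using W(3) by (metis of_nat_le_iff of_nat_numeral of_nat_power)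
    also have "\<dots> = 2 powr real (card X)" by (simp add: powr_realpow)
    also have "\<dots> \<le> 2 powr M" using cX by simp
    finally show "real (card W) \<le> 2 powr M" .
    show "real (card (D + D)) \<le> real (card (D + (D + (D + D))))"
      using D24 fin by (intro of_nat_mono card_mono) (auto simp: card_set_plus_le)
  qed auto
  finally show ?thesis using V \<open>D \<subseteq> ?V\<close> by blast
qed

text \<open>Since only half of the sums have to be caught, the subgroup can be built around the
  popular sums \<open>D\<close> alone, for which \<open>popular_four_sumset\<close> controls
  iterated sums.\<close>

lemma exists_subgrp_of_doubling:
  fixes A :: "'a::exponent_two set"
  assumes fin: "finite A" and ne: "A \<noteq> {}" and K: "real (card (A + A)) \<le> K * real (card A)"
  shows "\<exists>V. subgrp V \<and> real (card V) \<le> 2 powr (32 * K ^ 7) * (16 * K ^ 7 * real (card A)) \<and>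
    real (card A) ^ 2 / 2 \<le> real (card {(a, b) \<in> A \<times> A. a + b \<in> V})"
proof -
  let ?a = "real (card A)"
  have a: "?a > 0" using fin ne by (simp add: card_gt_0_iff)
  have fin2: "finite (A + A)" using fin by (simp add: card_set_plus_le)
  have "card (A + A) \<ge> card A"
  proof -
    obtain x where "x \<in> A" using ne by blast
    then have "(\<lambda>y. x + y) ` A \<subseteq> A + A" by auto
    from card_mono[OF fin2 this] show ?thesis by (simp add: card_image inj_on_def)
  qed
  then have K1: "K \<ge> 1" using K a by (smt (verit) mult_le_cancel_right1 of_nat_le_iff)
  \<comment> \<open>At this threshold the unpopular sums account for at most
    \<open>card (A + A) * \<rho> \<le> ?a ^ 2 / 2\<close> pairs.\<close>
  define \<rho> where "\<rho> = ?a / (2 * K)"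
  have \<rho>: "\<rho> > 0" using a K1 by (simp add: \<rho>_def)
  define D where "D = {d \<in> A + A. \<rho> \<le> real (rep A d)}"
  have finD: "finite D" using fin2 by (simp add: D_def)
  have "0 \<in> D"
  proof -
    obtain x where "x \<in> A" using ne by blast
    then have "0 \<in> A + A" by (metis add_self set_plus_intro)
    moreover have "rep A 0 = card A" by (simp add: rep_def)
    moreover have "\<rho> \<le> ?a" using a K1 by (simp add: \<rho>_def field_simps)
    ultimately show ?thesis by (simp add: D_def)
  qed
  have "card {(x, b) \<in> A \<times> A. x + b \<in> A + A} = card (A \<times> A)"
    by (rule arg_cong[where f = card]) auto
  then have "?a ^ 2 = (\<Sum>d\<in>A + A. real (rep A d))"
    using sum_rep[OF fin fin2] by (simp add: card_cartesian_product power2_eq_square flip: of_nat_mult)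
  also have "\<dots> = (\<Sum>d\<in>D. real (rep A d)) + (\<Sum>d\<in>(A + A) - D. real (rep A d))"
    using sum.subset_diff[of D "A + A"] fin2 by (simp add: D_def add.commute)
  also have "(\<Sum>d\<in>(A + A) - D. real (rep A d)) \<le> (\<Sum>d\<in>(A + A) - D. \<rho>)"
    by (intro sum_mono) (auto simp: D_def)
  also have "\<dots> \<le> real (card (A + A)) * \<rho>"
    using \<rho> fin2 by (auto intro!: mult_right_mono of_nat_mono card_mono)
  also have "\<dots> \<le> K * ?a * \<rho>" using K \<rho> by (intro mult_right_mono) auto
  also have "\<dots> = ?a ^ 2 / 2" using K1 by (simp add: \<rho>_def power2_eq_square)
  finally have mass: "?a ^ 2 / 2 \<le> (\<Sum>d\<in>D. real (rep A d))" by simp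
  \<comment> \<open>No sum has more than \<open>?a\<close> representations, so catching half of the
    pairs forces at least \<open>?a / 2\<close> popular sums.\<close>
  also have "\<dots> \<le> (\<Sum>d\<in>D. ?a)" by (intro sum_mono) (simp add: rep_le[OF fin])
  finally have "?a * ?a \<le> 2 * real (card D) * ?a" by (simp add: power2_eq_square)
  then have cD: "?a \<le> 2 * real (card D)" using a by (simp add: mult_le_cancel_right)
  have "\<rho> ^ 4 * real (card (D + (D + (D + D)))) \<le> ?a ^ 2 * real (card (A + A)) ^ 3"
    by (rule popular_four_sumset[OF fin finD \<rho>]) (simp add: D_def)
  also have "\<dots> \<le> ?a ^ 2 * (K * ?a) ^ 3"
    using K by (intro mult_left_mono power_mono) auto
  \<comment> \<open>The power \<open>K ^ 7\<close> is \<open>K ^ 4\<close> from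
    \<open>\<rho> ^ 4\<close> times \<open>K ^ 3\<close> from the three factors
    \<open>card (A + A)\<close>.\<close>
  also have "\<dots> = \<rho> ^ 4 * (16 * K ^ 7 * ?a)"
    using K1 a by (simp add: \<rho>_def field_simps eval_nat_numeral)
  finally have c4: "real (card (D + (D + (D + D)))) \<le> 16 * K ^ 7 * ?a"
    using \<rho> by (simp add: mult_le_cancel_left)
  also have "\<dots> \<le> 32 * K ^ 7 * real (card D)"
    using mult_left_mono[OF cD, of "16 * K ^ 7"] K1 by simp
  finally obtain V where V: "subgrp V" "D \<subseteq> V"
    "real (card V) \<le> 2 powr (32 * K ^ 7) * real (card (D + (D + (D + D))))"
    using exists_subgrp_of_quadrupling[OF finD \<open>0 \<in> D\<close>] by blast
  have "(\<Sum>d\<in>D. real (rep A d)) \<le> (\<Sum>d\<in>V. real (rep A d))"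
    using V subgrpD(1)[OF V(1)] by (intro sum_mono2) auto
  with mass have "?a ^ 2 / 2 \<le> real (card {(x, b) \<in> A \<times> A. x + b \<in> V})"
    using sum_rep[OF fin subgrpD(1)[OF V(1)]] by simp
  moreover have "real (card V) \<le> 2 powr (32 * K ^ 7) * (16 * K ^ 7 * ?a)"
    using V(3) mult_left_mono[OF c4, of "2 powr (32 * K ^ 7)"] by (meson order_trans powr_ge_zero)
  ultimately show ?thesis using V(1) by blast
qed


section \<open>Sifting by random characters\<close>

lemma exists_ge_weighted_average:
  fixes \<nu> g :: "'x \<Rightarrow> real"
  assumes "finite G" "\<And>x. x \<in> G \<Longrightarrow> 0 \<le> \<nu> x" "sum \<nu> G = 1" "m \<le> (\<Sum>x\<in>G. \<nu> x * g x)"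
  shows "\<exists>x\<in>G. m \<le> g x"
proof (rule ccontr)
  assume "\<not> ?thesis"
  then have lt: "\<And>x. x \<in> G \<Longrightarrow> g x < m" by force
  obtain x where x: "x \<in> G" "\<nu> x \<noteq> 0"
    using assms(3) by (metis sum.not_neutral_contains_not_neutral zero_neq_one)
  have "(\<Sum>x\<in>G. \<nu> x * g x) < (\<Sum>x\<in>G. \<nu> x * m)"
  proof (rule sum_strict_mono_ex1)
    show "\<forall>x\<in>G. \<nu> x * g x \<le> \<nu> x * m" using lt assms(2) by (simp add: less_imp_le mult_left_mono)
    show "\<exists>x\<in>G. \<nu> x * g x < \<nu> x * m" using x lt assms(2) by (intro bexI[of _ x]) (auto simp: less_le)
  qed (rule assms(1))
  also have "\<dots> = m" using assms(3) by (simp flip: sum_distrib_right)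
  finally show False using assms(4) by simp
qed

text \<open>Passing to a random level set of a random character keeps a pair \<open>a, b\<close> with probability
  \<open>(1 + k a b) / 4\<close>, so pairs with small \<open>k\<close> die out faster than the average pair.\<close>

lemma sift_step:
  fixes \<nu> :: "'x \<Rightarrow> real" and ch :: "'x \<Rightarrow> 'a \<Rightarrow> real" and k :: "'a \<Rightarrow> 'a \<Rightarrow> real"
  assumes G: "finite G" "\<And>x. x \<in> G \<Longrightarrow> 0 \<le> \<nu> x" "sum \<nu> G = 1"
    and k: "\<And>a b. a \<in> A \<Longrightarrow> b \<in> A \<Longrightarrow> k a b = (\<Sum>x\<in>G. \<nu> x * (ch x a * ch x b))"
    and pm: "\<And>x a. x \<in> G \<Longrightarrow> a \<in> A \<Longrightarrow> ch x a = 1 \<or> ch x a = -1"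
    and A: "finite A" "\<kappa> * real (card A) ^ 2 \<le> (\<Sum>a\<in>A. \<Sum>b\<in>A. k a b)"
    and \<kappa>: "0 < \<kappa>" and c: "0 \<le> c"
  defines "bad \<equiv> \<lambda>B. {(a, b) \<in> B \<times> B. k a b < \<kappa> / 2}"
  shows "\<exists>B\<subseteq>A. (1 + \<kappa>) / 4 * (real (card A) ^ 2 - c * real (card (bad A)))
    \<le> real (card B) ^ 2 - c * ((1 + \<kappa>) / (1 + \<kappa> / 2)) * real (card (bad B))"
proof -
  \<comment> \<open>A bad pair survives with probability at most
    \<open>(1 + \<kappa> / 2) / 4\<close>, the average pair with at least
    \<open>(1 + \<kappa>) / 4\<close>. The penalty on bad pairs may thus grow by the quotient of
    these numbers while the potential loses only the factor
    \<open>(1 + \<kappa>) / 4\<close>.\<close>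
  define c' where "c' = c * ((1 + \<kappa>) / (1 + \<kappa> / 2))"
  have c': "c' \<ge> 0" "c' * (1 + \<kappa> / 2) = c * (1 + \<kappa>)" using c \<kappa> by (auto simp: c'_def)
  define \<Phi> where "\<Phi> B = real (card B) ^ 2 - c' * real (card (bad B))" for B
  define w where "w a b = 1 - c' * of_bool (k a b < \<kappa> / 2)" for a b
  define lev where "lev x s = {a \<in> A. ch x a = s}" for x s
  have \<Phi>: "\<Phi> B = (\<Sum>a\<in>B. \<Sum>b\<in>B. w a b)" if "finite B" for B
  proof -
    have "bad B = {p \<in> B \<times> B. k (fst p) (snd p) < \<kappa> / 2}" by (auto simp: bad_def)
    then have "real (card (bad B)) = (\<Sum>p\<in>B \<times> B. of_bool (k (fst p) (snd p) < \<kappa> / 2))"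
      using that by (simp add: Int_def of_bool_def sum.If_cases)
    also have "\<dots> = (\<Sum>a\<in>B. \<Sum>b\<in>B. of_bool (k a b < \<kappa> / 2))"
      by (simp add: sum.cartesian_product split_def)
    finally show ?thesis
      by (simp add: \<Phi>_def w_def sum_subtractf power2_eq_square sum_distrib_left)
  qed
  \<comment> \<open>Two elements share a level set exactly when their signs agree, and
    \<open>(1 + ch x a * ch x b) / 2\<close> is the indicator of that.\<close>
  have lev: "\<Phi> (lev x 1) + \<Phi> (lev x (-1)) = (\<Sum>a\<in>A. \<Sum>b\<in>A. w a b * ((1 + ch x a * ch x b) / 2))"
    if x: "x \<in> G" for x
  proof -
    have "\<Phi> (lev x s) = (\<Sum>a\<in>A. \<Sum>b\<in>A. w a b * (of_bool (ch x a = s) * of_bool (ch x b = s)))" for s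
    proof -
      have "\<Phi> (lev x s) = (\<Sum>a\<in>lev x s. \<Sum>b\<in>lev x s. w a b)" using A(1) by (simp add: \<Phi> lev_def)
      also have "\<dots> = (\<Sum>a\<in>lev x s. \<Sum>b\<in>A. w a b * of_bool (ch x b = s))"
        using A(1) by (intro sum.cong refl sum.mono_neutral_cong_left) (auto simp: lev_def)
      also have "\<dots> = (\<Sum>a\<in>A. (\<Sum>b\<in>A. w a b * of_bool (ch x b = s)) * of_bool (ch x a = s))"
        using A(1) by (intro sum.mono_neutral_cong_left) (auto simp: lev_def)
      finally show ?thesis by (simp add: sum_distrib_right sum_distrib_left mult_ac)
    qed
    then have "\<Phi> (lev x 1) + \<Phi> (lev x (-1)) = (\<Sum>a\<in>A. \<Sum>b\<in>A. w a b * (of_bool (ch x a = 1) * of_bool (ch x b = 1)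
        + of_bool (ch x a = -1) * of_bool (ch x b = -1)))"
      by (simp add: sum.distrib distrib_left)
    also have "\<dots> = (\<Sum>a\<in>A. \<Sum>b\<in>A. w a b * ((1 + ch x a * ch x b) / 2))"
    proof (intro sum.cong refl)
      fix a b assume "a \<in> A" "b \<in> A"
      then show "w a b * (of_bool (ch x a = 1) * of_bool (ch x b = 1) + of_bool (ch x a = -1) * of_bool (ch x b = -1))
        = w a b * ((1 + ch x a * ch x b) / 2)"
        using pm[OF x, of a] pm[OF x, of b] by auto
    qed
    finally show ?thesis .
  qed
  have "(1 + \<kappa>) / 4 * (real (card A) ^ 2 - c * real (card (bad A)))
      \<le> (\<Sum>a\<in>A. \<Sum>b\<in>A. w a b * ((1 + k a b) / 4))"
  proof -
    have "real (card (bad A)) = (\<Sum>a\<in>A. \<Sum>b\<in>A. of_bool (k a b < \<kappa> / 2))"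
    proof -
      have "bad A = {p \<in> A \<times> A. k (fst p) (snd p) < \<kappa> / 2}" by (auto simp: bad_def)
      then have "real (card (bad A)) = (\<Sum>p\<in>A \<times> A. of_bool (k (fst p) (snd p) < \<kappa> / 2))"
        using A(1) by (simp add: Int_def of_bool_def sum.If_cases)
      then show ?thesis by (simp add: sum.cartesian_product split_def)
    qed
    then have "c' * ((1 + \<kappa> / 2) / 4) * real (card (bad A)) = (\<Sum>a\<in>A. \<Sum>b\<in>A. c' * of_bool (k a b < \<kappa> / 2) * ((1 + \<kappa> / 2) / 4))"
      by (simp only: sum_distrib_left) (simp add: mult_ac)
    also have "\<dots> \<ge> (\<Sum>a\<in>A. \<Sum>b\<in>A. c' * of_bool (k a b < \<kappa> / 2) * ((1 + k a b) / 4))"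
    proof (intro sum_mono)
      fix a b
      show "c' * of_bool (k a b < \<kappa> / 2) * ((1 + k a b) / 4) \<le> c' * of_bool (k a b < \<kappa> / 2) * ((1 + \<kappa> / 2) / 4)"
        using c'(1) by (cases "k a b < \<kappa> / 2") (auto simp del: times_divide_eq_right intro!: mult_left_mono)
    qed
    finally have "(\<Sum>a\<in>A. \<Sum>b\<in>A. c' * of_bool (k a b < \<kappa> / 2) * ((1 + k a b) / 4)) \<le> c * (1 + \<kappa>) / 4 * real (card (bad A))"
      using c' by (simp add: mult.assoc[symmetric])
    moreover have "(1 + \<kappa>) / 4 * real (card A) ^ 2 \<le> (\<Sum>a\<in>A. \<Sum>b\<in>A. (1 + k a b) / 4)"
      using A(2) by (simp add: sum.distrib add_divide_distrib power2_eq_square algebra_simps flip: sum_divide_distrib)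
    moreover have "(\<Sum>a\<in>A. \<Sum>b\<in>A. w a b * ((1 + k a b) / 4)) = (\<Sum>a\<in>A. \<Sum>b\<in>A. (1 + k a b) / 4)
        - (\<Sum>a\<in>A. \<Sum>b\<in>A. c' * of_bool (k a b < \<kappa> / 2) * ((1 + k a b) / 4))"
      unfolding w_def by (simp only: left_diff_distrib sum_subtractf mult_1)
    moreover have "(1 + \<kappa>) / 4 * (real (card A) ^ 2 - c * real (card (bad A)))
        = (1 + \<kappa>) / 4 * real (card A) ^ 2 - c * (1 + \<kappa>) / 4 * real (card (bad A))"
      by (simp add: field_simps)
    ultimately show ?thesis by linarith
  qed
  also have "\<dots> = (\<Sum>a\<in>A. \<Sum>b\<in>A. w a b * ((\<Sum>x\<in>G. \<nu> x * (1 + ch x a * ch x b)) / 4))"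
    using k G(3) by (intro sum.cong refl) (simp add: distrib_left sum.distrib)
  also have "\<dots> = (\<Sum>a\<in>A. \<Sum>b\<in>A. \<Sum>x\<in>G. \<nu> x * (w a b * ((1 + ch x a * ch x b) / 2) / 2))"
    by (intro sum.cong refl) (simp add: sum_distrib_left sum_divide_distrib field_simps)
  also have "\<dots> = (\<Sum>x\<in>G. \<nu> x * ((\<Sum>a\<in>A. \<Sum>b\<in>A. w a b * ((1 + ch x a * ch x b) / 2)) / 2))"
    by (subst sum.swap, subst sum.swap[of _ A G])
      (simp add: sum.swap[of _ G A] sum_distrib_left sum_divide_distrib)
  also have "\<dots> = (\<Sum>x\<in>G. \<nu> x * ((\<Phi> (lev x 1) + \<Phi> (lev x (-1))) / 2))"
    by (intro sum.cong refl) (simp add: lev)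
  finally have "\<exists>x\<in>G. (1 + \<kappa>) / 4 * (real (card A) ^ 2 - c * real (card (bad A)))
      \<le> (\<Phi> (lev x 1) + \<Phi> (lev x (-1))) / 2"
    by (intro exists_ge_weighted_average[where \<nu> = \<nu>] G)
  then obtain x where x: "x \<in> G" "(1 + \<kappa>) / 4 * (real (card A) ^ 2 - c * real (card (bad A)))
      \<le> (\<Phi> (lev x 1) + \<Phi> (lev x (-1))) / 2"
    by blast
  have "lev x s \<subseteq> A" for s by (auto simp: lev_def)
  moreover have "(1 + \<kappa>) / 4 * (real (card A) ^ 2 - c * real (card (bad A))) \<le> \<Phi> (lev x 1) \<or>
      (1 + \<kappa>) / 4 * (real (card A) ^ 2 - c * real (card (bad A))) \<le> \<Phi> (lev x (-1))"
    using x(2) by argo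
  ultimately show ?thesis unfolding \<Phi>_def c'_def by blast
qed

text \<open>Iterates \<open>sift_step\<close>, raising the penalty on bad pairs in each round. The
  bound \<open>pd\<close> is demanded for all subsets because every round needs the average of
  \<open>k\<close> over the current set to be at least \<open>\<kappa>\<close>.\<close>

lemma sift:
  fixes \<nu> :: "'x \<Rightarrow> real" and ch :: "'x \<Rightarrow> 'a \<Rightarrow> real" and k :: "'a \<Rightarrow> 'a \<Rightarrow> real"
  assumes G: "finite G" "\<And>x. x \<in> G \<Longrightarrow> 0 \<le> \<nu> x" "sum \<nu> G = 1"
    and k: "\<And>a b. a \<in> S \<Longrightarrow> b \<in> S \<Longrightarrow> k a b = (\<Sum>x\<in>G. \<nu> x * (ch x a * ch x b))"
    and pm: "\<And>x a. x \<in> G \<Longrightarrow> a \<in> S \<Longrightarrow> ch x a = 1 \<or> ch x a = -1"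
    and S: "finite S" and pd: "\<And>A. A \<subseteq> S \<Longrightarrow> \<kappa> * real (card A) ^ 2 \<le> (\<Sum>a\<in>A. \<Sum>b\<in>A. k a b)"
    and \<kappa>: "0 < \<kappa>"
  defines "bad \<equiv> \<lambda>B. {(a, b) \<in> B \<times> B. k a b < \<kappa> / 2}"
  shows "\<exists>A\<subseteq>S. ((1 + \<kappa>) / 4) ^ T * (real (card S) ^ 2 / 2)
    \<le> real (card A) ^ 2 - ((1 + \<kappa>) / (1 + \<kappa> / 2)) ^ T / 2 * real (card (bad A))"
proof (induction T)
  case 0
  \<comment> \<open>With initial penalty 1/2 the potential is at least \<open>card S ^ 2 / 2\<close>
    even if every pair is bad.\<close>
  have "card (bad S) \<le> card (S \<times> S)" using S by (intro card_mono) (auto simp: bad_def)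
  then have "real (card (bad S)) \<le> real (card S) ^ 2"
    by (simp add: card_cartesian_product power2_eq_square flip: of_nat_mult)
  then show ?case by (intro exI[of _ S]) simp
next
  case (Suc T)
  let ?p = "(1 + \<kappa>) / 4" and ?r = "(1 + \<kappa>) / (1 + \<kappa> / 2)"
  obtain A where A: "A \<subseteq> S" "?p ^ T * (real (card S) ^ 2 / 2)
      \<le> real (card A) ^ 2 - ?r ^ T / 2 * real (card (bad A))"
    using Suc by blast
  have "\<exists>B\<subseteq>A. ?p * (real (card A) ^ 2 - ?r ^ T / 2 * real (card (bad A)))
    \<le> real (card B) ^ 2 - ?r ^ T / 2 * ?r * real (card (bad B))"
    unfolding bad_def
  proof (rule sift_step[OF G])
    show "k a b = (\<Sum>x\<in>G. \<nu> x * (ch x a * ch x b))" if "a \<in> A" "b \<in> A" for a b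
      using k that A(1) by blast
  qed (use A pm S pd \<kappa> in \<open>auto intro: finite_subset\<close>)
  moreover have "?p * (?p ^ T * (real (card S) ^ 2 / 2)) \<le> ?p * (real (card A) ^ 2 - ?r ^ T / 2 * real (card (bad A)))"
    using A(2) \<kappa> by (intro mult_left_mono) auto
  ultimately obtain B where B: "B \<subseteq> A" "?p * (?p ^ T * (real (card S) ^ 2 / 2)) \<le> real (card B) ^ 2 - ?r ^ T / 2 * ?r * real (card (bad B))"
    by (meson order_trans)
  then show ?case using A(1) by (intro exI[of _ B]) (auto simp: mult_ac)
qed


text \<open>By Markov's inequality most elements of \<open>A\<close> have at most
  \<open>card A / 4\<close> bad partners; these form \<open>B\<close>. Two of them, \<open>a\<close>
  and \<open>a'\<close>, share at least half of \<open>A\<close> as good partners \<open>b\<close>,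
  and each writes \<open>a + a'\<close> as a sum \<open>(a + b) + (a' + b)\<close> of two elements
  of \<open>Z\<close>. Counting pairs in \<open>Z \<times> Z\<close> bounds
  \<open>card (B + B)\<close>.\<close>

lemma small_doubling_of_few_bad:
  fixes A Z :: "'a::exponent_two set"
  assumes fin: "finite A" "finite Z"
    and bad: "16 * card {(a, b) \<in> A \<times> A. a + b \<notin> Z} \<le> card A ^ 2"
  shows "\<exists>B\<subseteq>A. card A \<le> 2 * card B \<and> card (B + B) * card A \<le> 2 * card Z ^ 2"
proof -
  define N where "N a = {b \<in> A. a + b \<notin> Z}" for a
  define B where "B = {a \<in> A. 4 * card (N a) \<le> card A}"
  have finN: "finite (N a)" for a using fin by (simp add: N_def)
  have "{(a, b) \<in> A \<times> A. a + b \<notin> Z} = Sigma A N" by (auto simp: N_def)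
  then have "card {(a, b) \<in> A \<times> A. a + b \<notin> Z} = (\<Sum>a\<in>A. card (N a))"
    using fin finN by simp
  moreover have "card (A - B) * card A \<le> 4 * (\<Sum>a\<in>A. card (N a))"
  proof -
    have "card (A - B) * card A = (\<Sum>a\<in>A - B. card A)" by simp
    also have "\<dots> \<le> (\<Sum>a\<in>A - B. 4 * card (N a))"
      by (intro sum_mono) (auto simp: B_def)
    also have "\<dots> \<le> (\<Sum>a\<in>A. 4 * card (N a))" using fin by (intro sum_mono2) auto
    finally show ?thesis by (simp add: sum_distrib_left)
  qed
  ultimately have "4 * (card (A - B) * card A) \<le> card A * card A"
    using bad unfolding power2_eq_square by linarith
  then have "card A = 0 \<or> 4 * card (A - B) \<le> card A" by (auto simp flip: mult.assoc)
  moreover have "card (A - B) = card A - card B" "card B \<le> card A"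
    using fin by (auto simp: B_def card_Diff_subset card_mono)
  ultimately have cB: "card A \<le> 2 * card B" by linarith
  have rep: "card A \<le> 2 * rep Z d" if dBB: "d \<in> B + B" for d
  proof -
    obtain a a' where d: "a \<in> B" "a' \<in> B" "d = a + a'" using dBB unfolding set_plus_def by blast
    have "card (A - (N a \<union> N a')) \<le> rep Z d"
      unfolding rep_def
    proof (rule card_inj_on_le[where f = "\<lambda>b. a + b"])
      have "a + b + d = a' + b" for b unfolding d(3) by (metis add.assoc add.commute add_self_left)
      then show "(\<lambda>b. a + b) ` (A - (N a \<union> N a')) \<subseteq> {z \<in> Z. z + d \<in> Z}" by (auto simp: N_def)
    qed (use fin in \<open>auto simp: inj_on_def\<close>)
    moreover have "card A - card (N a \<union> N a') \<le> card (A - (N a \<union> N a'))"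
      by (rule diff_card_le_card_Diff) (simp add: finN)
    moreover have "card (N a \<union> N a') \<le> card (N a) + card (N a')" by (rule card_Un_le)
    moreover have "4 * card (N a) \<le> card A" "4 * card (N a') \<le> card A" using d by (auto simp: B_def)
    ultimately show ?thesis by linarith
  qed
  have finB: "finite (B + B)" using fin by (simp add: B_def card_set_plus_le)
  have "card (B + B) * card A = (\<Sum>d\<in>B + B. card A)" by simp
  also have "\<dots> \<le> (\<Sum>d\<in>B + B. 2 * rep Z d)" by (intro sum_mono rep)
  also have "\<dots> = 2 * card {(z, z') \<in> Z \<times> Z. z + z' \<in> B + B}"
    by (simp only: sum_rep[OF fin(2) finB] sum_distrib_left)
  also have "\<dots> \<le> 2 * card (Z \<times> Z)" using fin by (intro mult_left_mono card_mono) auto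
  finally show ?thesis using cB
    by (intro exI[of _ B]) (simp add: B_def card_cartesian_product power2_eq_square)
qed

section \<open>Fourier analysis and the ambiguity function\<close>

text \<open>\<open>X\<close> is a subset of a type, so that spaces of every dimension fit into one
  type. The form \<open>dot\<close> identifies \<open>X\<close> with its dual: points and
  frequencies range over the same set, and \<open>X \<times> X\<close> serves as phase
  space.\<close>

locale f2_space =
  fixes X :: "'v::exponent_two set" and dot :: "'v \<Rightarrow> 'v \<Rightarrow> bool"
  assumes X: "subgrp X"
    and dot_commute: "dot x y = dot y x"
    and dot_add_left: "dot (x + y) z = dot x z + dot y z"
    and dot_nondegenerate: "a \<in> X \<Longrightarrow> a \<noteq> 0 \<Longrightarrow> \<exists>x\<in>X. dot a x \<noteq> 0"
begin

abbreviation N :: real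
  where "N \<equiv> real (card X)"

lemma N_pos: "N > 0"
  using subgrp_card_pos[OF X] by simp

lemma X_nonempty [simp]: "X \<noteq> {}"
  using X by (rule subgrpD)

lemma finX [simp, intro]: "finite X"
  using X by (rule subgrpD)

lemma X_0 [simp, intro]: "0 \<in> X"
  using X by (rule subgrpD)

lemma X_add [simp, intro]: "x \<in> X \<Longrightarrow> y \<in> X \<Longrightarrow> x + y \<in> X"
  using X by (rule subgrpD)

lemma dot_add_right: "dot z (x + y) = dot z x + dot z y"
  by (simp only: dot_commute[of z] dot_add_left)

lemma dot_0 [simp]: "dot 0 x = 0" "dot x 0 = 0"
  by (metis add_self dot_add_left, metis add_self dot_add_right)

definition chi :: "'v \<Rightarrow> 'v \<Rightarrow> real"
  where "chi a x = sg (dot a x)"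

lemma chi_commute: "chi a x = chi x a"
  by (simp add: chi_def dot_commute)

lemma chi_add: "chi (a + b) x = chi a x * chi b x" "chi a (x + y) = chi a x * chi a y"
  by (simp_all add: chi_def dot_add_left dot_add_right)

lemma chi_0 [simp]: "chi 0 x = 1" "chi x 0 = 1"
  by (simp_all add: chi_def)

lemma chi_square [simp]: "chi a x * chi a x = 1" "(chi a x)\<^sup>2 = 1" "chi a x * (chi a x * y) = y"
  by (simp_all add: chi_def flip: mult.assoc)

lemma sum_chi:
  assumes "a \<in> X"
  shows "(\<Sum>x\<in>X. chi a x) = (if a = 0 then N else 0)"
  using sum_character[OF X, of "dot a"] dot_nondegenerate[OF assms]
  by (auto simp: chi_def dot_add_right)

lemma sum_chi_delta:
  assumes "y \<in> X" "z \<in> X"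
  shows "(\<Sum>a\<in>X. chi a (y + z)) = (if y = z then N else 0)"
proof -
  have "y + z = 0 \<longleftrightarrow> y = z" by (metis add_self add_left_inj)
  then show ?thesis using sum_chi[of "y + z"] assms by (simp add: chi_commute)
qed

definition fourier :: "('v \<Rightarrow> real) \<Rightarrow> 'v \<Rightarrow> real"
  where "fourier g a = (\<Sum>x\<in>X. g x * chi a x) / N"

lemma fourier_inversion:
  assumes "x \<in> X"
  shows "g x = (\<Sum>a\<in>X. fourier g a * chi a x)"
proof -
  have "(\<Sum>a\<in>X. fourier g a * chi a x) = (\<Sum>a\<in>X. \<Sum>y\<in>X. g y * chi a (y + x) / N)"
    by (simp add: fourier_def sum_divide_distrib sum_distrib_left sum_distrib_right chi_add mult_ac)
  also have "\<dots> = (\<Sum>y\<in>X. g y * (\<Sum>a\<in>X. chi a (y + x)) / N)"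
    by (subst sum.swap) (simp add: sum_distrib_left sum_divide_distrib)
  also have "\<dots> = (\<Sum>y\<in>X. if y = x then g y else 0)"
    using assms N_pos by (intro sum.cong refl) (simp add: sum_chi_delta)
  also have "\<dots> = g x" using assms by simp
  finally show ?thesis by simp
qed

lemma parseval: "(\<Sum>a\<in>X. (fourier g a)\<^sup>2) = (\<Sum>x\<in>X. (g x)\<^sup>2) / N"
proof -
  have "(\<Sum>a\<in>X. (fourier g a)\<^sup>2) = (\<Sum>a\<in>X. \<Sum>x\<in>X. g x * (fourier g a * chi a x) / N)"
    by (intro sum.cong refl)
      (simp add: power2_eq_square fourier_def[of g] sum_divide_distrib sum_distrib_left mult_ac flip: fourier_def)
  also have "\<dots> = (\<Sum>x\<in>X. g x * (\<Sum>a\<in>X. fourier g a * chi a x) / N)"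
    by (subst sum.swap) (simp add: sum_distrib_left sum_divide_distrib)
  also have "\<dots> = (\<Sum>x\<in>X. (g x)\<^sup>2) / N"
    by (simp add: fourier_inversion[symmetric] power2_eq_square sum_divide_distrib)
  finally show ?thesis .
qed

text \<open>The squared ambiguity function of time-frequency analysis, with shift \<open>h\<close>
  and frequency \<open>a\<close>.\<close>

definition amb :: "('v \<Rightarrow> real) \<Rightarrow> 'v \<Rightarrow> 'v \<Rightarrow> real"
  where "amb f h a = (fourier (\<lambda>x. f x * f (x + h)) a)\<^sup>2"

abbreviation pamb :: "('v \<Rightarrow> real) \<Rightarrow> 'v \<times> 'v \<Rightarrow> real"
  where "pamb f u \<equiv> amb f (fst u) (snd u)"

lemma amb_nonneg [simp]: "0 \<le> amb f h a"
  by (simp add: amb_def)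

lemma amb_expand:
  "amb f h a = (\<Sum>x\<in>X. \<Sum>y\<in>X. f x * f (x + h) * f y * f (y + h) * chi a (x + y)) / N\<^sup>2"
  by (simp add: amb_def fourier_def power_divide power2_eq_square[of "sum _ _"] sum_product chi_add mult_ac)

text \<open>Substituting \<open>y = x + h\<close> in \<open>amb_expand\<close> exposes the
  parallelogram \<open>x, x + h, x + k, x + k + h\<close>, in which \<open>h\<close> and
  \<open>k\<close> play symmetric roles.\<close>

lemma amb_cube:
  assumes "k \<in> X"
  shows "amb f k b = (\<Sum>h\<in>X. \<Sum>x\<in>X. f x * f (x + h) * f (x + k) * f (x + k + h) * chi h b) / N\<^sup>2"
proof -
  have "(\<Sum>h\<in>X. \<Sum>x\<in>X. f x * f (x + h) * f (x + k) * f (x + k + h) * chi h b)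
     = (\<Sum>x\<in>X. \<Sum>h\<in>X. f x * f (x + h) * f (x + k) * f (x + k + h) * chi h b)"
    by (rule sum.swap)
  also have "\<dots> = (\<Sum>x\<in>X. \<Sum>y\<in>X. f x * f y * f (x + k) * f (y + k) * chi (x + y) b)"
  proof (rule sum.cong[OF refl])
    fix x assume x: "x \<in> X"
    have "x + k + (x + y) = y + k" for y by (simp add: add_ac)
    then show "(\<Sum>h\<in>X. f x * f (x + h) * f (x + k) * f (x + k + h) * chi h b)
      = (\<Sum>y\<in>X. f x * f y * f (x + k) * f (y + k) * chi (x + y) b)"
      using sum_translate'[OF X x, of "\<lambda>h. f x * f (x + h) * f (x + k) * f (x + k + h) * chi h b", symmetric]
      by simp
  qed
  finally show ?thesis by (simp add: amb_expand chi_commute[of b] mult_ac)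
qed

text \<open>The character of phase space given by the symplectic form, which appears below as
  \<open>br\<close>: \<open>sch u v = sg (br u v)\<close>.\<close>

definition sch :: "'v \<times> 'v \<Rightarrow> 'v \<times> 'v \<Rightarrow> real"
  where "sch u v = chi (fst u) (snd v) * chi (snd u) (fst v)"

lemma sch_add: "sch u (v + w) = sch u v * sch u w"
  by (simp add: sch_def chi_add)

lemma sch_cases: "sch u v = 1 \<or> sch u v = -1"
  by (auto simp: sch_def chi_def sg_def)

text \<open>Summing over the frequency against \<open>chi a k\<close> forces
  \<open>y = x + k\<close> in \<open>amb_expand\<close>. What remains is the parallelogram sum of
  \<open>amb_cube\<close>, with the roles of the two shifts exchanged.\<close>

lemma amb_self_dual:
  assumes u: "u \<in> X \<times> X"
  shows "pamb f u = (\<Sum>v\<in>X \<times> X. pamb f v * sch v u) / N"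
proof -
  obtain k b where u: "u = (k, b)" "k \<in> X" "b \<in> X" using u by auto
  have "(\<Sum>a\<in>X. amb f h a * (chi h b * chi a k))
      = (\<Sum>x\<in>X. f x * f (x + h) * f (x + k) * f (x + k + h) * chi h b) / N" if h: "h \<in> X" for h
  proof -
    let ?t = "\<lambda>x y. f x * f (x + h) * f y * f (y + h) * chi h b"
    have "(\<Sum>a\<in>X. amb f h a * (chi h b * chi a k)) = (\<Sum>a\<in>X. \<Sum>x\<in>X. \<Sum>y\<in>X. ?t x y * chi a (x + k + y) / N\<^sup>2)"
      by (simp add: amb_expand sum_divide_distrib sum_distrib_left sum_distrib_right chi_add mult_ac)
    also have "\<dots> = (\<Sum>x\<in>X. \<Sum>y\<in>X. \<Sum>a\<in>X. ?t x y * chi a (x + k + y) / N\<^sup>2)"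
      by (subst sum.swap) (intro sum.cong refl sum.swap)
    also have "\<dots> = (\<Sum>x\<in>X. \<Sum>y\<in>X. if x + k = y then ?t x y / N else 0)"
      using u by (intro sum.cong refl)
        (simp add: sum_distrib_left[symmetric] sum_divide_distrib[symmetric] sum_chi_delta power2_eq_square)
    also have "\<dots> = (\<Sum>x\<in>X. ?t x (x + k) / N)"
      using u by (intro sum.cong refl) (simp add: sum.delta')
    finally show ?thesis by (simp add: sum_divide_distrib)
  qed
  then have "(\<Sum>v\<in>X \<times> X. pamb f v * sch v u)
      = (\<Sum>h\<in>X. (\<Sum>x\<in>X. f x * f (x + h) * f (x + k) * f (x + k + h) * chi h b) / N)"
    by (simp add: sum.cartesian_product' sch_def u split_def flip: sum.cartesian_product)
  then show ?thesis
    by (simp add: u amb_cube[OF u(2)] power2_eq_square sum_divide_distrib)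
qed

text \<open>The derivative \<open>f x * f (x + h)\<close> is invariant under translation by
  \<open>h\<close>, while \<open>chi a\<close> changes sign, so the sum equals its own
  negative.\<close>

lemma amb_odd:
  assumes h: "h \<in> X" and "dot h a \<noteq> 0"
  shows "amb f h a = 0"
proof -
  have "chi a h = -1" using assms by (auto simp: chi_def dot_commute sg_def zero_bool_def)
  moreover have "(\<Sum>x\<in>X. f x * f (x + h) * chi a x) = (\<Sum>x\<in>X. f (x + h) * f (x + h + h) * chi a (x + h))"
    using sum_translate[OF X h, of "\<lambda>x. f x * f (x + h) * chi a x"] by simp
  ultimately have "(\<Sum>x\<in>X. f x * f (x + h) * chi a x) = - (\<Sum>x\<in>X. f x * f (x + h) * chi a x)"
    by (simp add: chi_add sum_negf mult_ac)
  then show ?thesis by (simp add: amb_def fourier_def)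
qed

end

locale f2_sign = f2_space +
  fixes f :: "'a \<Rightarrow> real"
  assumes f_pm: "x \<in> X \<Longrightarrow> f x = 1 \<or> f x = -1"
begin

abbreviation F :: "'a \<times> 'a \<Rightarrow> real"
  where "F \<equiv> pamb f"

lemma f_square: "x \<in> X \<Longrightarrow> (f x)\<^sup>2 = 1"
  using f_pm[of x] by auto

lemma sum_amb: "h \<in> X \<Longrightarrow> (\<Sum>a\<in>X. amb f h a) = 1"
  using N_pos by (simp add: amb_def parseval power_mult_distrib f_square)

lemma sum_F: "(\<Sum>u\<in>X \<times> X. F u) = N"
  by (simp add: sum.cartesian_product' sum_amb split_def flip: sum.cartesian_product)

text \<open>Under the density \<open>F / N\<close>, self-duality turns the sum over \<open>A\<close>
  into the mean of \<open>t v = (\<Sum>u\<in>A. sch v u)\<close> and the double sum into the mean of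
  \<open>(t v)\<^sup>2\<close>. The claim is that a variance is nonnegative.\<close>

lemma F_posdef:
  assumes A: "A \<subseteq> X \<times> X"
  shows "(\<Sum>u\<in>A. F u)\<^sup>2 \<le> (\<Sum>u\<in>A. \<Sum>v\<in>A. F (u + v))"
proof -
  define w where "w v = F v / N" for v
  define t where "t v = (\<Sum>u\<in>A. sch v u)" for v
  define m where "m = (\<Sum>u\<in>A. F u)"
  have w: "sum w (X \<times> X) = 1" "\<And>v. 0 \<le> w v"
    using N_pos by (simp_all add: w_def sum_F flip: sum_divide_distrib)
  have dual: "F u = (\<Sum>v\<in>X \<times> X. w v * sch v u)" if "u \<in> X \<times> X" for u
    using amb_self_dual[OF that] by (simp add: w_def sum_divide_distrib)
  have 1: "m = (\<Sum>v\<in>X \<times> X. w v * t v)"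
  proof -
    have "m = (\<Sum>u\<in>A. \<Sum>v\<in>X \<times> X. w v * sch v u)" unfolding m_def using A by (intro sum.cong refl dual) auto
    then show ?thesis by (subst (asm) sum.swap) (simp add: t_def sum_distrib_left)
  qed
  have 2: "(\<Sum>u\<in>A. \<Sum>v\<in>A. F (u + v)) = (\<Sum>v\<in>X \<times> X. w v * (t v)\<^sup>2)"
  proof -
    have "(\<Sum>u\<in>A. \<Sum>v\<in>A. F (u + v)) = (\<Sum>u\<in>A. \<Sum>v\<in>A. \<Sum>z\<in>X \<times> X. w z * (sch z u * sch z v))"
    proof (intro sum.cong refl)
      fix u v assume "u \<in> A" "v \<in> A"
      then have "u + v \<in> X \<times> X" using A by (cases u; cases v) auto
      then show "F (u + v) = (\<Sum>z\<in>X \<times> X. w z * (sch z u * sch z v))"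
        using dual[of "u + v"] by (simp add: sch_add)
    qed
    also have "\<dots> = (\<Sum>u\<in>A. \<Sum>z\<in>X \<times> X. \<Sum>v\<in>A. w z * (sch z u * sch z v))"
      by (intro sum.cong refl sum.swap)
    also have "\<dots> = (\<Sum>z\<in>X \<times> X. \<Sum>u\<in>A. \<Sum>v\<in>A. w z * (sch z u * sch z v))"
      by (rule sum.swap)
    finally show ?thesis
      unfolding t_def power2_eq_square sum_product by (simp add: sum_distrib_left)
  qed
  have "0 \<le> (\<Sum>v\<in>X \<times> X. w v * (t v - m)\<^sup>2)" using w by (intro sum_nonneg) auto
  also have "\<dots> = (\<Sum>v\<in>X \<times> X. w v * (t v)\<^sup>2 - 2 * m * (w v * t v) + m\<^sup>2 * w v)"
    by (intro sum.cong refl) (simp add: power2_eq_square algebra_simps)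
  also have "\<dots> = (\<Sum>v\<in>X \<times> X. w v * (t v)\<^sup>2) - 2 * m * m + m\<^sup>2"
    by (simp add: sum.distrib sum_subtractf flip: sum_distrib_left 1) (simp add: w)
  finally show ?thesis unfolding 2 m_def[symmetric] by (simp add: power2_eq_square)
qed

end

section \<open>Isotropic subgroups and alternating graphs\<close>

context f2_space
begin

text \<open>The quadratic form with polar form \<open>br\<close>; by \<open>amb_odd\<close> the
  ambiguity function is supported on its zeros.\<close>

definition q :: "'v \<times> 'v \<Rightarrow> bool"
  where "q u = dot (fst u) (snd u)"

definition br :: "'v \<times> 'v \<Rightarrow> 'v \<times> 'v \<Rightarrow> bool"
  where "br u v = dot (fst u) (snd v) + dot (snd u) (fst v)"

lemma br_add: "br (u + v) w = br u w + br v w" "br u (v + w) = br u v + br u w"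
  by (simp_all add: br_def dot_add_left dot_add_right add_ac)

lemma q_add: "q (u + v) = q u + q v + br u v"
  unfolding q_def br_def dot_commute[of "snd u"] by (simp add: dot_add_left dot_add_right add_ac)

definition perp :: "('v \<times> 'v) set \<Rightarrow> ('v \<times> 'v) set"
  where "perp V = {w. \<forall>u\<in>V. br u w = 0}"

lemma subgrp_Int_perp:
  assumes "subgrp V"
  shows "subgrp (V \<inter> perp V)"
proof -
  have "br u 0 = 0" for u by (simp add: br_def zero_prod_def)
  moreover have "br u (v + w) = 0" if "br u v = 0" "br u w = 0" for u v w using that by (simp add: br_add)
  ultimately show ?thesis using subgrpD[OF assms] unfolding subgrp_def perp_def by blast
qed

text \<open>No basis is chosen. Extended by zero, the character \<open>sg (\<phi> x)\<close> of
  \<open>H\<close> is a nonzero function, so by Parseval it has a nonzero Fourier coefficient at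
  some \<open>a\<close>. That coefficient is a character sum over \<open>H\<close>, hence its
  character is trivial.\<close>

lemma exists_dot_eq:
  assumes H: "subgrp H" "H \<subseteq> X"
    and hom: "\<And>x y. x \<in> H \<Longrightarrow> y \<in> H \<Longrightarrow> \<phi> (x + y) = \<phi> x + \<phi> y"
  shows "\<exists>a\<in>X. \<forall>x\<in>H. dot a x = \<phi> x"
proof -
  define g where "g x = (if x \<in> H then sg (\<phi> x) else 0)" for x
  have "(\<Sum>x\<in>X. (g x)\<^sup>2) = (\<Sum>x\<in>H. 1)"
    using H by (intro sum.mono_neutral_cong_right) (auto simp: g_def)
  then have "(\<Sum>a\<in>X. (fourier g a)\<^sup>2) \<noteq> 0"
    using subgrp_card_pos[OF H(1)] N_pos by (simp add: parseval)
  then obtain a where a: "a \<in> X" "fourier g a \<noteq> 0" by (force intro: sum.neutral)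
  have "(\<Sum>x\<in>X. g x * chi a x) = (\<Sum>x\<in>H. sg (\<phi> x + dot a x))"
    using H by (intro sum.mono_neutral_cong_right) (auto simp: g_def chi_def)
  then have "(\<Sum>x\<in>H. sg (\<phi> x + dot a x)) \<noteq> 0" using a(2) by (auto simp: fourier_def)
  then have "\<forall>x\<in>H. \<phi> x + dot a x = 0"
    using sum_character[OF H(1), of "\<lambda>x. \<phi> x + dot a x"] by (auto simp: hom dot_add_right add_ac split: if_splits)
  then have "\<forall>x\<in>H. dot a x = \<phi> x" using add_eq_iff[of "\<phi> x" "dot a x" 0 for x] by simp
  then show ?thesis using a(1) by blast
qed

text \<open>The indicator of \<open>H\<close> has Fourier coefficient \<open>card H / N\<close> at
  every point of \<open>U\<close>; Bessel's inequality does the rest.\<close>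

lemma card_orthogonal_le:
  assumes H: "subgrp H" "H \<subseteq> X" and U: "U \<subseteq> X" and orth: "\<And>h u. h \<in> H \<Longrightarrow> u \<in> U \<Longrightarrow> dot u h = 0"
  shows "real (card H) * real (card U) \<le> N"
proof -
  have finU: "finite U" using U by (rule finite_subset) simp
  define g where "g x = (if x \<in> H then 1 else 0 :: real)" for x
  have 1: "(\<Sum>x\<in>X. (g x)\<^sup>2) = real (card H)"
    using sum.mono_neutral_cong_right[of X H "\<lambda>x. (g x)\<^sup>2" "\<lambda>_. 1"] H by (auto simp: g_def)
  have 2: "fourier g u = real (card H) / N" if "u \<in> U" for u
  proof -
    have "(\<Sum>x\<in>X. g x * chi u x) = (\<Sum>x\<in>H. 1)"
      using H orth that by (intro sum.mono_neutral_cong_right) (auto simp: g_def chi_def)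
    then show ?thesis by (simp add: fourier_def)
  qed
  have "(\<Sum>u\<in>U. (real (card H) / N)\<^sup>2) = (\<Sum>u\<in>U. (fourier g u)\<^sup>2)" by (simp add: 2)
  also have "\<dots> \<le> (\<Sum>u\<in>X. (fourier g u)\<^sup>2)" using U by (intro sum_mono2) auto
  also have "\<dots> = real (card H) / N" by (simp add: parseval 1)
  finally have "real (card U) * (real (card H))\<^sup>2 / N\<^sup>2 \<le> real (card H) / N" by (simp add: power_divide)
  then have "real (card U) * (real (card H))\<^sup>2 / N\<^sup>2 * N\<^sup>2 \<le> real (card H) / N * N\<^sup>2"
    by (intro mult_right_mono) auto
  then have "real (card H) * (real (card H) * real (card U)) \<le> real (card H) * N"
    using N_pos by (simp add: power2_eq_square field_simps)
  then show ?thesis using subgrp_card_pos[OF H(1)] by simp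
qed

text \<open>Graphs of linear maps \<open>L\<close>, defined on a subgroup of \<open>X\<close>, with
  \<open>dot x (L x) = 0\<close>. As sets they are extended by plain enlargement; the last clause
  makes the relation single-valued.\<close>

definition alt_graph :: "('v \<times> 'v) set \<Rightarrow> bool"
  where "alt_graph W \<longleftrightarrow> subgrp W \<and> W \<subseteq> X \<times> X \<and> (\<forall>u\<in>W. q u = 0) \<and> (\<forall>a. (0, a) \<in> W \<longrightarrow> a = 0)"

lemma br_eq_0:
  assumes "subgrp W" "\<forall>u\<in>W. q u = 0" "u \<in> W" "v \<in> W"
  shows "br u v = 0"
  using q_add[of u v] assms subgrpD(3)[OF assms(1,3,4)] by simp

lemma alt_graph_extend1:
  assumes W: "alt_graph W" and v: "v \<in> X" "v \<notin> fst ` W"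
  shows "\<exists>W'. alt_graph W' \<and> W \<subset> W'"
proof -
  note W' = W[unfolded alt_graph_def]
  have sub: "subgrp W" using W' by blast
  let ?H = "fst ` W"
  have H: "subgrp ?H" using subgrpD[OF sub] unfolding subgrp_def
  proof (intro conjI ballI)
    show "0 \<in> fst ` W" using subgrpD(2)[OF sub] by (force simp: zero_prod_def)
    fix x y assume "x \<in> fst ` W" "y \<in> fst ` W"
    then obtain u v where "u \<in> W" "v \<in> W" "x = fst u" "y = fst v" by blast
    then show "x + y \<in> fst ` W" using subgrpD(3)[OF sub] by (intro image_eqI[of _ _ "u + v"]) auto
  qed (use subgrpD(1)[OF sub] in simp)
  have HX: "?H \<subseteq> X" using W' by auto
  have uniq: "a = b" if "(h, a) \<in> W" "(h, b) \<in> W" for h a b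
  proof -
    have "(0, a + b) \<in> W" using subgrpD(3)[OF sub that] by (simp add: plus_prod_def)
    then have "a + b = 0" using W' by blast
    then show ?thesis using add_eq_iff[of a b 0] by simp
  qed
  define L where "L h = (THE a. (h, a) \<in> W)" for h
  have L: "(h, a) \<in> W \<Longrightarrow> L h = a" for h a unfolding L_def using uniq by blast
  have Lmem: "(h, L h) \<in> W" if "h \<in> ?H" for h using that L by auto
  have Ladd: "L (h + k) = L h + L k" if "h \<in> ?H" "k \<in> ?H" for h k
    using subgrpD(3)[OF sub Lmem[OF that(1)] Lmem[OF that(2)]] by (simp add: plus_prod_def L)
  let ?H' = "?H \<union> (\<lambda>h. v + h) ` ?H"
  \<comment> \<open>An image \<open>a\<close> of \<open>v\<close> keeps the graph isotropic if
    \<open>dot a h = dot v (L h)\<close> for all \<open>h \<in> ?H\<close> and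
    \<open>dot a v = 0\<close>. Both conditions prescribe values of a single functional on
    \<open>?H'\<close>.\<close>
  define \<phi> where "\<phi> x = (if x \<in> ?H then dot v (L x) else dot v (L (v + x)))" for x
  have H': "subgrp ?H'" by (rule subgrp_adjoin[OF H])
  have vH: "v + h \<notin> ?H" if "h \<in> ?H" for h using subgrp_add_iff(2)[OF H that] v by simp
  have \<phi>1: "\<phi> h = dot v (L h)" "\<phi> (v + h) = dot v (L h)" if "h \<in> ?H" for h
    using vH[OF that] that by (auto simp: \<phi>_def)
  have "\<phi> (x + y) = \<phi> x + \<phi> y" if xy: "x \<in> ?H'" "y \<in> ?H'" for x y
  proof -
    have Hadd: "h + k \<in> ?H" if "h \<in> ?H" "k \<in> ?H" for h k using subgrpD(3)[OF H that] .
    from xy obtain h where h: "h \<in> ?H" "x = h \<or> x = v + h" by blast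
    from xy obtain k where k: "k \<in> ?H" "y = k \<or> y = v + k" by blast
    have e: "h + (v + k) = v + (h + k)" "v + h + k = v + (h + k)" "v + h + (v + k) = h + k"
      by (simp_all add: add_ac)
    note \<phi>1[OF h(1)] \<phi>1[OF k(1)] \<phi>1[OF Hadd[OF h(1) k(1)]] Ladd[OF h(1) k(1)]
    then show ?thesis using h(2) k(2)
      by (elim disjE) (simp_all only: e dot_add_right add_self_left add_self_right')
  qed
  moreover have "?H' \<subseteq> X" using HX v by auto
  ultimately obtain a where a: "a \<in> X" "\<forall>x\<in>?H'. dot a x = \<phi> x"
    using exists_dot_eq[OF H', of \<phi>] by blast
  have av: "dot v a = 0"
  proof -
    have 0: "0 \<in> ?H" using subgrpD(2)[OF H] .
    then have "v + 0 \<in> ?H'" by blast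
    then have "v \<in> ?H'" by simp
    then have "dot a v = \<phi> (v + 0)" using a by simp
    also have "\<dots> = dot v (L 0)" using \<phi>1 0 by blast
    also have "L 0 = 0" using subgrpD(2)[OF sub] by (simp add: L zero_prod_def)
    finally show ?thesis by (simp add: dot_commute)
  qed
  let ?W' = "W \<union> (\<lambda>w. (v, a) + w) ` W"
  have "alt_graph ?W'"
    unfolding alt_graph_def
  proof (intro conjI allI impI ballI)
    show "subgrp ?W'" by (rule subgrp_adjoin[OF sub])
    show "?W' \<subseteq> X \<times> X" using W' v a by (auto simp: plus_prod_def)
    fix u assume u: "u \<in> ?W'"
    show "q u = 0"
    proof (cases "u \<in> W")
      case False
      then obtain h b where hb: "(h, b) \<in> W" "u = (v, a) + (h, b)" using u by auto
      have h: "h \<in> ?H" using hb(1) by force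
      have "q (v, a) = 0" using av by (simp add: q_def)
      moreover have "q (h, b) = 0" using W' hb by blast
      moreover have "br (v, a) (h, b) = dot v b + dot a h" by (simp add: br_def)
      moreover have "dot a h = dot v b" using a(2) h \<phi>1(1)[OF h] L[OF hb(1)] by simp
      ultimately show ?thesis unfolding hb(2) q_add by simp
    qed (use W' in blast)
  next
    fix b assume b: "(0, b) \<in> ?W'"
    have "(0, b) \<in> W"
    proof (rule ccontr)
      assume "(0, b) \<notin> W"
      then obtain h c where "(h, c) \<in> W" "0 = v + h" using b by (auto simp: plus_prod_def)
      then have "(v, c) \<in> W" using add_eq_iff[of v h 0] by simp
      then have "v \<in> ?H" by force
      then show False using v by blast
    qed
    then show "b = 0" using W' by blast
  qed
  moreover have "(v, a) + 0 \<in> ?W'" using subgrpD(2)[OF sub] by blast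
  then have "(v, a) \<in> ?W'" by (simp only: add.right_neutral)
  moreover have "(v, a) \<notin> W" using v by force
  ultimately show ?thesis by blast
qed

lemma alt_graph_extend:
  assumes W: "alt_graph W"
  shows "\<exists>W'. alt_graph W' \<and> W \<subseteq> W' \<and> X \<subseteq> fst ` W'"
proof -
  have "finite {W'. alt_graph W' \<and> W \<subseteq> W'}"
    by (rule finite_subset[of _ "Pow (X \<times> X)"]) (auto simp: alt_graph_def)
  then obtain W' where "alt_graph W'" "W \<subseteq> W'" "\<And>W''. alt_graph W'' \<Longrightarrow> W \<subseteq> W'' \<Longrightarrow> W' \<subseteq> W'' \<Longrightarrow> W' = W''"
    using finite_has_maximal2[of "{W'. alt_graph W' \<and> W \<subseteq> W'}" W] W by auto
  moreover have "X \<subseteq> fst ` W'"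
  proof
    fix v assume "v \<in> X"
    show "v \<in> fst ` W'"
    proof (rule ccontr)
      assume "v \<notin> fst ` W'"
      then obtain W'' where "alt_graph W''" "W' \<subset> W''"
        using alt_graph_extend1[OF \<open>alt_graph W'\<close> \<open>v \<in> X\<close>] by blast
      then show False using calculation by blast
    qed
  qed
  ultimately show ?thesis by blast
qed

text \<open>Take \<open>W\<close> maximal among the alternating graphs in \<open>U\<close>. If
  \<open>u\<close> had no such decomposition, adjoining \<open>u\<close> would create no nonzero
  vertical vector, against maximality.\<close>

lemma exists_graph_complement:
  assumes U: "subgrp U" "U \<subseteq> X \<times> X" "\<forall>u\<in>U. q u = 0"
  shows "\<exists>W\<subseteq>U. alt_graph W \<and> (\<forall>u\<in>U. \<exists>w\<in>W. \<exists>a. (0, a) \<in> U \<and> u = w + (0, a))"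
proof -
  let ?S = "{W. alt_graph W \<and> W \<subseteq> U}"
  have "finite ?S" using subgrpD(1)[OF U(1)] by (auto intro: finite_subset[of _ "Pow U"])
  moreover have "{0} \<in> ?S"
    using subgrpD(2)[OF U(1)] by (auto simp: alt_graph_def subgrp_def q_def) (auto simp: zero_prod_def)
  ultimately obtain W where W: "alt_graph W" "W \<subseteq> U" and max: "\<And>W'. alt_graph W' \<Longrightarrow> W' \<subseteq> U \<Longrightarrow> W \<subseteq> W' \<Longrightarrow> W = W'"
    using finite_has_maximal2[of ?S "{0}"] by auto
  have sub: "subgrp W" using W(1) by (simp add: alt_graph_def)
  have "\<exists>w\<in>W. \<exists>a. (0, a) \<in> U \<and> u = w + (0, a)" if u: "u \<in> U" for u
  proof (rule ccontr)
    assume no: "\<not> ?thesis"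
    let ?W = "W \<union> (\<lambda>w. u + w) ` W"
    have "u \<notin> W"
    proof
      assume "u \<in> W"
      moreover have "(0, 0) \<in> U" "u = u + (0, 0)"
        using subgrpD(2)[OF U(1)] by (simp_all flip: zero_prod_def)
      ultimately show False using no by blast
    qed
    have WU: "?W \<subseteq> U" using W(2) subgrpD(3)[OF U(1) u] by blast
    have "alt_graph ?W" unfolding alt_graph_def
    proof (intro conjI allI impI)
      show "subgrp ?W" by (rule subgrp_adjoin[OF sub])
      show "?W \<subseteq> X \<times> X" "\<forall>u\<in>?W. q u = 0" using WU U by auto
      fix a assume a: "(0, a) \<in> ?W"
      have "(0, a) \<in> W"
      proof (rule ccontr)
        assume "(0, a) \<notin> W"
        then obtain w where w: "w \<in> W" "(0, a) = u + w" using a by auto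
        then have "u = w + (0, a)" by simp
        moreover have "(0, a) \<in> U" using a WU by blast
        ultimately show False using no w by blast
      qed
      then show "a = 0" using W(1) by (simp add: alt_graph_def)
    qed
    then have "?W = W" using max[of ?W] WU by blast
    moreover have "u + 0 \<in> ?W" using subgrpD(2)[OF sub] by blast
    then have "u \<in> ?W" by (simp only: add.right_neutral)
    ultimately show False using \<open>u \<notin> W\<close> by blast
  qed
  then show ?thesis using W by blast
qed

end

context f2_sign
begin

lemma F_eq_0: "u \<in> X \<times> X \<Longrightarrow> q u \<noteq> 0 \<Longrightarrow> F u = 0"
  by (auto simp: q_def amb_odd)

lemma amb_product:
  assumes "h \<in> X"
  shows "(\<Sum>x\<in>X. \<Sum>y\<in>X. f (x + h) * f (x + k) * f (y + h) * f (y + k) * chi a (x + y)) = N\<^sup>2 * amb f (h + k) a"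
proof -
  let ?t = "\<lambda>x y. f x * f (x + (h + k)) * f y * f (y + (h + k)) * chi a (x + y)"
  have eq: "f (x + h) * f (x + k) * f (y + h) * f (y + k) * chi a (x + y) = ?t (x + h) (y + h)" for x y
    by (simp add: add_ac)
  have "(\<Sum>x\<in>X. \<Sum>y\<in>X. ?t (x + h) (y + h)) = (\<Sum>x\<in>X. \<Sum>y\<in>X. ?t (x + h) y)"
    by (intro sum.cong refl sum_translate[OF X assms])
  also have "\<dots> = (\<Sum>x\<in>X. \<Sum>y\<in>X. ?t x y)"
    using sum_translate[OF X assms, of "\<lambda>x. \<Sum>y\<in>X. ?t x y"] .
  finally show ?thesis using N_pos unfolding eq by (simp add: amb_expand)
qed

text \<open>This is the operator inequality \<open>\<langle>Tv, v\<rangle>\<^sup>2 \<le> \<langle>T\<^sup>2v, v\<rangle>\<close> for \<open>v = f \<otimes> f\<close> and the sum \<open>T\<close> of the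
  signed Weyl operators \<open>W\<^sub>u \<otimes> W\<^sub>u\<close>, \<open>u \<in> V\<close>; here \<open>T\<^sup>2\<close> is \<open>|V|\<close> times the same sum over the radical of \<open>V\<close>.\<close>

lemma mass_radical:
  assumes V: "subgrp V" "V \<subseteq> X \<times> X"
  shows "(\<Sum>u\<in>V. F u)\<^sup>2 \<le> real (card V) * (\<Sum>u\<in>V \<inter> perp V. F u)"
proof -
  note finV = subgrpD(1)[OF V(1)]
  define T where "T p = (\<Sum>u\<in>V. sg (q u) * f (fst p + fst u) * f (snd p + fst u) * chi (snd u) (fst p + snd p))" for p
  define c where "c p = f (fst p) * f (snd p)" for p
  \<comment> \<open>The sign costs nothing on the support of \<open>F\<close>. It pays off in the
    square of \<open>T\<close>: the signs at \<open>u\<close> and \<open>u + w\<close> leave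
    \<open>sg (br u w)\<close> in front of \<open>F w\<close>, and this sums over \<open>u\<close>
    to zero unless \<open>w\<close> is in the radical.\<close>
  have sgq: "sg (q u) * F u = F u" if "u \<in> X \<times> X" for u
    using F_eq_0[OF that] by (cases "q u = 0") auto
  have "(\<Sum>u\<in>V. F u) = (\<Sum>u\<in>V. sg (q u) * F u)"
    by (intro sum.cong refl sgq[symmetric]) (use V in blast)
  also have "\<dots> = (\<Sum>u\<in>V. \<Sum>p\<in>X \<times> X. c p * (sg (q u) * f (fst p + fst u) * f (snd p + fst u) * chi (snd u) (fst p + snd p)) / N\<^sup>2)"
    by (simp add: amb_expand sum.cartesian_product c_def sum_divide_distrib sum_distrib_left split_def mult_ac)
  also have "\<dots> = (\<Sum>p\<in>X \<times> X. c p * T p) / N\<^sup>2"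
    by (subst sum.swap) (simp add: T_def sum_distrib_left sum_divide_distrib)
  finally have 1: "(\<Sum>u\<in>V. F u) = (\<Sum>p\<in>X \<times> X. c p * T p) / N\<^sup>2" .
  have "(c p)\<^sup>2 = 1" if "p \<in> X \<times> X" for p
    using that by (auto simp: c_def power_mult_distrib f_square)
  then have cc: "(\<Sum>p\<in>X \<times> X. (c p)\<^sup>2) = N\<^sup>2" by (simp add: card_cartesian_product power2_eq_square)
  have "(\<Sum>p\<in>X \<times> X. (T p)\<^sup>2) = (\<Sum>p\<in>X \<times> X. \<Sum>u\<in>V. \<Sum>v\<in>V. sg (q u) * sg (q v) *
      (f (fst p + fst u) * f (fst p + fst v) * f (snd p + fst u) * f (snd p + fst v) * chi (snd u + snd v) (fst p + snd p)))"
    by (intro sum.cong refl) (simp add: T_def power2_eq_square sum_product chi_add mult_ac)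
  also have "\<dots> = (\<Sum>u\<in>V. \<Sum>v\<in>V. \<Sum>p\<in>X \<times> X. sg (q u) * sg (q v) *
      (f (fst p + fst u) * f (fst p + fst v) * f (snd p + fst u) * f (snd p + fst v) * chi (snd u + snd v) (fst p + snd p)))"
    by (subst sum.swap) (intro sum.cong refl sum.swap)
  also have "\<dots> = (\<Sum>u\<in>V. \<Sum>v\<in>V. N\<^sup>2 * (sg (q u) * sg (q v) * F (u + v)))"
  proof (intro sum.cong refl)
    fix u v assume "u \<in> V" "v \<in> V"
    then have "fst u \<in> X" using V by auto
    from amb_product[OF this, of "fst v" "snd u + snd v"]
    show "(\<Sum>p\<in>X \<times> X. sg (q u) * sg (q v) *
      (f (fst p + fst u) * f (fst p + fst v) * f (snd p + fst u) * f (snd p + fst v) * chi (snd u + snd v) (fst p + snd p)))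
      = N\<^sup>2 * (sg (q u) * sg (q v) * F (u + v))"
      by (simp add: sum.cartesian_product split_def flip: sum_distrib_left)
  qed
  also have "\<dots> = (\<Sum>u\<in>V. \<Sum>w\<in>V. N\<^sup>2 * (sg (q u) * sg (q (u + w)) * F w))"
  proof (rule sum.cong[OF refl])
    fix u assume "u \<in> V"
    from sum_translate'[OF V(1) this, of "\<lambda>v. N\<^sup>2 * (sg (q u) * sg (q v) * F (u + v))", symmetric]
    show "(\<Sum>v\<in>V. N\<^sup>2 * (sg (q u) * sg (q v) * F (u + v)))
      = (\<Sum>w\<in>V. N\<^sup>2 * (sg (q u) * sg (q (u + w)) * F w))"
      by simp
  qed
  also have "\<dots> = (\<Sum>u\<in>V. \<Sum>w\<in>V. N\<^sup>2 * F w * sg (br u w))"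
  proof (intro sum.cong refl)
    fix u w assume "w \<in> V"
    then have 1: "sg (q w) * F w = F w" using V(2) sgq by blast
    have 2: "sg (q u) * sg (q (u + w)) * F w = sg (q u) * sg (q u) * sg (br u w) * (sg (q w) * F w)"
      by (simp add: q_add mult_ac)
    show "N\<^sup>2 * (sg (q u) * sg (q (u + w)) * F w) = N\<^sup>2 * F w * sg (br u w)"
      unfolding 2 1 by simp
  qed
  also have "\<dots> = (\<Sum>w\<in>V. N\<^sup>2 * F w * (\<Sum>u\<in>V. sg (br u w)))"
    by (subst sum.swap) (simp add: sum_distrib_left)
  also have "\<dots> = (\<Sum>w\<in>V. if w \<in> perp V then N\<^sup>2 * real (card V) * F w else 0)"
    by (intro sum.cong refl) (simp add: sum_character[OF V(1)] br_add perp_def)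
  also have "\<dots> = N\<^sup>2 * (real (card V) * (\<Sum>w\<in>V \<inter> perp V. F w))"
    using finV by (simp add: sum.inter_restrict sum_distrib_left mult.assoc if_distrib cong: if_cong)
  finally have TT: "(\<Sum>p\<in>X \<times> X. (T p)\<^sup>2) = N\<^sup>2 * (real (card V) * (\<Sum>w\<in>V \<inter> perp V. F w))" .
  have "(\<Sum>u\<in>V. F u)\<^sup>2 * N\<^sup>2 * N\<^sup>2 = (\<Sum>p\<in>X \<times> X. c p * T p)\<^sup>2"
    unfolding 1 using N_pos by (simp add: power_divide power2_eq_square)
  also have "\<dots> \<le> (\<Sum>p\<in>X \<times> X. (c p)\<^sup>2) * (\<Sum>p\<in>X \<times> X. (T p)\<^sup>2)"
    by (rule Cauchy_Schwarz_ineq_sum)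
  finally have "(\<Sum>u\<in>V. F u)\<^sup>2 * N\<^sup>2 * N\<^sup>2 \<le> (real (card V) * (\<Sum>w\<in>V \<inter> perp V. F w)) * N\<^sup>2 * N\<^sup>2"
    by (simp add: cc TT mult_ac)
  then show ?thesis using N_pos by (simp add: mult_le_cancel_right)
qed

end

section \<open>From large ambiguity to correlation\<close>

text \<open>Here \<open>\<sigma> N\<close> bounds the size of the sifted set from below and \<open>K\<close> bounds its doubling after pruning.\<close>

definition inverse_const :: "real \<Rightarrow> nat \<Rightarrow> real"
  where "inverse_const \<gamma> T = (let \<sigma> = \<gamma> / 2 ^ (T + 1); K = 4 / ((\<gamma>\<^sup>2 / 2)\<^sup>2 * \<sigma>\<^sup>2) in
    \<gamma> ^ 4 * \<sigma> / (8 * (2 powr (32 * K ^ 7) * (16 * K ^ 7))))"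

lemma inverse_const_pos: "0 < \<gamma> \<Longrightarrow> 0 < inverse_const \<gamma> T"
  by (simp add: inverse_const_def Let_def)

context f2_sign
begin

text \<open>Each fibre of the projection to \<open>?H\<close> has mass at most 1, so
  \<open>?H\<close> has at least \<open>c * N\<close> elements. It is orthogonal to the vertical
  part \<open>?U0\<close>, which therefore has at most \<open>1 / c\<close>. Hence at most
  \<open>1 / c\<close> vertical translates of a graph cover \<open>U\<close>, and one of them, the
  translate by \<open>a\<close>, carries mass \<open>c\<^sup>2 * N\<close>.\<close>

lemma exists_alternating_map:
  assumes U: "subgrp U" "U \<subseteq> X \<times> X" "\<forall>u\<in>U. q u = 0"
    and c: "0 < c" "c * N \<le> (\<Sum>u\<in>U. F u)"
  shows "\<exists>L. \<exists>a\<in>X. (\<forall>x\<in>X. L x \<in> X \<and> dot x (L x) = 0) \<and> (\<forall>x\<in>X. \<forall>y\<in>X. L (x + y) = L x + L y)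
    \<and> c\<^sup>2 * N \<le> (\<Sum>h\<in>X. amb f h (L h + a))"
proof -
  have finU: "finite U" using U by (intro subgrpD)
  let ?H = "fst ` U" and ?U0 = "{a. (0, a) \<in> U}"
  have U0X: "?U0 \<subseteq> X" using U(2) by auto
  then have finU0: "finite ?U0" by (rule finite_subset) simp
  have H: "subgrp ?H" unfolding subgrp_def
  proof (intro conjI ballI)
    show "0 \<in> ?H" using subgrpD(2)[OF U(1)] by (force simp: zero_prod_def)
    fix x y assume "x \<in> ?H" "y \<in> ?H"
    then obtain u v where "u \<in> U" "v \<in> U" "x = fst u" "y = fst v" by blast
    then show "x + y \<in> ?H" using subgrpD(3)[OF U(1)] by (intro image_eqI[of _ _ "u + v"]) auto
  qed (use finU in simp)
  have HX: "?H \<subseteq> X" using U(2) by auto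
  have "(\<Sum>u\<in>U. F u) \<le> (\<Sum>u\<in>?H \<times> X. F u)"
    using U(2) finU by (intro sum_mono2) (auto simp: subset_iff intro: rev_image_eqI)
  also have "\<dots> = real (card ?H)"
    using HX by (simp add: sum.cartesian_product' sum_amb subset_iff split_def flip: sum.cartesian_product)
  finally have cH: "c * N \<le> real (card ?H)" using c by linarith
  have "real (card ?H) * real (card ?U0) \<le> N"
  proof (rule card_orthogonal_le[OF H HX U0X])
    fix h a assume h: "h \<in> ?H" and a: "a \<in> ?U0"
    then obtain b where "(h, b) \<in> U" by auto
    then have "br (0, a) (h, b) = 0" using br_eq_0[OF U(1,3)] a by blast
    then show "dot a h = 0" by (simp add: br_def)
  qed
  then have "c * N * real (card ?U0) \<le> N"
    using cH by (meson mult_right_mono of_nat_0_le_iff order_trans)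
  then have cU0: "c * real (card ?U0) \<le> 1" using N_pos by (simp add: field_simps)
  obtain W where W: "W \<subseteq> U" "alt_graph W" and cov: "\<forall>u\<in>U. \<exists>w\<in>W. \<exists>a. (0, a) \<in> U \<and> u = w + (0, a)"
    using exists_graph_complement[OF U] by blast
  obtain W' where W': "alt_graph W'" "W \<subseteq> W'" "X \<subseteq> fst ` W'" using alt_graph_extend[OF W(2)] by blast
  have sub': "subgrp W'" "W' \<subseteq> X \<times> X" using W'(1) by (auto simp: alt_graph_def)
  have finW: "finite W" using W(1) finU by (rule finite_subset)
  have "c * N \<le> (\<Sum>u\<in>(\<lambda>(a, w). w + (0, a)) ` (?U0 \<times> W). F u)"
  proof -
    have "U \<subseteq> (\<lambda>(a, w). w + (0, a)) ` (?U0 \<times> W)" using cov by force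
    then have "(\<Sum>u\<in>U. F u) \<le> (\<Sum>u\<in>(\<lambda>(a, w). w + (0, a)) ` (?U0 \<times> W). F u)"
      using finU0 finW by (intro sum_mono2) auto
    then show ?thesis using c by linarith
  qed
  also have "\<dots> \<le> (\<Sum>p\<in>?U0 \<times> W. F ((\<lambda>(a, w). w + (0, a)) p))"
    using sum_image_le[of "?U0 \<times> W" F "\<lambda>(a, w). w + (0, a)"] finU0 finW by (simp add: o_def)
  also have "\<dots> = (\<Sum>a\<in>?U0. \<Sum>w\<in>W. F (w + (0, a)))"
    by (simp add: sum.cartesian_product split_def)
  finally have tot: "c * N \<le> (\<Sum>a\<in>?U0. \<Sum>w\<in>W. F (w + (0, a)))" .
  have "\<exists>a\<in>?U0. c\<^sup>2 * N \<le> (\<Sum>w\<in>W. F (w + (0, a)))"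
  proof (rule ccontr)
    assume "\<not> ?thesis"
    then have lt: "(\<Sum>w\<in>W. F (w + (0, a))) < c\<^sup>2 * N" if "a \<in> ?U0" for a using that by force
    have "0 \<in> ?U0" using subgrpD(2)[OF U(1)] by (simp add: zero_prod_def)
    then have "(\<Sum>a\<in>?U0. \<Sum>w\<in>W. F (w + (0, a))) < (\<Sum>a\<in>?U0. c\<^sup>2 * N)"
      by (intro sum_strict_mono finU0 lt) auto
    also have "\<dots> = c * N * (c * real (card ?U0))" by (simp add: power2_eq_square)
    also have "\<dots> \<le> c * N * 1" using cU0 c N_pos by (intro mult_left_mono) auto
    finally show False using tot by simp
  qed
  then obtain a where a: "a \<in> ?U0" "c\<^sup>2 * N \<le> (\<Sum>w\<in>W. F (w + (0, a)))" by blast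
  have uniq: "b = b'" if "(h, b) \<in> W'" "(h, b') \<in> W'" for h b b'
  proof -
    have "(0, b + b') \<in> W'" using subgrpD(3)[OF sub'(1) that] by (simp add: plus_prod_def)
    then have "b + b' = 0" using W'(1) by (auto simp: alt_graph_def)
    then show ?thesis using add_eq_iff[of b b' 0] by simp
  qed
  define L where "L h = (THE b. (h, b) \<in> W')" for h
  have L: "L h = b" if "(h, b) \<in> W'" for h b
    unfolding L_def using that uniq[OF _ that] by (rule the_equality)
  have Lmem: "(h, L h) \<in> W'" if hX: "h \<in> X" for h
  proof -
    obtain u where "u \<in> W'" "h = fst u" using hX W'(3) by blast
    then have "(h, snd u) \<in> W'" by simp
    then show ?thesis using L by simp
  qed
  have W'_eq: "W' = (\<lambda>h. (h, L h)) ` X"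
  proof
    show "W' \<subseteq> (\<lambda>h. (h, L h)) ` X"
    proof
      fix u assume u: "u \<in> W'"
      then have "u = (fst u, L (fst u))" "fst u \<in> X" using L[of "fst u" "snd u"] sub'(2) by auto
      then show "u \<in> (\<lambda>h. (h, L h)) ` X" by blast
    qed
  qed (use Lmem in auto)
  have "L (x + y) = L x + L y" if "x \<in> X" "y \<in> X" for x y
    using subgrpD(3)[OF sub'(1) Lmem[OF that(1)] Lmem[OF that(2)]] by (simp add: plus_prod_def L)
  moreover have "L x \<in> X \<and> dot x (L x) = 0" if "x \<in> X" for x
  proof -
    have "q (x, L x) = 0" using W'(1) Lmem[OF that] by (simp add: alt_graph_def)
    then show ?thesis using Lmem[OF that] sub'(2) by (auto simp: q_def)
  qed
  moreover have "c\<^sup>2 * N \<le> (\<Sum>h\<in>X. amb f h (L h + a))"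
  proof -
    have "(\<Sum>w\<in>W. F (w + (0, a))) \<le> (\<Sum>w\<in>W'. F (w + (0, a)))"
      using W'(2) subgrpD(1)[OF sub'(1)] by (intro sum_mono2) auto
    also have "\<dots> = (\<Sum>h\<in>X. amb f h (L h + a))"
      unfolding W'_eq by (subst sum.reindex) (auto simp: inj_on_def)
    finally show ?thesis using a(2) by linarith
  qed
  ultimately show ?thesis using a(1) U0X by blast
qed

text \<open>For \<open>g x = f x * sg (P x)\<close> the polarisation moves the frequency
  \<open>L h + a\<close> of the derivative of \<open>f\<close> to the fixed frequency
  \<open>a\<close> of the derivative of \<open>g\<close>, up to sign. As a function \<open>G\<close>
  of \<open>h\<close> this coefficient has Fourier transform
  \<open>fourier g (a + b) * fourier g b\<close>. By Parseval an average of
  \<open>(fourier g (a + b))\<^sup>2\<close>, with weights \<open>(fourier g b)\<^sup>2\<close> of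
  sum 1, is at least \<open>c\<^sup>2\<close>.\<close>

lemma correlation_of_alternating:
  assumes a: "a \<in> X" and L: "\<And>h. h \<in> X \<Longrightarrow> L h \<in> X"
    and P: "\<And>x h. x \<in> X \<Longrightarrow> h \<in> X \<Longrightarrow> P (x + h) = P x + P h + dot (L h) x"
    and c: "0 \<le> c" "c\<^sup>2 * N \<le> (\<Sum>h\<in>X. amb f h (L h + a))"
  shows "\<exists>b\<in>X. c \<le> \<bar>\<Sum>x\<in>X. f x * sg (P x + dot b x)\<bar> / N"
proof -
  define g where "g x = f x * sg (P x)" for x
  have g2: "(g x)\<^sup>2 = 1" if "x \<in> X" for x using that by (simp add: g_def power_mult_distrib f_square)
  define G where "G h = fourier (\<lambda>x. g x * g (x + h)) a" for h
  have G: "(G h)\<^sup>2 = amb f h (L h + a)" if h: "h \<in> X" for h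
  proof -
    have "(\<Sum>x\<in>X. g x * g (x + h) * chi a x) = (\<Sum>x\<in>X. sg (P h) * (f x * f (x + h) * chi (L h + a) x))"
    proof (rule sum.cong[OF refl])
      fix x assume "x \<in> X"
      have "g x * g (x + h) * chi a x = sg (P x) * sg (P x) * (sg (P h) * (f x * f (x + h) * chi (L h + a) x))"
        using P[OF \<open>x \<in> X\<close> h] by (simp add: g_def chi_def dot_add_left mult_ac)
      then show "g x * g (x + h) * chi a x = sg (P h) * (f x * f (x + h) * chi (L h + a) x)" by simp
    qed
    then have "G h = sg (P h) * fourier (\<lambda>x. f x * f (x + h)) (L h + a)"
      by (simp add: G_def fourier_def sum_distrib_left)
    then show ?thesis by (simp add: amb_def power_mult_distrib)
  qed
  have FG: "fourier G b = fourier g (a + b) * fourier g b" for b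
  proof -
    have "(\<Sum>h\<in>X. G h * chi b h) = (\<Sum>h\<in>X. \<Sum>x\<in>X. g x * g (x + h) * chi a x * chi b h / N)"
      by (simp add: G_def fourier_def sum_divide_distrib sum_distrib_right)
    also have "\<dots> = (\<Sum>x\<in>X. \<Sum>h\<in>X. g x * g (x + h) * chi a x * chi b h / N)" by (rule sum.swap)
    also have "\<dots> = (\<Sum>x\<in>X. \<Sum>y\<in>X. g x * g y * chi a x * chi b (x + y) / N)"
    proof (rule sum.cong[OF refl])
      fix x assume "x \<in> X"
      from sum_translate'[OF X this, of "\<lambda>h. g x * g (x + h) * chi a x * chi b h / N", symmetric]
      show "(\<Sum>h\<in>X. g x * g (x + h) * chi a x * chi b h / N) = (\<Sum>y\<in>X. g x * g y * chi a x * chi b (x + y) / N)"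
        by simp
    qed
    also have "\<dots> = (\<Sum>x\<in>X. g x * chi (a + b) x) * (\<Sum>y\<in>X. g y * chi b y) / N"
      unfolding sum_product by (simp add: sum_divide_distrib chi_add mult_ac)
    finally show ?thesis by (simp add: fourier_def)
  qed
  have "c\<^sup>2 \<le> (\<Sum>h\<in>X. (G h)\<^sup>2) / N" using c(2) N_pos by (simp add: G field_simps)
  also have "\<dots> = (\<Sum>b\<in>X. (fourier g b)\<^sup>2 * (fourier g (a + b))\<^sup>2)"
    by (simp add: parseval[symmetric] FG power_mult_distrib mult.commute)
  finally obtain b where b: "b \<in> X" "c\<^sup>2 \<le> (fourier g (a + b))\<^sup>2"
    using exists_ge_weighted_average[of X "\<lambda>b. (fourier g b)\<^sup>2" "c\<^sup>2" "\<lambda>b. (fourier g (a + b))\<^sup>2"] N_pos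
    by (auto simp: parseval g2)
  have "c \<le> \<bar>fourier g (a + b)\<bar>" using b(2) c(1) by (simp add: abs_le_square_iff[symmetric])
  also have "fourier g (a + b) = (\<Sum>x\<in>X. f x * sg (P x + dot (a + b) x)) / N"
    by (simp add: fourier_def g_def chi_def mult_ac)
  finally show ?thesis using a b(1) by (intro bexI[of _ "a + b"]) auto
qed

lemma exists_structured_alternating_map:
  assumes \<gamma>: "0 < \<gamma>" and T: "32 \<le> ((1 + \<gamma>\<^sup>2) / (1 + \<gamma>\<^sup>2 / 2)) ^ T"
    and big: "\<gamma> * N \<le> real (card {u \<in> X \<times> X. \<gamma> \<le> F u})"
  shows "\<exists>L. \<exists>a\<in>X. (\<forall>x\<in>X. L x \<in> X \<and> dot x (L x) = 0) \<and> (\<forall>x\<in>X. \<forall>y\<in>X. L (x + y) = L x + L y)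
    \<and> (inverse_const \<gamma> T)\<^sup>2 * N \<le> (\<Sum>h\<in>X. amb f h (L h + a))"
proof -
  define S where "S = {u \<in> X \<times> X. \<gamma> \<le> F u}"
  define \<kappa> where "\<kappa> = \<gamma>\<^sup>2"
  \<comment> \<open>Sifting loses at most \<open>4 ^ T\<close> in the squared size, thus
    \<open>2 ^ T\<close> in the size; the extra 2 absorbs the square root of the initial factor
    1/2.\<close>
  define \<sigma> where "\<sigma> = \<gamma> / 2 ^ (T + 1)"
  \<comment> \<open>Results from \<open>card (B + B) * card A \<le> 2 * card Z ^ 2\<close> with
    \<open>card Z \<le> N / (\<kappa> / 2)\<close> and \<open>\<sigma> * N \<le> card A\<close>; a
    second factor 2 comes from \<open>card A \<le> 2 * card B\<close>.\<close>
  define K where "K = 4 / ((\<gamma>\<^sup>2 / 2)\<^sup>2 * \<sigma>\<^sup>2)"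
  define C where "C = 2 powr (32 * K ^ 7) * (16 * K ^ 7)"
  have \<kappa>: "0 < \<kappa>" using \<gamma> by (simp add: \<kappa>_def)
  have \<sigma>: "0 < \<sigma>" using \<gamma> by (simp add: \<sigma>_def)
  have K: "0 < K" using \<gamma> \<sigma> by (simp add: K_def)
  have C: "0 < C" using K by (simp add: C_def)
  have SX: "S \<subseteq> X \<times> X" by (auto simp: S_def)
  have finS: "finite S" by (rule finite_subset[OF SX]) simp
  have pd: "\<kappa> * (real (card A))\<^sup>2 \<le> (\<Sum>a\<in>A. \<Sum>b\<in>A. F (a + b))" if "A \<subseteq> S" for A
  proof -
    have "\<gamma> * real (card A) \<le> (\<Sum>a\<in>A. F a)"
      using sum_mono[of A "\<lambda>_. \<gamma>" F] that by (auto simp: S_def mult.commute)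
    then have "(\<gamma> * real (card A))\<^sup>2 \<le> (\<Sum>a\<in>A. F a)\<^sup>2" using \<gamma> by (intro power_mono) auto
    also have "\<dots> \<le> (\<Sum>a\<in>A. \<Sum>b\<in>A. F (a + b))" using that SX by (intro F_posdef) auto
    finally show ?thesis by (simp add: \<kappa>_def power_mult_distrib)
  qed
  have "\<exists>A\<subseteq>S. ((1 + \<kappa>) / 4) ^ T * (real (card S) ^ 2 / 2)
    \<le> real (card A) ^ 2 - ((1 + \<kappa>) / (1 + \<kappa> / 2)) ^ T / 2 * real (card {(a, b) \<in> A \<times> A. F (a + b) < \<kappa> / 2})"
  proof (rule sift[where G = "X \<times> X" and \<nu> = "\<lambda>v. F v / N" and ch = sch])
    show "(\<Sum>v\<in>X \<times> X. F v / N) = 1" using N_pos by (simp add: sum_F flip: sum_divide_distrib)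
    show "F (u + v) = (\<Sum>x\<in>X \<times> X. F x / N * (sch x u * sch x v))" if "u \<in> S" "v \<in> S" for u v
    proof -
      have "u + v \<in> X \<times> X" using that SX by (cases u; cases v) auto
      from amb_self_dual[OF this, of f] show ?thesis by (simp add: sch_add sum_divide_distrib)
    qed
  qed (use finS pd \<kappa> sch_cases N_pos in auto)
  then obtain A where A: "A \<subseteq> S" and A2: "((1 + \<kappa>) / 4) ^ T * (real (card S) ^ 2 / 2)
    \<le> real (card A) ^ 2 - ((1 + \<kappa>) / (1 + \<kappa> / 2)) ^ T / 2 * real (card {(a, b) \<in> A \<times> A. F (a + b) < \<kappa> / 2})"
    by blast
  let ?bad = "{(a, b) \<in> A \<times> A. F (a + b) < \<kappa> / 2}"
  have finA: "finite A" using A finS by (rule finite_subset)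
  have fbad: "finite ?bad" by (rule finite_subset[of _ "A \<times> A"]) (use finA in auto)
  \<comment> \<open>The 32 in the choice of \<open>T\<close>, halved by the initial penalty, is the
    16 that \<open>small_doubling_of_few_bad\<close> asks for.\<close>
  have r: "16 * real (card ?bad) \<le> ((1 + \<kappa>) / (1 + \<kappa> / 2)) ^ T / 2 * real (card ?bad)"
    using T by (intro mult_right_mono) (auto simp: \<kappa>_def)
  have cA: "\<sigma> * N \<le> real (card A)"
  proof -
    have "(1 / 4) ^ T \<le> ((1 + \<kappa>) / 4) ^ T" using \<kappa> by (intro power_mono) auto
    then have "(1 / 4) ^ T * (real (card S) ^ 2 / 2) \<le> ((1 + \<kappa>) / 4) ^ T * (real (card S) ^ 2 / 2)"
      by (intro mult_right_mono) auto
    also have "\<dots> \<le> real (card A) ^ 2" using A2 r by linarith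
    finally have *: "(1 / 4) ^ T * (real (card S) ^ 2 / 2) \<le> real (card A) ^ 2" .
    have "(real (card S) / 2 ^ (T + 1))\<^sup>2 = (1 / 4) ^ T * (real (card S) ^ 2 / 4)"
      by (simp add: power_divide power_mult_distrib power2_eq_square field_simps flip: power_mult_distrib)
    also have "\<dots> \<le> (1 / 4) ^ T * (real (card S) ^ 2 / 2)" by (intro mult_left_mono) auto
    finally have "(real (card S) / 2 ^ (T + 1))\<^sup>2 \<le> (real (card A))\<^sup>2" using * by linarith
    then have "real (card S) / 2 ^ (T + 1) \<le> real (card A)" by (rule power2_le_imp_le) simp
    moreover have "\<gamma> * N / 2 ^ (T + 1) \<le> real (card S) / 2 ^ (T + 1)"
      using big by (intro divide_right_mono) (auto simp: S_def)
    ultimately show ?thesis by (simp add: \<sigma>_def)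
  qed
  define Z where "Z = {u \<in> X \<times> X. \<kappa> / 2 \<le> F u}"
  have finZ: "finite Z" by (rule finite_subset[of _ "X \<times> X"]) (auto simp: Z_def)
  have cZ: "\<kappa> / 2 * real (card Z) \<le> N"
  proof -
    have "\<kappa> / 2 * real (card Z) = (\<Sum>u\<in>Z. \<kappa> / 2)" by simp
    also have "\<dots> \<le> (\<Sum>u\<in>Z. F u)" by (intro sum_mono) (auto simp: Z_def)
    also have "\<dots> \<le> (\<Sum>u\<in>X \<times> X. F u)" by (intro sum_mono2) (auto simp: Z_def)
    finally show ?thesis by (simp add: sum_F)
  qed
  have "{(a, b) \<in> A \<times> A. a + b \<notin> Z} \<subseteq> ?bad"
  proof
    fix p assume "p \<in> {(a, b) \<in> A \<times> A. a + b \<notin> Z}"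
    then obtain a b where ab: "p = (a, b)" "a \<in> A" "b \<in> A" "a + b \<notin> Z" by blast
    then have "a + b \<in> X \<times> X" using A SX by (cases a; cases b) auto
    then have "F (a + b) < \<kappa> / 2" using ab(4) unfolding Z_def by force
    then show "p \<in> ?bad" using ab by blast
  qed
  then have "card {(a, b) \<in> A \<times> A. a + b \<notin> Z} \<le> card ?bad" by (rule card_mono[OF fbad])
  moreover have "16 * real (card ?bad) \<le> real (card A) ^ 2"
  proof -
    have "0 \<le> ((1 + \<kappa>) / 4) ^ T * (real (card S) ^ 2 / 2)" using \<kappa> by simp
    then show ?thesis using A2 r by linarith
  qed
  then have "16 * card ?bad \<le> card A ^ 2"
    using of_nat_le_iff[of "16 * card ?bad" "card A ^ 2", where 'a = real] by simp
  ultimately have "16 * card {(a, b) \<in> A \<times> A. a + b \<notin> Z} \<le> card A ^ 2" by linarith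
  then obtain B where B: "B \<subseteq> A" "card A \<le> 2 * card B" "card (B + B) * card A \<le> 2 * card Z ^ 2"
    using small_doubling_of_few_bad[OF finA finZ] by blast
  have finB: "finite B" using B(1) finA by (rule finite_subset)
  have BX: "B \<subseteq> X \<times> X" using B A SX by blast
  have cAB: "real (card A) \<le> 2 * real (card B)" using B(2) by (simp flip: of_nat_mult)
  have Apos: "0 < real (card A)" using cA \<sigma> N_pos by (meson less_le_trans mult_pos_pos)
  then have Bpos: "0 < real (card B)" using cAB by linarith
  then have Bne: "B \<noteq> {}" by auto
  have "real (card (B + B)) \<le> K * real (card B)"
  proof -
    have Aadd: "real (card (B + B)) * real (card A) \<le> 2 * real (card Z) ^ 2"
      using B(3) by (simp flip: of_nat_mult of_nat_power)
    have "real (card Z) \<le> N / (\<kappa> / 2)" using cZ \<kappa> by (simp add: field_simps)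
    also have "\<dots> \<le> real (card A) / \<sigma> / (\<kappa> / 2)"
      using cA \<sigma> \<kappa> by (intro divide_right_mono) (auto simp: field_simps)
    finally have "real (card Z) ^ 2 \<le> (real (card A) / \<sigma> / (\<kappa> / 2))\<^sup>2" by (intro power_mono) auto
    also have "\<dots> = real (card A) ^ 2 * K / 4"
      using \<sigma> \<kappa> by (simp add: K_def \<kappa>_def power_divide power_mult_distrib field_simps)
    finally have "2 * real (card Z) ^ 2 \<le> real (card A) ^ 2 * K / 2" by simp
    also have "\<dots> = (real (card A) * K / 2) * real (card A)" by (simp add: power2_eq_square)
    finally have "real (card (B + B)) * real (card A) \<le> (real (card A) * K / 2) * real (card A)"
      using Aadd by linarith
    then have "real (card (B + B)) \<le> real (card A) * K / 2" using Apos by (rule mult_right_le_imp_le)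
    also have "\<dots> \<le> 2 * real (card B) * K / 2" using cAB K by (intro divide_right_mono mult_right_mono) auto
    finally show ?thesis by (simp add: mult.commute)
  qed
  then obtain V0 where V0: "subgrp V0" "real (card V0) \<le> C * real (card B)"
    "real (card B) ^ 2 / 2 \<le> real (card {(a, b) \<in> B \<times> B. a + b \<in> V0})"
    using exists_subgrp_of_doubling[OF finB Bne, of K] by (auto simp: C_def mult.assoc)
  \<comment> \<open>Cutting back to phase space loses no sums of elements of
    \<open>B\<close>.\<close>
  define V where "V = V0 \<inter> X \<times> X"
  have V: "subgrp V" "V \<subseteq> X \<times> X"
    using V0(1) by (auto simp: V_def subgrp_def zero_prod_def)
  have "card V \<le> card V0" using subgrpD(1)[OF V0(1)] by (intro card_mono) (auto simp: V_def)
  then have cV: "real (card V) \<le> C * real (card B)" using V0(2) by linarith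
  \<comment> \<open>By pigeonhole some coset \<open>a + V\<close> contains half of \<open>B\<close>.
    Sums of two elements of that half lie in \<open>V\<close>, so positive definiteness on it bounds
    the mass of \<open>V\<close> from below.\<close>
  have "\<exists>a\<in>B. real (card B) / 2 \<le> real (card {b \<in> B. a + b \<in> V})"
  proof (rule ccontr)
    assume "\<not> ?thesis"
    then have lt: "real (card {b \<in> B. a + b \<in> V}) < real (card B) / 2" if "a \<in> B" for a using that by force
    have "{(a, b) \<in> B \<times> B. a + b \<in> V0} = (SIGMA a:B. {b \<in> B. a + b \<in> V})"
    proof -
      have "a + b \<in> X \<times> X" if "a \<in> B" "b \<in> B" for a b using that BX by (cases a; cases b) auto
      then show ?thesis by (auto simp: V_def simp del: plus_prod_def mem_Sigma_iff)
    qed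
    then have "real (card {(a, b) \<in> B \<times> B. a + b \<in> V0}) = (\<Sum>a\<in>B. real (card {b \<in> B. a + b \<in> V}))"
      using finB by simp
    also have "\<dots> < (\<Sum>a\<in>B. real (card B) / 2)" by (intro sum_strict_mono finB Bne lt)
    finally show False using V0(3) by (simp add: power2_eq_square)
  qed
  then obtain a where a: "a \<in> B" "real (card B) / 2 \<le> real (card {b \<in> B. a + b \<in> V})" by blast
  define D where "D = {b \<in> B. a + b \<in> V}"
  have Dpos: "0 < real (card D)" using a(2) Bpos by (simp add: D_def)
  have "(\<Sum>b'\<in>D. F (b + b')) \<le> (\<Sum>u\<in>V. F u)" if b: "b \<in> D" for b
  proof -
    have "b + b' \<in> V" if "b' \<in> D" for b'
    proof -
      have "(a + b) + (a + b') \<in> V" using b that by (auto simp: D_def simp del: plus_prod_def intro: subgrpD(3)[OF V(1)])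
      moreover have "(a + b) + (a + b') = b + b'" by (simp add: add_ac)
      ultimately show ?thesis by simp
    qed
    then have "(\<lambda>b'. b + b') ` D \<subseteq> V" by blast
    then have "(\<Sum>u\<in>(\<lambda>b'. b + b') ` D. F u) \<le> (\<Sum>u\<in>V. F u)"
      using subgrpD(1)[OF V(1)] by (intro sum_mono2) auto
    then show ?thesis by (subst (asm) sum.reindex) (auto simp: inj_on_def)
  qed
  then have "(\<Sum>b\<in>D. \<Sum>b'\<in>D. F (b + b')) \<le> real (card D) * (\<Sum>u\<in>V. F u)"
    using sum_mono[of D "\<lambda>b. \<Sum>b'\<in>D. F (b + b')" "\<lambda>_. \<Sum>u\<in>V. F u"] by simp
  moreover have "\<kappa> * (real (card D))\<^sup>2 \<le> (\<Sum>b\<in>D. \<Sum>b'\<in>D. F (b + b'))"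
    using B A by (intro pd) (auto simp: D_def)
  ultimately have "real (card D) * (\<kappa> * real (card D)) \<le> real (card D) * (\<Sum>u\<in>V. F u)"
    by (simp add: power2_eq_square mult_ac)
  then have "\<kappa> * real (card D) \<le> (\<Sum>u\<in>V. F u)" using Dpos by (rule mult_left_le_imp_le)
  moreover have "\<kappa> * (real (card B) / 2) \<le> \<kappa> * real (card D)"
    using a(2) \<kappa> by (intro mult_left_mono) (auto simp: D_def)
  ultimately have mV: "\<kappa> * (real (card B) / 2) \<le> (\<Sum>u\<in>V. F u)" by linarith
  define R where "R = V \<inter> perp V"
  have R: "subgrp R" unfolding R_def by (rule subgrp_Int_perp[OF V(1)])
  have RV: "R \<subseteq> V" by (simp add: R_def)
  have "(\<kappa> * (real (card B) / 2))\<^sup>2 \<le> (\<Sum>u\<in>V. F u)\<^sup>2" using mV \<kappa> by (intro power_mono) auto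
  also have "\<dots> \<le> real (card V) * (\<Sum>u\<in>R. F u)" unfolding R_def by (rule mass_radical[OF V])
  also have "\<dots> \<le> C * real (card B) * (\<Sum>u\<in>R. F u)" using cV by (intro mult_right_mono sum_nonneg) auto
  finally have "real (card B) * (\<kappa>\<^sup>2 * real (card B) / (4 * C)) \<le> real (card B) * (\<Sum>u\<in>R. F u)"
    using C by (simp add: power2_eq_square field_simps)
  then have mR: "\<kappa>\<^sup>2 * real (card B) / (4 * C) \<le> (\<Sum>u\<in>R. F u)" using Bpos by (rule mult_left_le_imp_le)
  \<comment> \<open>On \<open>R\<close> the form \<open>br\<close> vanishes and \<open>q\<close> is
    additive, so this is a subgroup; it keeps all the mass of \<open>R\<close> because
    \<open>F\<close> vanishes where \<open>q\<close> does not.\<close>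
  define U where "U = {u \<in> R. q u = 0}"
  have "inverse_const \<gamma> T * N = \<kappa>\<^sup>2 * (\<sigma> * N / 2) / (4 * C)"
    unfolding inverse_const_def Let_def \<sigma>_def[symmetric] K_def[symmetric] C_def[symmetric]
    by (simp add: \<kappa>_def field_simps flip: power_mult)
  also have "\<dots> \<le> \<kappa>\<^sup>2 * real (card B) / (4 * C)"
    using cA cAB C by (intro divide_right_mono mult_left_mono) auto
  also have "\<dots> \<le> (\<Sum>u\<in>R. F u)" by (rule mR)
  also have "\<dots> = (\<Sum>u\<in>U. F u)"
    by (rule sum.mono_neutral_right) (use R RV V(2) F_eq_0 in \<open>auto simp: U_def subgrp_def\<close>)
  finally have mU: "inverse_const \<gamma> T * N \<le> (\<Sum>u\<in>U. F u)" .
  have "subgrp U"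
  proof -
    have "q (u + v) = 0" if "u \<in> U" "v \<in> U" for u v
    proof -
      have "br u v = 0" using that RV by (auto simp: U_def R_def perp_def)
      then show ?thesis using that by (simp add: U_def q_add)
    qed
    moreover have "q 0 = 0" by (simp add: q_def zero_prod_def)
    ultimately show ?thesis using R by (auto simp: U_def subgrp_def)
  qed
  moreover have "U \<subseteq> X \<times> X" "\<forall>u\<in>U. q u = 0" using RV V(2) by (auto simp: U_def)
  ultimately show ?thesis using mU inverse_const_pos[OF \<gamma>] by (intro exists_alternating_map)
qed

end

section \<open>The acceptance probability\<close>

context f2_space
begin

text \<open>In frequency space the sum is diagonal, with terms
  \<open>fourier g a * fourier b a * fourier c a\<close>. Once \<open>m\<close> is taken out, the
  product of the other two is handled by the arithmetic-geometric mean inequality and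
  Parseval.\<close>

lemma bilinear_bound:
  assumes b: "\<And>x. x \<in> X \<Longrightarrow> \<bar>b x\<bar> \<le> 1" and c: "\<And>x. x \<in> X \<Longrightarrow> \<bar>c x\<bar> \<le> 1"
    and m: "\<And>a. a \<in> X \<Longrightarrow> \<bar>fourier g a\<bar> \<le> m"
  shows "(\<Sum>x\<in>X. \<Sum>y\<in>X. b x * c y * g (x + y)) \<le> m * N\<^sup>2"
proof -
  have m0: "0 \<le> m" using m[of 0] by (meson X_0 abs_ge_zero order_trans)
  have norm: "(\<Sum>a\<in>X. (fourier u a)\<^sup>2) \<le> 1" if "\<And>x. x \<in> X \<Longrightarrow> \<bar>u x\<bar> \<le> 1" for u
  proof -
    have "(\<Sum>x\<in>X. (u x)\<^sup>2) \<le> (\<Sum>x\<in>X. 1)" by (intro sum_mono) (simp add: that abs_square_le_1)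
    then show ?thesis using N_pos by (simp add: parseval)
  qed
  have "(\<Sum>x\<in>X. \<Sum>y\<in>X. b x * c y * g (x + y)) = (\<Sum>x\<in>X. \<Sum>y\<in>X. \<Sum>a\<in>X. fourier g a * (b x * chi a x) * (c y * chi a y))"
  proof (intro sum.cong refl)
    fix x y assume "x \<in> X" "y \<in> X"
    then have "g (x + y) = (\<Sum>a\<in>X. fourier g a * chi a (x + y))" by (intro fourier_inversion) simp
    then show "b x * c y * g (x + y) = (\<Sum>a\<in>X. fourier g a * (b x * chi a x) * (c y * chi a y))"
      by (simp add: sum_distrib_left chi_add mult_ac)
  qed
  also have "\<dots> = (\<Sum>x\<in>X. \<Sum>a\<in>X. \<Sum>y\<in>X. fourier g a * (b x * chi a x) * (c y * chi a y))"
    by (intro sum.cong refl sum.swap)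
  also have "\<dots> = (\<Sum>a\<in>X. \<Sum>x\<in>X. \<Sum>y\<in>X. fourier g a * (b x * chi a x) * (c y * chi a y))"
    by (rule sum.swap)
  also have "\<dots> = (\<Sum>a\<in>X. fourier g a * (fourier b a * fourier c a) * N\<^sup>2)"
  proof (intro sum.cong refl)
    fix a
    have "(\<Sum>x\<in>X. \<Sum>y\<in>X. fourier g a * (b x * chi a x) * (c y * chi a y))
      = fourier g a * ((\<Sum>x\<in>X. b x * chi a x) * (\<Sum>y\<in>X. c y * chi a y))"
      unfolding sum_product by (simp add: sum_distrib_left mult.assoc)
    then show "(\<Sum>x\<in>X. \<Sum>y\<in>X. fourier g a * (b x * chi a x) * (c y * chi a y)) = fourier g a * (fourier b a * fourier c a) * N\<^sup>2"
      using N_pos by (simp add: fourier_def[of b] fourier_def[of c] power2_eq_square)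
  qed
  also have "\<dots> \<le> (\<Sum>a\<in>X. m * (((fourier b a)\<^sup>2 + (fourier c a)\<^sup>2) / 2) * N\<^sup>2)"
  proof (intro sum_mono mult_right_mono)
    fix a assume a: "a \<in> X"
    have "fourier g a * (fourier b a * fourier c a) \<le> \<bar>fourier g a\<bar> * \<bar>fourier b a * fourier c a\<bar>"
      by (metis abs_ge_self abs_mult)
    also have "\<dots> \<le> m * (((fourier b a)\<^sup>2 + (fourier c a)\<^sup>2) / 2)"
    proof (intro mult_mono m a m0)
      have "0 \<le> (\<bar>fourier b a\<bar> - \<bar>fourier c a\<bar>)\<^sup>2" by simp
      then show "\<bar>fourier b a * fourier c a\<bar> \<le> ((fourier b a)\<^sup>2 + (fourier c a)\<^sup>2) / 2"
        by (simp add: power2_diff abs_mult)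
    qed simp
    finally show "fourier g a * (fourier b a * fourier c a) \<le> m * (((fourier b a)\<^sup>2 + (fourier c a)\<^sup>2) / 2)" .
  qed simp
  also have "\<dots> = m * (((\<Sum>a\<in>X. (fourier b a)\<^sup>2) + (\<Sum>a\<in>X. (fourier c a)\<^sup>2)) / 2) * N\<^sup>2"
    by (simp only: sum_distrib_left sum_distrib_right sum_divide_distrib sum.distrib[symmetric])
  also have "\<dots> \<le> m * 1 * N\<^sup>2"
    using norm[of b, OF b] norm[of c, OF c] m0 by (intro mult_right_mono mult_left_mono) auto
  finally show ?thesis by simp
qed

end

context f2_sign
begin

text \<open>Cauchy-Schwarz over \<open>(x, y)\<close> removes \<open>A\<close> and doubles
  \<open>z\<close>. For fixed \<open>z\<close>, \<open>z'\<close> the remaining factors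
  \<open>B\<close> depend on \<open>x\<close> only and the factors \<open>C\<close> on
  \<open>y\<close> only, so \<open>bilinear_bound\<close> applies to the function
  \<open>f (w + z) * f (w + z')\<close> of \<open>w\<close>, whose Fourier coefficients are square
  roots of \<open>amb f (z + z')\<close> up to sign.\<close>

lemma box_bound:
  assumes \<gamma>: "0 \<le> \<gamma>" and small: "real (card {u \<in> X \<times> X. \<gamma> \<le> F u}) \<le> \<gamma> * N"
    and A: "\<And>x y. x \<in> X \<Longrightarrow> y \<in> X \<Longrightarrow> \<bar>A x y\<bar> \<le> 1"
    and B: "\<And>x z. x \<in> X \<Longrightarrow> z \<in> X \<Longrightarrow> \<bar>B x z\<bar> \<le> 1"
    and C: "\<And>y z. y \<in> X \<Longrightarrow> z \<in> X \<Longrightarrow> \<bar>C y z\<bar> \<le> 1"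
  shows "(\<Sum>x\<in>X. \<Sum>y\<in>X. \<Sum>z\<in>X. f (x + y + z) * A x y * B x z * C y z)\<^sup>2 \<le> (\<gamma> + sqrt \<gamma>) * N ^ 6"
proof -
  define R where "R p = (\<Sum>z\<in>X. f (fst p + snd p + z) * B (fst p) z * C (snd p) z)" for p
  \<comment> \<open>The trivial bound 1 is spent only on the at most \<open>\<gamma> * N\<close>
    shifts that have a large coefficient.\<close>
  define m where "m h = (if \<exists>a\<in>X. \<gamma> \<le> amb f h a then 1 else sqrt \<gamma>)" for h
  have four: "\<bar>fourier (\<lambda>w. f (w + z) * f (w + z')) a\<bar> \<le> m (z + z')" if z: "z \<in> X" "z' \<in> X" and a: "a \<in> X" for z z' a
  proof -
    have "(\<Sum>w\<in>X. f (w + z) * f (w + z') * chi a w) = (\<Sum>w\<in>X. f (w + z + z) * f (w + z + z') * chi a (w + z))"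
      using sum_translate[OF X z(1), of "\<lambda>w. f (w + z) * f (w + z') * chi a w"] by simp
    also have "\<dots> = (\<Sum>w\<in>X. chi a z * (f w * f (w + (z + z')) * chi a w))"
      by (intro sum.cong refl) (simp add: chi_add add.assoc)
    finally have eq: "fourier (\<lambda>w. f (w + z) * f (w + z')) a = chi a z * fourier (\<lambda>w. f w * f (w + (z + z'))) a"
      by (simp add: fourier_def sum_distrib_left)
    have sq: "\<bar>fourier (\<lambda>w. f (w + z) * f (w + z')) a\<bar> = sqrt (amb f (z + z') a)"
      by (simp add: eq abs_mult amb_def chi_def)
    show ?thesis
    proof (cases "\<exists>b\<in>X. \<gamma> \<le> amb f (z + z') b")
      case True
      have "amb f (z + z') a \<le> (\<Sum>b\<in>X. amb f (z + z') b)"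
        using a by (intro member_le_sum) auto
      then show ?thesis using True z by (simp add: m_def sq sum_amb)
    next
      case False
      then show ?thesis using a by (force simp: m_def sq)
    qed
  qed
  have "(\<Sum>h\<in>X. m h) \<le> (\<Sum>h\<in>X. of_bool (\<exists>a\<in>X. \<gamma> \<le> amb f h a) + sqrt \<gamma>)"
    using \<gamma> by (intro sum_mono) (auto simp: m_def)
  also have "\<dots> = real (card {h \<in> X. \<exists>a\<in>X. \<gamma> \<le> amb f h a}) + sqrt \<gamma> * N"
    by (simp add: sum.distrib Int_def of_bool_def sum.If_cases mult.commute)
  also have "\<dots> \<le> \<gamma> * N + sqrt \<gamma> * N"
  proof -
    have "{h \<in> X. \<exists>a\<in>X. \<gamma> \<le> amb f h a} = fst ` {u \<in> X \<times> X. \<gamma> \<le> F u}" by force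
    then have "card {h \<in> X. \<exists>a\<in>X. \<gamma> \<le> amb f h a} \<le> card {u \<in> X \<times> X. \<gamma> \<le> F u}"
      by (simp add: card_image_le)
    then show ?thesis using small by linarith
  qed
  finally have m_sum: "(\<Sum>h\<in>X. m h) \<le> \<gamma> * N + sqrt \<gamma> * N" .
  have "(\<Sum>p\<in>X \<times> X. (R p)\<^sup>2) = (\<Sum>p\<in>X \<times> X. \<Sum>z\<in>X. \<Sum>z'\<in>X.
      (B (fst p) z * B (fst p) z') * (C (snd p) z * C (snd p) z') * (f (fst p + snd p + z) * f (fst p + snd p + z')))"
    by (intro sum.cong refl) (simp add: R_def power2_eq_square sum_product mult_ac)
  also have "\<dots> = (\<Sum>z\<in>X. \<Sum>z'\<in>X. \<Sum>p\<in>X \<times> X.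
      (B (fst p) z * B (fst p) z') * (C (snd p) z * C (snd p) z') * (f (fst p + snd p + z) * f (fst p + snd p + z')))"
    by (subst sum.swap) (intro sum.cong refl sum.swap)
  also have "\<dots> \<le> (\<Sum>z\<in>X. \<Sum>z'\<in>X. m (z + z') * N\<^sup>2)"
  proof (intro sum_mono)
    fix z z' assume z: "z \<in> X" "z' \<in> X"
    have "(\<Sum>x\<in>X. \<Sum>y\<in>X. (B x z * B x z') * (C y z * C y z') * (f (x + y + z) * f (x + y + z'))) \<le> m (z + z') * N\<^sup>2"
    proof (rule bilinear_bound[where g = "\<lambda>w. f (w + z) * f (w + z')"])
      show "\<bar>B x z * B x z'\<bar> \<le> 1" if "x \<in> X" for x
        using mult_le_one[OF B[OF that z(1)] _ B[OF that z(2)]] by (simp add: abs_mult)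
      show "\<bar>C y z * C y z'\<bar> \<le> 1" if "y \<in> X" for y
        using mult_le_one[OF C[OF that z(1)] _ C[OF that z(2)]] by (simp add: abs_mult)
    qed (rule four[OF z])
    then show "(\<Sum>p\<in>X \<times> X. (B (fst p) z * B (fst p) z') * (C (snd p) z * C (snd p) z')
        * (f (fst p + snd p + z) * f (fst p + snd p + z'))) \<le> m (z + z') * N\<^sup>2"
      by (simp add: sum.cartesian_product split_def)
  qed
  also have "\<dots> = (\<Sum>z\<in>X. \<Sum>h\<in>X. m h * N\<^sup>2)"
    by (intro sum.cong refl sum_translate'[OF X, where f = "\<lambda>h. m h * N\<^sup>2"])
  also have "\<dots> = N ^ 3 * (\<Sum>h\<in>X. m h)"
    by (simp add: eval_nat_numeral flip: sum_distrib_right)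
  also have "\<dots> \<le> N ^ 3 * (\<gamma> * N + sqrt \<gamma> * N)" by (intro mult_left_mono m_sum) simp
  finally have R_sum: "(\<Sum>p\<in>X \<times> X. (R p)\<^sup>2) \<le> N ^ 3 * (\<gamma> * N + sqrt \<gamma> * N)" .
  have "(\<Sum>x\<in>X. \<Sum>y\<in>X. \<Sum>z\<in>X. f (x + y + z) * A x y * B x z * C y z) = (\<Sum>p\<in>X \<times> X. A (fst p) (snd p) * R p)"
  proof -
    have "(\<Sum>x\<in>X. \<Sum>y\<in>X. \<Sum>z\<in>X. f (x + y + z) * A x y * B x z * C y z) = (\<Sum>x\<in>X. \<Sum>y\<in>X. A x y * R (x, y))"
      by (simp add: R_def sum_distrib_left mult_ac)
    then show ?thesis by (simp add: sum.cartesian_product split_def)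
  qed
  then have "(\<Sum>x\<in>X. \<Sum>y\<in>X. \<Sum>z\<in>X. f (x + y + z) * A x y * B x z * C y z)\<^sup>2
      \<le> (\<Sum>p\<in>X \<times> X. (A (fst p) (snd p))\<^sup>2) * (\<Sum>p\<in>X \<times> X. (R p)\<^sup>2)"
    by (simp add: Cauchy_Schwarz_ineq_sum)
  also have "\<dots> \<le> N\<^sup>2 * (\<Sum>p\<in>X \<times> X. (R p)\<^sup>2)"
  proof (intro mult_right_mono sum_nonneg)
    have "(\<Sum>p\<in>X \<times> X. (A (fst p) (snd p))\<^sup>2) \<le> (\<Sum>p\<in>X \<times> X. 1)"
      using A by (intro sum_mono) (auto simp: abs_square_le_1)
    then show "(\<Sum>p\<in>X \<times> X. (A (fst p) (snd p))\<^sup>2) \<le> N\<^sup>2" by (simp add: card_cartesian_product power2_eq_square)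
  qed simp
  also have "\<dots> \<le> N\<^sup>2 * (N ^ 3 * (\<gamma> * N + sqrt \<gamma> * N))" by (intro mult_left_mono R_sum) simp
  also have "\<dots> = (\<gamma> + sqrt \<gamma>) * (N\<^sup>2 * N ^ 3 * N)" by (simp only: distrib_right distrib_left mult_ac)
  also have "N\<^sup>2 * N ^ 3 * N = N ^ 6" by (simp add: eval_nat_numeral)
  finally show ?thesis .
qed

end

section \<open>Averages over tuples and products over edges\<close>

lemma sum_resample:
  assumes "i \<in> I" "finite X"
  shows "(\<Sum>xs\<in>Pi\<^sub>E I (\<lambda>_. X). \<Sum>x\<in>X. \<Phi> (xs(i := x))) = real (card X) * (\<Sum>xs\<in>Pi\<^sub>E I (\<lambda>_. X). \<Phi> xs :: real)"
proof -
  let ?\<Omega> = "Pi\<^sub>E I (\<lambda>_. X)"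
  \<comment> \<open>Exchanging the fresh value with the old coordinate is an involution of
    \<open>?\<Omega> \<times> X\<close>.\<close>
  let ?sw = "\<lambda>(xs, x). (xs(i := x), xs i)"
  have "(\<Sum>p\<in>?\<Omega> \<times> X. \<Phi> ((fst p)(i := snd p))) = (\<Sum>p\<in>?\<Omega> \<times> X. \<Phi> (fst p))"
    by (rule sum.reindex_bij_witness[where i = ?sw and j = ?sw]) (use assms in \<open>auto simp: PiE_iff extensional_def\<close>)
  then show ?thesis
    by (simp add: sum.cartesian_product[symmetric] split_def sum.cartesian_product' sum_distrib_left)
qed

lemma prod_Pow_insert:
  assumes "finite A" "x \<notin> A"
  shows "(\<Prod>s\<in>Pow (insert x A). h s) = (\<Prod>s\<in>Pow A. h s) * (\<Prod>s\<in>Pow A. h (insert x s))"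
proof -
  have "inj_on (insert x) (Pow A)" using assms(2) by (auto simp: inj_on_def)
  then show ?thesis
    unfolding Pow_insert using assms
    by (subst prod.union_disjoint) (auto simp: prod.reindex)
qed

lemma prod_one_plus:
  assumes "finite E"
  shows "(\<Prod>e\<in>E. 1 + \<psi> e) = (\<Sum>E'\<in>Pow E. \<Prod>e\<in>E'. \<psi> e :: real)"
  using prod_add[OF assms, of \<psi> "\<lambda>_. 1"] by (simp add: add.commute)

text \<open>The empty subset contributes \<open>f 0\<close>. When \<open>f 0\<close> is a sign, the
  test's equation at \<open>e\<close> thus becomes \<open>cube_prod f e xs = 1\<close>.\<close>

definition cube_prod :: "('v::exponent_two \<Rightarrow> real) \<Rightarrow> 'i set \<Rightarrow> ('i \<Rightarrow> 'v) \<Rightarrow> real"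
  where "cube_prod f e xs = (\<Prod>s\<in>Pow e. f (\<Sum>i\<in>s. xs i))"

context f2_sign
begin

lemma sum_mem: "(\<And>i. i \<in> s \<Longrightarrow> xs i \<in> X) \<Longrightarrow> (\<Sum>i\<in>s. xs i) \<in> X"
  by (induction s rule: infinite_finite_induct) auto

lemma abs_prod_f:
  assumes "\<And>p. p \<in> P \<Longrightarrow> g p \<in> X"
  shows "\<bar>\<Prod>p\<in>P. f (g p)\<bar> = 1"
proof -
  have "\<bar>f (g p)\<bar> = 1" if "p \<in> P" for p using f_pm[OF assms[OF that]] by auto
  then show ?thesis by (simp add: abs_prod)
qed

text \<open>Fix one edge \<open>{i, j, k}\<close>, freeze all other coordinates and resample these
  three. Every factor but \<open>f (x + y + z)\<close> misses one of the three vertices; grouped by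
  the first one missed, in the order \<open>i, j, k\<close>, the factors form the functions
  \<open>C\<close>, \<open>B\<close>, \<open>A\<close> of the hypothesis.\<close>

lemma edge_product_bound:
  assumes fin: "finite E'" and E': "E' \<noteq> {}" "\<And>e. e \<in> E' \<Longrightarrow> e \<subseteq> I \<and> card e = 3"
    and \<eta>: "\<And>A B C. (\<And>x y. x \<in> X \<Longrightarrow> y \<in> X \<Longrightarrow> \<bar>A x y\<bar> \<le> 1) \<Longrightarrow>
      (\<And>x z. x \<in> X \<Longrightarrow> z \<in> X \<Longrightarrow> \<bar>B x z\<bar> \<le> 1) \<Longrightarrow> (\<And>y z. y \<in> X \<Longrightarrow> z \<in> X \<Longrightarrow> \<bar>C y z\<bar> \<le> 1) \<Longrightarrow>
      (\<Sum>x\<in>X. \<Sum>y\<in>X. \<Sum>z\<in>X. f (x + y + z) * A x y * B x z * C y z) \<le> \<eta> * N ^ 3"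
    and I: "finite I"
  shows "(\<Sum>xs\<in>Pi\<^sub>E I (\<lambda>_. X). \<Prod>e\<in>E'. cube_prod f e xs) \<le> \<eta> * real (card (Pi\<^sub>E I (\<lambda>_. X)))"
proof -
  let ?\<Omega> = "Pi\<^sub>E I (\<lambda>_. X)"
  obtain e0 where e0: "e0 \<in> E'" using E'(1) by blast
  obtain i j k where ijk: "e0 = {i, j, k}" "i \<noteq> j" "i \<noteq> k" "j \<noteq> k"
    using E'(2)[OF e0] by (auto simp: card_3_iff)
  have I3: "i \<in> I" "j \<in> I" "k \<in> I" using E'(2)[OF e0] ijk by auto
  have finE: "finite e" if "e \<in> E'" for e using E'(2)[OF that] I by (auto intro: finite_subset)
  \<comment> \<open>Factors are indexed by an edge together with a subset, because a subset common
    to several edges counts with multiplicity.\<close>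
  let ?S = "Sigma E' Pow"
  have finS: "finite ?S" using fin finE by auto
  define Pi where "Pi = {p \<in> ?S. i \<notin> snd p}"
  define Pj where "Pj = {p \<in> ?S. i \<in> snd p \<and> j \<notin> snd p}"
  define Pk where "Pk = {p \<in> ?S. i \<in> snd p \<and> j \<in> snd p \<and> k \<notin> snd p}"
  define G where "G P xs = (\<Prod>p\<in>P. f (\<Sum>l\<in>snd p. xs l))" for P :: "('b set \<times> 'b set) set" and xs
  have split: "?S = insert (e0, e0) (Pi \<union> Pj \<union> Pk)"
  proof
    show "?S \<subseteq> insert (e0, e0) (Pi \<union> Pj \<union> Pk)"
    proof
      fix p assume p: "p \<in> ?S"
      then obtain e s where es: "p = (e, s)" "e \<in> E'" "s \<subseteq> e" by auto
      show "p \<in> insert (e0, e0) (Pi \<union> Pj \<union> Pk)"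
      proof (cases "i \<in> s \<and> j \<in> s \<and> k \<in> s")
        case True
        then have "e0 \<subseteq> s" using ijk by auto
        moreover have "card e = card e0" using E'(2) es(2) e0 by simp
        ultimately have "e0 = e" using es finE[OF es(2)] by (metis card_subset_eq order_trans)
        then show ?thesis using \<open>e0 \<subseteq> s\<close> es by auto
      next
        case False
        then show ?thesis using p es(1) by (auto simp: Pi_def Pj_def Pk_def)
      qed
    qed
  qed (use e0 in \<open>auto simp: Pi_def Pj_def Pk_def\<close>)
  have prod: "(\<Prod>e\<in>E'. cube_prod f e xs) = f (xs i + xs j + xs k) * G Pk xs * G Pj xs * G Pi xs" for xs
  proof -
    have "(\<Prod>e\<in>E'. cube_prod f e xs) = G ?S xs"
      unfolding cube_prod_def G_def using fin finE by (subst prod.Sigma) (auto simp: split_def)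
    also have "\<dots> = f (\<Sum>l\<in>e0. xs l) * G (Pi \<union> Pj \<union> Pk) xs"
      unfolding split G_def using finS ijk
      by (subst prod.insert) (auto simp: Pi_def Pj_def Pk_def)
    also have "G (Pi \<union> Pj \<union> Pk) xs = G Pi xs * G Pj xs * G Pk xs"
    proof -
      have "finite Pi" "finite Pj" "finite Pk" using finS by (auto simp: Pi_def Pj_def Pk_def)
      moreover have "Pi \<inter> Pj = {}" "(Pi \<union> Pj) \<inter> Pk = {}" by (auto simp: Pi_def Pj_def Pk_def)
      ultimately show ?thesis unfolding G_def by (simp add: prod.union_disjoint)
    qed
    also have "(\<Sum>l\<in>e0. xs l) = xs i + xs j + xs k" using ijk by (simp add: add.assoc)
    finally show ?thesis by (simp add: mult_ac)
  qed
  have Gcong: "G P xs = G P ys" if "\<And>p l. p \<in> P \<Longrightarrow> l \<in> snd p \<Longrightarrow> xs l = ys l" for P xs ys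
    unfolding G_def by (intro prod.cong refl arg_cong[where f = f] sum.cong) (use that in auto)
  have bound: "\<bar>G P xs\<bar> \<le> 1" if "P \<subseteq> ?S" "xs \<in> ?\<Omega>" for P xs
  proof -
    have "\<bar>G P xs\<bar> = 1" unfolding G_def
    proof (rule abs_prod_f, rule sum_mem)
      fix p l assume "p \<in> P" "l \<in> snd p"
      then have "l \<in> I" using that(1) E'(2) by fastforce
      then show "xs l \<in> X" using that(2) by auto
    qed
    then show ?thesis by simp
  qed
  have inner: "(\<Sum>x\<in>X. \<Sum>y\<in>X. \<Sum>z\<in>X. \<Prod>e\<in>E'. cube_prod f e (xs(i := x, j := y, k := z))) \<le> \<eta> * N ^ 3"
    if xs: "xs \<in> ?\<Omega>" for xs
  proof -
    have mem: "xs(i := x, j := y) \<in> ?\<Omega>" "xs(i := x, k := y) \<in> ?\<Omega>" "xs(j := x, k := y) \<in> ?\<Omega>"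
      if "x \<in> X" "y \<in> X" for x y
      using that xs I3 by (auto simp: PiE_iff extensional_def)
    have "(\<Sum>x\<in>X. \<Sum>y\<in>X. \<Sum>z\<in>X. f (x + y + z) * G Pk (xs(i := x, j := y)) * G Pj (xs(i := x, k := z)) * G Pi (xs(j := y, k := z))) \<le> \<eta> * N ^ 3"
      by (rule \<eta>) (intro bound mem; auto simp: Pi_def Pj_def Pk_def)+
    moreover have "(\<Prod>e\<in>E'. cube_prod f e (xs(i := x, j := y, k := z)))
        = f (x + y + z) * G Pk (xs(i := x, j := y)) * G Pj (xs(i := x, k := z)) * G Pi (xs(j := y, k := z))" for x y z
    proof -
      have "G Pk (xs(i := x, j := y, k := z)) = G Pk (xs(i := x, j := y))"
        by (rule Gcong) (auto simp: Pk_def)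
      moreover have "G Pj (xs(i := x, j := y, k := z)) = G Pj (xs(i := x, k := z))"
        by (rule Gcong) (auto simp: Pj_def)
      moreover have "G Pi (xs(i := x, j := y, k := z)) = G Pi (xs(j := y, k := z))"
        by (rule Gcong) (auto simp: Pi_def)
      ultimately show ?thesis using ijk by (simp add: prod)
    qed
    ultimately show ?thesis by simp
  qed
  let ?\<Phi> = "\<lambda>xs. \<Prod>e\<in>E'. cube_prod f e xs"
  have "N ^ 3 * (\<Sum>xs\<in>?\<Omega>. ?\<Phi> xs) = N * (N * (\<Sum>xs\<in>?\<Omega>. \<Sum>z\<in>X. ?\<Phi> (xs(k := z))))"
    using sum_resample[OF I3(3) finX, of ?\<Phi>] by (simp add: power3_eq_cube)
  also have "\<dots> = N * (\<Sum>xs\<in>?\<Omega>. \<Sum>y\<in>X. \<Sum>z\<in>X. ?\<Phi> (xs(j := y, k := z)))"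
    using sum_resample[OF I3(2) finX, of "\<lambda>xs. \<Sum>z\<in>X. ?\<Phi> (xs(k := z))"] by simp
  also have "\<dots> = (\<Sum>xs\<in>?\<Omega>. \<Sum>x\<in>X. \<Sum>y\<in>X. \<Sum>z\<in>X. ?\<Phi> (xs(i := x, j := y, k := z)))"
    using sum_resample[OF I3(1) finX, of "\<lambda>xs. \<Sum>y\<in>X. \<Sum>z\<in>X. ?\<Phi> (xs(j := y, k := z))"] by simp
  also have "\<dots> \<le> (\<Sum>xs\<in>?\<Omega>. \<eta> * N ^ 3)" by (intro sum_mono inner)
  also have "\<dots> = N ^ 3 * (\<eta> * real (card ?\<Omega>))" by simp
  finally show ?thesis using N_pos by (simp add: mult_le_cancel_left)
qed

lemma acceptance_bound:
  assumes E: "\<And>e. e \<in> E \<Longrightarrow> e \<subseteq> I \<and> card e = 3" and I: "finite I" and \<eta>: "0 \<le> \<eta>"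
    and box: "\<And>A B C. (\<And>x y. x \<in> X \<Longrightarrow> y \<in> X \<Longrightarrow> \<bar>A x y\<bar> \<le> 1) \<Longrightarrow>
      (\<And>x z. x \<in> X \<Longrightarrow> z \<in> X \<Longrightarrow> \<bar>B x z\<bar> \<le> 1) \<Longrightarrow> (\<And>y z. y \<in> X \<Longrightarrow> z \<in> X \<Longrightarrow> \<bar>C y z\<bar> \<le> 1) \<Longrightarrow>
      (\<Sum>x\<in>X. \<Sum>y\<in>X. \<Sum>z\<in>X. f (x + y + z) * A x y * B x z * C y z) \<le> \<eta> * N ^ 3"
  shows "real (card {xs \<in> Pi\<^sub>E I (\<lambda>_. X). \<forall>e\<in>E. cube_prod f e xs = 1})
    \<le> (1 / 2 ^ card E + \<eta>) * real (card (Pi\<^sub>E I (\<lambda>_. X)))"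
proof -
  let ?\<Omega> = "Pi\<^sub>E I (\<lambda>_. X)"
  have finE: "finite E" using E I by (intro finite_subset[of E "Pow I"]) auto
  have fin\<Omega>: "finite ?\<Omega>" using I by (intro finite_PiE) auto
  have pm: "cube_prod f e xs = 1 \<or> cube_prod f e xs = -1" if "e \<in> E" "xs \<in> ?\<Omega>" for e xs
  proof -
    have "\<bar>cube_prod f e xs\<bar> = 1" unfolding cube_prod_def
      by (intro abs_prod_f sum_mem) (use that E in \<open>auto simp: PiE_iff\<close>)
    then show ?thesis by linarith
  qed
  have ind: "of_bool (\<forall>e\<in>E. cube_prod f e xs = 1) = (\<Prod>e\<in>E. 1 + cube_prod f e xs) / 2 ^ card E" if xs: "xs \<in> ?\<Omega>" for xs
  proof (cases "\<forall>e\<in>E. cube_prod f e xs = 1")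
    case False
    then obtain e where "e \<in> E" "1 + cube_prod f e xs = 0" using pm[OF _ xs] by fastforce
    then have "(\<Prod>e\<in>E. 1 + cube_prod f e xs) = 0" using finE prod_zero by fastforce
    then show ?thesis using False by simp
  qed simp
  have "real (card {xs \<in> ?\<Omega>. \<forall>e\<in>E. cube_prod f e xs = 1}) = (\<Sum>xs\<in>?\<Omega>. of_bool (\<forall>e\<in>E. cube_prod f e xs = 1))"
    using fin\<Omega> by (simp add: Int_def of_bool_def sum.If_cases)
  also have "\<dots> = (\<Sum>xs\<in>?\<Omega>. \<Sum>E'\<in>Pow E. \<Prod>e\<in>E'. cube_prod f e xs) / 2 ^ card E"
    by (simp add: ind prod_one_plus[OF finE] flip: sum_divide_distrib)
  also have "\<dots> = (\<Sum>E'\<in>Pow E. \<Sum>xs\<in>?\<Omega>. \<Prod>e\<in>E'. cube_prod f e xs) / 2 ^ card E"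
    by (subst sum.swap) simp
  \<comment> \<open>Granting \<open>\<eta>\<close> to the empty set as well makes the number of
    terms cancel exactly against \<open>2 ^ card E\<close>.\<close>
  also have "\<dots> \<le> (\<Sum>E'\<in>Pow E. of_bool (E' = {}) * real (card ?\<Omega>) + \<eta> * real (card ?\<Omega>)) / 2 ^ card E"
  proof (intro divide_right_mono sum_mono)
    fix E' assume E': "E' \<in> Pow E"
    show "(\<Sum>xs\<in>?\<Omega>. \<Prod>e\<in>E'. cube_prod f e xs) \<le> of_bool (E' = {}) * real (card ?\<Omega>) + \<eta> * real (card ?\<Omega>)"
    proof (cases "E' = {}")
      case False
      have "(\<Sum>xs\<in>?\<Omega>. \<Prod>e\<in>E'. cube_prod f e xs) \<le> \<eta> * real (card ?\<Omega>)"
      proof (rule edge_product_bound[OF _ False _ box I])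
        show "finite E'" using E' finE by (auto intro: finite_subset)
        show "e \<subseteq> I \<and> card e = 3" if "e \<in> E'" for e using that E' E by blast
      qed
      then show ?thesis using False by simp
    qed (use \<eta> in simp)
  qed simp
  also have "\<dots> = (real (card ?\<Omega>) + 2 ^ card E * (\<eta> * real (card ?\<Omega>))) / 2 ^ card E"
    using finE by (simp add: sum.distrib card_Pow of_bool_def flip: sum_distrib_right)
  also have "\<dots> = (1 / 2 ^ card E + \<eta>) * real (card ?\<Omega>)" by (simp add: field_simps)
  finally show ?thesis .
qed

end

section \<open>The cube and quadratic polynomials\<close>

lemma add_False [simp]: "False + b = b" "b + False = b"
  by (auto simp: plus_bool_def)

lemma sum_False [simp]: "(\<Sum>i\<in>S. False) = False"
  using sum.neutral_const[of S, where 'a = bool] by (simp only: zero_bool_def)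

lemma vadd_eq: "vadd x y = x + y"
  by (simp add: vadd_def fun_eq_iff plus_bool_def)

lemma vzero_eq: "vzero = 0"
  by (simp add: vzero_def fun_eq_iff zero_bool_def)

lemma sgn_fun_eq: "sgn_fun P x = sg (P x)"
  by (simp add: sgn_fun_def sg_def)

lemma finite_cube: "finite (cube n)" and card_cube: "card (cube n) = 2 ^ n"
proof -
  have "bij_betw (\<lambda>x. {i. x i}) (cube n) (Pow {..<n})"
    by (rule bij_betwI[where g = "\<lambda>s i. i \<in> s"]) (auto simp: cube_def not_less[symmetric])
  from bij_betw_finite[OF this] bij_betw_same_card[OF this] show "finite (cube n)" "card (cube n) = 2 ^ n"
    by (simp_all add: card_Pow)
qed

lemma cube_add: "x \<in> cube n \<Longrightarrow> y \<in> cube n \<Longrightarrow> x + y \<in> cube n"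
  by (auto simp: cube_def plus_bool_def zero_bool_def)

lemma subgrp_cube: "subgrp (cube n)"
  unfolding subgrp_def using finite_cube[of n] cube_add[of _ n]
  by (auto simp: cube_def zero_bool_def)

definition bdot :: "nat \<Rightarrow> (nat \<Rightarrow> bool) \<Rightarrow> (nat \<Rightarrow> bool) \<Rightarrow> bool"
  where "bdot n x y = (\<Sum>i<n. x i \<and> y i)"

definition unit_vec :: "nat \<Rightarrow> nat \<Rightarrow> bool"
  where "unit_vec i = (\<lambda>j. j = i)"

lemma conj_xor_distrib: "((a + b) \<and> c) = ((a \<and> c) + (b \<and> c))" "(c \<and> (a + b)) = ((c \<and> a) + (c \<and> b))"
  by (auto simp: plus_bool_def)

lemma conj_xor_sum: "((\<Sum>i\<in>S. g i) \<and> c) = (\<Sum>i\<in>S. g i \<and> c)"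
  by (induction S rule: infinite_finite_induct) (auto simp: conj_xor_distrib zero_bool_def)

lemma unit_vec_cube: "i < n \<Longrightarrow> unit_vec i \<in> cube n"
  by (auto simp: unit_vec_def cube_def)

lemma bdot_unit_vec: "i < n \<Longrightarrow> bdot n (unit_vec i) x = x i"
proof -
  assume i: "i < n"
  have "bdot n (unit_vec i) x = (\<Sum>j<n. if j = i then x i else 0)"
    unfolding bdot_def by (intro sum.cong) (auto simp: unit_vec_def zero_bool_def)
  also have "\<dots> = x i" using i by (simp add: sum.delta)
  finally show ?thesis .
qed

interpretation cube: f2_space "cube n" "bdot n" for n
proof
  show "subgrp (cube n)" by (rule subgrp_cube)
  show "bdot n x y = bdot n y x" for x y by (simp add: bdot_def conj_commute)
  show "bdot n (x + y) z = bdot n x z + bdot n y z" for x y z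
    by (simp add: bdot_def conj_xor_distrib sum.distrib)
  show "\<exists>x\<in>cube n. bdot n a x \<noteq> 0" if a: "a \<in> cube n" "a \<noteq> 0" for a
  proof -
    obtain i where "a i" using a(2) by (auto simp: fun_eq_iff zero_bool_def)
    moreover then have "i < n" using a(1) by (auto simp: cube_def not_less[symmetric])
    ultimately have "bdot n a (unit_vec i)"
      using bdot_unit_vec[of i n a] by (simp add: bdot_def conj_commute)
    then show ?thesis using unit_vec_cube[OF \<open>i < n\<close>] by (auto simp: zero_bool_def)
  qed
qed

lemma additive_expand:
  fixes \<phi> :: "(nat \<Rightarrow> bool) \<Rightarrow> bool"
  assumes add: "\<And>x y. x \<in> cube n \<Longrightarrow> y \<in> cube n \<Longrightarrow> \<phi> (x + y) = \<phi> x + \<phi> y" and x: "x \<in> cube n"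
  shows "\<phi> x = (\<Sum>i<n. x i \<and> \<phi> (unit_vec i))"
proof -
  have \<phi>0: "\<phi> 0 = 0"
  proof -
    have "0 \<in> cube n" by simp
    from add[OF this this] show ?thesis by simp
  qed
  \<comment> \<open>Induction on a bound for the support of \<open>x\<close>, while
    \<open>\<phi>\<close> stays additive on the whole of \<open>cube n\<close>.\<close>
  have "\<phi> x = (\<Sum>i<k. x i \<and> \<phi> (unit_vec i))" if "k \<le> n" "x \<in> cube k" for k
    using that
  proof (induction k arbitrary: x)
    case 0
    then have "x = 0" by (auto simp: cube_def fun_eq_iff zero_bool_def)
    then show ?case using \<phi>0 by (metis lessThan_0 sum.empty)
  next
    case (Suc k)
    show ?case
    proof (cases "x k")
      case False
      then have "x \<in> cube k" using Suc.prems by (auto simp: cube_def le_Suc_eq) (metis le_antisym not_less_eq_eq)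
      then show ?thesis using Suc False by simp
    next
      case True
      define y where "y = x(k := False)"
      have y: "y \<in> cube k" using Suc.prems by (auto simp: cube_def y_def)
      have yn: "y \<in> cube n" using y Suc.prems by (auto simp: cube_def)
      have "x = y + unit_vec k" using True by (auto simp: y_def unit_vec_def fun_eq_iff plus_bool_def)
      then have "\<phi> x = \<phi> y + \<phi> (unit_vec k)" using add[OF yn unit_vec_cube[of k n]] Suc.prems by simp
      also have "\<phi> y = (\<Sum>i<k. y i \<and> \<phi> (unit_vec i))" using Suc y by simp
      also have "\<dots> = (\<Sum>i<k. x i \<and> \<phi> (unit_vec i))" by (intro sum.cong) (auto simp: y_def)
      finally show ?thesis using True by simp
    qed
  qed
  then show ?thesis using x by simp
qed

lemma odd_sum_eq: "odd (\<Sum>i\<in>S. g i :: nat) = (\<Sum>i\<in>S. odd (g i))"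
  by (induction S rule: infinite_finite_induct) (auto simp: plus_bool_def zero_bool_def)

text \<open>Trades the parity of a natural number for addition in \<open>bool\<close>, where sums
  can be split and merged termwise.\<close>

lemma quad_poly_iff:
  "quad_poly n P \<longleftrightarrow> (\<exists>c a b. \<forall>x\<in>cube n. P x =
    c + (\<Sum>i<n. a i \<and> x i) + (\<Sum>i<n. \<Sum>j<n. i \<le> j \<and> b i j \<and> x i \<and> x j))"
proof -
  have "odd (of_bool c + (\<Sum>i<n. of_bool (a i \<and> x i)) + (\<Sum>i<n. \<Sum>j<n. of_bool (i \<le> j \<and> b i j \<and> x i \<and> x j)) :: nat)
    = (c + (\<Sum>i<n. a i \<and> x i) + (\<Sum>i<n. \<Sum>j<n. i \<le> j \<and> b i j \<and> x i \<and> x j))" for c a b x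
    by (simp only: odd_add odd_sum_eq odd_of_bool_self plus_bool_def)
  then show ?thesis unfolding quad_poly_def by simp
qed

lemma quad_poly_add_affine:
  assumes "quad_poly n P"
  shows "quad_poly n (\<lambda>x. P x + bdot n d x + e)"
proof -
  obtain c a b where P: "\<forall>x\<in>cube n. P x = c + (\<Sum>i<n. a i \<and> x i) + (\<Sum>i<n. \<Sum>j<n. i \<le> j \<and> b i j \<and> x i \<and> x j)"
    using assms unfolding quad_poly_iff by blast
  have "P x + bdot n d x + e = (c + e) + (\<Sum>i<n. (a i + d i) \<and> x i) + (\<Sum>i<n. \<Sum>j<n. i \<le> j \<and> b i j \<and> x i \<and> x j)"
    if "x \<in> cube n" for x
    unfolding P[rule_format, OF that] bdot_def conj_xor_distrib sum.distrib by (simp only: add_ac)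
  then show ?thesis unfolding quad_poly_iff by (intro exI[of _ "c + e"] exI[of _ "\<lambda>i. a i + d i"] exI[of _ b]) blast
qed

text \<open>An alternating form \<open>(x, h) \<mapsto> dot (L h) x\<close> polarises the quadratic form given by the part of its
  matrix above the diagonal.\<close>

lemma exists_quad_poly_polarization:
  assumes L: "\<And>x. x \<in> cube n \<Longrightarrow> L x \<in> cube n \<and> bdot n x (L x) = 0"
    and add: "\<And>x y. x \<in> cube n \<Longrightarrow> y \<in> cube n \<Longrightarrow> L (x + y) = L x + L y"
  shows "\<exists>P. quad_poly n P \<and> (\<forall>x\<in>cube n. \<forall>h\<in>cube n. P (x + h) = P x + P h + bdot n (L h) x)"
proof -
  define B where "B i j = L (unit_vec j) i" for i j
  have sym: "bdot n x (L y) = bdot n y (L x)" if "x \<in> cube n" "y \<in> cube n" for x y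
  proof -
    have "bdot n (x + y) (L (x + y)) = bdot n x (L y) + bdot n y (L x)"
      using L that by (simp add: add cube.dot_add_left cube.dot_add_right add.commute)
    then have "bdot n x (L y) + bdot n y (L x) = 0" using L[OF cube_add[OF that]] by simp
    then show ?thesis using add_eq_iff[of "bdot n x (L y)" "bdot n y (L x)" 0] by simp
  qed
  have B: "B i j = bdot n (unit_vec i) (L (unit_vec j))" if "i < n" for i j
    using that by (simp add: B_def bdot_unit_vec)
  have Bsym: "B i j = B j i" if "i < n" "j < n" for i j
    using that sym unit_vec_cube by (simp add: B)
  \<comment> \<open>In the polarisation of \<open>P\<close> the two diagonal contributions cancel,
    so the form must have zero diagonal.\<close>
  have Bdiag: "\<not> B i i" if "i < n" for i
    using L[OF unit_vec_cube[OF that]] that by (simp add: B zero_bool_def)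
  have form: "bdot n (L h) x = (\<Sum>i<n. \<Sum>j<n. B i j \<and> x i \<and> h j)" if "h \<in> cube n" for h x
  proof -
    have "L h i = (\<Sum>j<n. h j \<and> B i j)" for i
      unfolding B_def by (rule additive_expand[where \<phi> = "\<lambda>h. L h i", OF _ that]) (simp add: add)
    then have "bdot n (L h) x = (\<Sum>i<n. \<Sum>j<n. (h j \<and> B i j) \<and> x i)"
      by (simp only: bdot_def conj_xor_sum)
    also have "\<dots> = (\<Sum>i<n. \<Sum>j<n. B i j \<and> x i \<and> h j)" by (intro sum.cong refl) auto
    finally show ?thesis .
  qed
  \<comment> \<open>Keeping one of the two symmetric entries replaces division by 2.\<close>
  define P where "P x = (\<Sum>i<n. \<Sum>j<n. i \<le> j \<and> B i j \<and> x i \<and> x j)" for x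
  have "quad_poly n P" unfolding quad_poly_iff
    by (rule exI[of _ False], rule exI[of _ "\<lambda>_. False"], rule exI[of _ B]) (simp add: P_def)
  moreover have "P (x + h) = P x + P h + bdot n (L h) x" if "h \<in> cube n" for x h
  proof -
    have "P (x + h) = P x + P h + ((\<Sum>i<n. \<Sum>j<n. i \<le> j \<and> B i j \<and> x i \<and> h j) + (\<Sum>i<n. \<Sum>j<n. i \<le> j \<and> B i j \<and> h i \<and> x j))"
      unfolding P_def sum.distrib[symmetric] by (intro sum.cong refl) (auto simp: plus_bool_def)
    also have "(\<Sum>i<n. \<Sum>j<n. i \<le> j \<and> B i j \<and> h i \<and> x j) = (\<Sum>i<n. \<Sum>j<n. j \<le> i \<and> B j i \<and> h j \<and> x i)"
      by (rule sum.swap)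
    also have "(\<Sum>i<n. \<Sum>j<n. i \<le> j \<and> B i j \<and> x i \<and> h j) + (\<Sum>i<n. \<Sum>j<n. j \<le> i \<and> B j i \<and> h j \<and> x i)
      = (\<Sum>i<n. \<Sum>j<n. B i j \<and> x i \<and> h j)"
      unfolding sum.distrib[symmetric]
    proof (intro sum.cong refl)
      fix i j assume "i \<in> {..<n}" "j \<in> {..<n}"
      then show "((i \<le> j \<and> B i j \<and> x i \<and> h j) + (j \<le> i \<and> B j i \<and> h j \<and> x i)) = (B i j \<and> x i \<and> h j)"
        using Bsym[of i j] Bdiag[of i] by (cases i j rule: linorder_cases) (auto simp: plus_bool_def zero_bool_def)
    qed
    finally show ?thesis by (simp only: form[OF that])
  qed
  ultimately show ?thesis by blast
qed

section \<open>Distance, correlation and the inverse theorem on the cube\<close>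

lemma correlation_of_fdist:
  assumes f: "\<And>x. x \<in> cube n \<Longrightarrow> f x = 1 \<or> f x = -1" and d: "1/2 - \<epsilon> \<le> fdist n f (sgn_fun P)"
  shows "(\<Sum>x\<in>cube n. f x * sg (P x)) \<le> 2 * \<epsilon> * 2 ^ n"
proof -
  have "(\<Sum>x\<in>cube n. f x * sg (P x)) = (\<Sum>x\<in>cube n. 1 - 2 * of_bool (f x \<noteq> sgn_fun P x))"
    using f by (intro sum.cong refl) (auto simp: sgn_fun_eq sg_def)
  also have "\<dots> = 2 ^ n - 2 * real (card {x \<in> cube n. f x \<noteq> sgn_fun P x})"
    by (simp add: sum_subtractf card_cube finite_cube Int_def of_bool_def sum.If_cases flip: sum_distrib_left)
  also have "real (card {x \<in> cube n. f x \<noteq> sgn_fun P x}) = fdist n f (sgn_fun P) * 2 ^ n"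
    by (simp add: fdist_def)
  also have "2 ^ n - 2 * (fdist n f (sgn_fun P) * 2 ^ n) = (1 - 2 * fdist n f (sgn_fun P)) * 2 ^ n"
    by (simp add: algebra_simps)
  also have "\<dots> \<le> 2 * \<epsilon> * 2 ^ n" using d by (intro mult_right_mono) auto
  finally show ?thesis .
qed

lemma inverse_theorem:
  assumes f: "\<And>x. x \<in> cube n \<Longrightarrow> f x = 1 \<or> f x = -1"
    and \<gamma>: "0 < \<gamma>" and T: "32 \<le> ((1 + \<gamma>\<^sup>2) / (1 + \<gamma>\<^sup>2 / 2)) ^ T"
    and big: "\<gamma> * real (card (cube n)) \<le> real (card {u \<in> cube n \<times> cube n. \<gamma> \<le> cube.pamb n f u})"
    and far: "\<And>P. quad_poly n P \<Longrightarrow> 1/2 - \<epsilon> \<le> fdist n f (sgn_fun P)"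
  shows "inverse_const \<gamma> T \<le> 2 * \<epsilon>"
proof -
  interpret f2_sign "cube n" "bdot n" f by unfold_locales (rule f)
  obtain L a where a: "a \<in> cube n" and L: "\<forall>x\<in>cube n. L x \<in> cube n \<and> bdot n x (L x) = 0"
    "\<forall>x\<in>cube n. \<forall>y\<in>cube n. L (x + y) = L x + L y"
    and mass: "(inverse_const \<gamma> T)\<^sup>2 * real (card (cube n)) \<le> (\<Sum>h\<in>cube n. cube.amb n f h (L h + a))"
    using exists_structured_alternating_map[OF \<gamma> T big] by blast
  obtain P where P: "quad_poly n P" "\<forall>x\<in>cube n. \<forall>h\<in>cube n. P (x + h) = P x + P h + bdot n (L h) x"
    using exists_quad_poly_polarization[of n L] L by blast
  obtain b where "inverse_const \<gamma> T \<le> \<bar>\<Sum>x\<in>cube n. f x * sg (P x + bdot n b x)\<bar> / real (card (cube n))"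
    using correlation_of_alternating[OF a, of L P "inverse_const \<gamma> T"] L(1) P(2) mass inverse_const_pos[OF \<gamma>, of T]
    by (auto simp: less_imp_le)
  also have "\<bar>\<Sum>x\<in>cube n. f x * sg (P x + bdot n b x)\<bar> \<le> 2 * \<epsilon> * 2 ^ n"
  proof -
    \<comment> \<open>The constant \<open>e\<close> gives the absolute value: adding 1 keeps the
      polynomial quadratic and negates the correlation.\<close>
    have "(\<Sum>x\<in>cube n. f x * sg (P x + bdot n b x + e)) \<le> 2 * \<epsilon> * 2 ^ n" for e
      by (rule correlation_of_fdist[OF f far[OF quad_poly_add_affine[OF P(1)]]])
    from this[of False] this[of True] show ?thesis
      by (simp only: sg_add) (simp add: sg_def[of True] sg_def[of False] sum_negf abs_le_iff)
  qed
  finally show ?thesis by (simp add: card_cube divide_right_mono)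
qed

section \<open>Third derivatives and the test in terms of \<open>cube_prod\<close>\<close>

definition third_deriv :: "((nat \<Rightarrow> bool) \<Rightarrow> bool) \<Rightarrow> (nat \<Rightarrow> bool) \<Rightarrow> (nat \<Rightarrow> bool) \<Rightarrow> (nat \<Rightarrow> bool) \<Rightarrow> bool"
  where "third_deriv P x y z = P x + P y + P z + P (x + y) + P (x + z) + P (y + z) + P (x + y + z) + P 0"

lemma third_deriv_add: "third_deriv (\<lambda>x. P x + Q x) x y z = third_deriv P x y z + third_deriv Q x y z"
  by (simp add: third_deriv_def add_ac)

lemma third_deriv_sum: "third_deriv (\<lambda>x. \<Sum>i\<in>S. P i x) x y z = (\<Sum>i\<in>S. third_deriv (P i) x y z)"
  unfolding third_deriv_def by (simp only: sum.distrib)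

text \<open>The third derivative is additive in \<open>P\<close>, so single monomials suffice; each
  involves at most two coordinates and is checked on all values of their bits.\<close>

lemma third_deriv_quad_poly:
  assumes P: "quad_poly n P" and xyz: "x \<in> cube n" "y \<in> cube n" "z \<in> cube n"
  shows "third_deriv P x y z = 0"
proof -
  obtain c a b where P: "\<forall>x\<in>cube n. P x = c + (\<Sum>i<n. a i \<and> x i) + (\<Sum>i<n. \<Sum>j<n. i \<le> j \<and> b i j \<and> x i \<and> x j)"
    using P unfolding quad_poly_iff by blast
  have "third_deriv P x y z = third_deriv (\<lambda>x. c + (\<Sum>i<n. a i \<and> x i) + (\<Sum>i<n. \<Sum>j<n. i \<le> j \<and> b i j \<and> x i \<and> x j)) x y z"
    unfolding third_deriv_def using P xyz cube_add[of _ n] cube.X_0[of n] by simp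
  also have "\<dots> = 0"
  proof -
    have "third_deriv (\<lambda>x. c) x y z = 0" by (simp add: third_deriv_def)
    moreover have "third_deriv (\<lambda>x. a i \<and> x i) x y z = 0" for i
      by (cases "x i"; cases "y i"; cases "z i") (simp_all add: third_deriv_def plus_bool_def zero_bool_def)
    moreover have "third_deriv (\<lambda>x. i \<le> j \<and> b i j \<and> x i \<and> x j) x y z = 0" for i j
      by (cases "x i"; cases "y i"; cases "z i"; cases "x j"; cases "y j"; cases "z j")
        (simp_all add: third_deriv_def plus_bool_def zero_bool_def)
    ultimately show ?thesis by (simp only: third_deriv_add third_deriv_sum sum.neutral_const add_0)
  qed
  finally show ?thesis .
qed

lemma cube_prod_triple:
  assumes "i \<noteq> j" "i \<noteq> k" "j \<noteq> k"
  shows "cube_prod f {i, j, k} xs = f (xs i) * f (xs j) * f (xs k) * f (xs i + xs j) * f (xs i + xs k)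
    * f (xs j + xs k) * f (xs i + xs j + xs k) * f 0"
  using assms by (simp add: cube_prod_def prod_Pow_insert add.assoc)

lemma test_accepts_iff:
  assumes E: "three_uniform t E" and f0: "f 0 = 1 \<or> f 0 = -1"
  shows "test_accepts E f xs \<longleftrightarrow> (\<forall>e\<in>E. cube_prod f e xs = 1)"
proof -
  have eq: "(\<forall>i j k. e = {i, j, k} \<longrightarrow>
      f (xs i) * f (xs j) * f (xs k) * f (vadd (xs i) (xs j)) * f (vadd (xs i) (xs k))
      * f (vadd (xs j) (xs k)) * f (vadd (vadd (xs i) (xs j)) (xs k)) = f vzero) \<longleftrightarrow> cube_prod f e xs = 1" if e: "e \<in> E" for e
  proof -
    have card: "card e = 3" using E e by (simp add: three_uniform_def)
    have *: "f (xs i) * f (xs j) * f (xs k) * f (vadd (xs i) (xs j)) * f (vadd (xs i) (xs k))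
      * f (vadd (xs j) (xs k)) * f (vadd (vadd (xs i) (xs j)) (xs k)) = f vzero \<longleftrightarrow> cube_prod f e xs = 1"
      if "e = {i, j, k}" for i j k
    proof -
      have "i \<noteq> j" "i \<noteq> k" "j \<noteq> k" using card that by (auto simp: card_insert_if split: if_splits)
      then show ?thesis using f0 unfolding that by (auto simp: cube_prod_triple vadd_eq vzero_eq)
    qed
    \<comment> \<open>At least one labelling exists, so the quantifier over labellings is not
      vacuous; all of them express the same symmetric condition.\<close>
    obtain i j k where "e = {i, j, k}" using card by (auto simp: card_3_iff)
    then show ?thesis using * by blast
  qed
  show ?thesis unfolding test_accepts_def by (rule ball_cong[OF refl eq])
qed

section \<open>Acceptance of quadratic functions and of functions far from them\<close>

lemma card_tuples_pos: "0 < card (Pi\<^sub>E {1..t::nat} (\<lambda>_. cube n))"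
  by (simp add: card_PiE card_cube)

lemma accept_prob_quad:
  assumes E: "three_uniform t E" and P: "quad_poly n P"
  shows "accept_prob n t E (sgn_fun P) = 1"
proof -
  have "test_accepts E (sgn_fun P) xs" if xs: "xs \<in> Pi\<^sub>E {1..t} (\<lambda>_. cube n)" for xs
  proof (subst test_accepts_iff[OF E])
    show "sgn_fun P 0 = 1 \<or> sgn_fun P 0 = -1" by (simp add: sgn_fun_eq sg_cases)
    show "\<forall>e\<in>E. cube_prod (sgn_fun P) e xs = 1"
    proof
      fix e assume "e \<in> E"
      then have e: "e \<subseteq> {1..t}" "card e = 3" using E by (auto simp: three_uniform_def)
      obtain i j k where ijk: "e = {i, j, k}" "i \<noteq> j" "i \<noteq> k" "j \<noteq> k" using e(2) by (auto simp: card_3_iff)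
      then have "xs i \<in> cube n" "xs j \<in> cube n" "xs k \<in> cube n" using xs e(1) by (auto simp: PiE_iff)
      then have "sg (third_deriv P (xs i) (xs j) (xs k)) = 1" using third_deriv_quad_poly[OF P] by simp
      then show "cube_prod (sgn_fun P) e xs = 1"
        using ijk(2-4) by (simp only: ijk(1) cube_prod_triple sgn_fun_eq third_deriv_def sg_add not_False_eq_True)
    qed
  qed
  then have "{xs \<in> Pi\<^sub>E {1..t} (\<lambda>_. cube n). test_accepts E (sgn_fun P) xs} = Pi\<^sub>E {1..t} (\<lambda>_. cube n)" by blast
  then show ?thesis using card_tuples_pos[of t n] by (simp add: accept_prob_def)
qed

text \<open>The inverse theorem enters in the contrapositive: a function far from all quadratics has
  few pairs with \<open>\<gamma> \<le> F u\<close>, as \<open>box_bound\<close> requires. Both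
  \<open>\<gamma>\<close> and \<open>T\<close>, and with them \<open>c\<close>, depend on
  \<open>\<eta>\<close> alone.\<close>

lemma accept_prob_far:
  assumes \<eta>: "0 < \<eta>"
  shows "\<exists>c>0. \<forall>n t E f \<epsilon>. three_uniform t E \<longrightarrow> \<epsilon> < c \<longrightarrow> (\<forall>x\<in>cube n. f x = 1 \<or> f x = -1) \<longrightarrow>
    (\<forall>P. quad_poly n P \<longrightarrow> fdist n f (sgn_fun P) \<ge> 1/2 - \<epsilon>) \<longrightarrow> accept_prob n t E f \<le> 1 / 2 ^ card E + \<eta>"
proof -
  \<comment> \<open>The cap at 1 ensures \<open>m ^ 4 \<le> m\<^sup>2\<close>.\<close>
  define m where "m = min \<eta> 1"
  \<comment> \<open>Gives \<open>sqrt \<gamma> = m\<^sup>2 / 2\<close>, so that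
    \<open>\<gamma> + sqrt \<gamma> \<le> m\<^sup>2\<close> and the squared estimate of
    \<open>box_bound\<close> becomes the error \<open>m\<close>.\<close>
  define \<gamma> where "\<gamma> = m ^ 4 / 4"
  have m: "0 < m" "m \<le> 1" "m \<le> \<eta>" using \<eta> by (auto simp: m_def)
  have \<gamma>: "0 < \<gamma>" using m by (simp add: \<gamma>_def)
  have \<gamma>m: "\<gamma> + sqrt \<gamma> \<le> m\<^sup>2"
  proof -
    have "sqrt \<gamma> = m\<^sup>2 / 2"
      using real_sqrt_unique[of "m\<^sup>2 / 2" \<gamma>] by (simp add: \<gamma>_def power_divide flip: power_mult)
    moreover have "m ^ 4 \<le> m\<^sup>2" using m by (intro power_decreasing) auto
    moreover have "0 \<le> m\<^sup>2" by simp
    ultimately show ?thesis unfolding \<gamma>_def by linarith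
  qed
  have "1 < (1 + \<gamma>\<^sup>2) / (1 + \<gamma>\<^sup>2 / 2)" using \<gamma> by (simp add: less_divide_eq add_pos_pos)
  then obtain T where T: "32 \<le> ((1 + \<gamma>\<^sup>2) / (1 + \<gamma>\<^sup>2 / 2)) ^ T"
    using real_arch_pow[of _ 32] by (meson less_imp_le)
  show ?thesis
  proof (intro exI[of _ "inverse_const \<gamma> T / 2"] conjI allI impI)
    show "0 < inverse_const \<gamma> T / 2" using inverse_const_pos[OF \<gamma>] by simp
    fix n t :: nat and E f \<epsilon>
    assume E: "three_uniform t E" and \<epsilon>: "\<epsilon> < inverse_const \<gamma> T / 2"
      and f: "\<forall>x\<in>cube n. f x = 1 \<or> f x = (-1 :: real)"
      and far: "\<forall>P. quad_poly n P \<longrightarrow> fdist n f (sgn_fun P) \<ge> 1/2 - \<epsilon>"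
    interpret f2_sign "cube n" "bdot n" f by unfold_locales (use f in blast)
    have small: "real (card {u \<in> cube n \<times> cube n. \<gamma> \<le> F u}) \<le> \<gamma> * real (card (cube n))"
    proof (rule ccontr)
      assume "\<not> ?thesis"
      then have "\<gamma> * real (card (cube n)) \<le> real (card {u \<in> cube n \<times> cube n. \<gamma> \<le> F u})" by linarith
      from inverse_theorem[OF f[rule_format] \<gamma> T this far[rule_format]] show False using \<epsilon> by linarith
    qed
    have box: "(\<Sum>x\<in>cube n. \<Sum>y\<in>cube n. \<Sum>z\<in>cube n. f (x + y + z) * A x y * B x z * C y z) \<le> m * real (card (cube n)) ^ 3"
      if "\<And>x y. x \<in> cube n \<Longrightarrow> y \<in> cube n \<Longrightarrow> \<bar>A x y\<bar> \<le> 1" "\<And>x z. x \<in> cube n \<Longrightarrow> z \<in> cube n \<Longrightarrow> \<bar>B x z\<bar> \<le> 1"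
        "\<And>y z. y \<in> cube n \<Longrightarrow> z \<in> cube n \<Longrightarrow> \<bar>C y z\<bar> \<le> 1" for A B C
    proof -
      have "(\<Sum>x\<in>cube n. \<Sum>y\<in>cube n. \<Sum>z\<in>cube n. f (x + y + z) * A x y * B x z * C y z)\<^sup>2 \<le> (\<gamma> + sqrt \<gamma>) * real (card (cube n)) ^ 6"
        by (rule box_bound[OF less_imp_le[OF \<gamma>] small that])
      also have "\<dots> \<le> m\<^sup>2 * real (card (cube n)) ^ 6" by (intro mult_right_mono \<gamma>m) simp
      also have "\<dots> = (m * real (card (cube n)) ^ 3)\<^sup>2" by (simp add: power_mult_distrib flip: power_mult)
      finally show ?thesis by (rule power2_le_imp_le) (use m in simp)
    qed
    let ?\<Omega> = "Pi\<^sub>E {1..t} (\<lambda>_. cube n)"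
    note acc = test_accepts_iff[OF E, of f, OF f_pm[OF cube.X_0]]
    have "real (card {xs \<in> ?\<Omega>. test_accepts E f xs}) \<le> (1 / 2 ^ card E + m) * real (card ?\<Omega>)"
      unfolding acc
    proof (rule acceptance_bound)
      show "e \<subseteq> {1..t} \<and> card e = 3" if "e \<in> E" for e using E that by (simp add: three_uniform_def)
    qed (use m box in \<open>simp_all only: finite_atLeastAtMost less_imp_le\<close>)
    also have "\<dots> \<le> (1 / 2 ^ card E + \<eta>) * real (card ?\<Omega>)" using m by (intro mult_right_mono) auto
    finally show "accept_prob n t E f \<le> 1 / 2 ^ card E + \<eta>"
      unfolding accept_prob_def using card_tuples_pos[of t n] by (simp add: divide_le_eq)
  qed
qed

theorem theorem3p3:
  shows "(\<forall>n t E P. three_uniform t E \<longrightarrow> quad_poly n P \<longrightarrow>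
            accept_prob n t E (sgn_fun P) = 1)
       \<and> (\<exists>\<phi> :: real \<Rightarrow> real.
            (\<forall>\<epsilon>\<in>{0<..1/2}. \<phi> \<epsilon> \<ge> 0) \<and> (\<phi> \<longlongrightarrow> 0) (at_right 0) \<and>
            (\<forall>n t E f \<epsilon>. three_uniform t E \<longrightarrow> \<epsilon> \<in> {0<..1/2} \<longrightarrow>
               (\<forall>x\<in>cube n. f x = 1 \<or> f x = -1) \<longrightarrow>
               (\<forall>P. quad_poly n P \<longrightarrow> fdist n f (sgn_fun P) \<ge> 1/2 - \<epsilon>) \<longrightarrow>
               accept_prob n t E f \<le> 1 / 2 ^ card E + \<phi> \<epsilon>))"
proof (intro conjI)
  show "\<forall>n t E P. three_uniform t E \<longrightarrow> quad_poly n P \<longrightarrow> accept_prob n t E (sgn_fun P) = 1"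
    using accept_prob_quad by blast
  define good where "good \<eta> c \<longleftrightarrow> (\<forall>n t E f \<epsilon>. three_uniform t E \<longrightarrow> \<epsilon> < c \<longrightarrow> (\<forall>x\<in>cube n. f x = 1 \<or> f x = -1) \<longrightarrow>
    (\<forall>P. quad_poly n P \<longrightarrow> fdist n f (sgn_fun P) \<ge> 1/2 - \<epsilon>) \<longrightarrow> accept_prob n t E f \<le> 1 / 2 ^ card E + \<eta>)"
    for \<eta> c
  have "\<forall>\<eta>. \<exists>c. 0 < \<eta> \<longrightarrow> 0 < c \<and> good \<eta> c" using accept_prob_far unfolding good_def by blast
  from choice[OF this] obtain c where c: "\<And>\<eta>. 0 < \<eta> \<Longrightarrow> 0 < c \<eta>" and good: "\<And>\<eta>. 0 < \<eta> \<Longrightarrow> good \<eta> (c \<eta>)"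
    by blast
  \<comment> \<open>The errors available at \<open>\<epsilon>\<close>;
    \<open>\<phi> \<epsilon>\<close> is their infimum. The default 1 keeps the set nonempty and is
    always valid, a probability being at most 1.\<close>
  define A where "A \<epsilon> = insert 1 {\<eta>. 0 < \<eta> \<and> \<epsilon> < c \<eta>}" for \<epsilon>
  define \<phi> where "\<phi> \<epsilon> = Inf (A \<epsilon>)" for \<epsilon>
  have A0: "0 \<le> \<eta>" if "\<eta> \<in> A \<epsilon>" for \<eta> \<epsilon> using that by (auto simp: A_def)
  have bdd: "bdd_below (A \<epsilon>)" for \<epsilon> using A0 by (rule bdd_belowI)
  have ne: "A \<epsilon> \<noteq> {}" for \<epsilon> by (simp add: A_def)
  have \<phi>0: "0 \<le> \<phi> \<epsilon>" for \<epsilon> unfolding \<phi>_def by (rule cInf_greatest[OF ne A0])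
  show "\<exists>\<phi> :: real \<Rightarrow> real. (\<forall>\<epsilon>\<in>{0<..1/2}. \<phi> \<epsilon> \<ge> 0) \<and> (\<phi> \<longlongrightarrow> 0) (at_right 0) \<and>
            (\<forall>n t E f \<epsilon>. three_uniform t E \<longrightarrow> \<epsilon> \<in> {0<..1/2} \<longrightarrow>
               (\<forall>x\<in>cube n. f x = 1 \<or> f x = -1) \<longrightarrow>
               (\<forall>P. quad_poly n P \<longrightarrow> fdist n f (sgn_fun P) \<ge> 1/2 - \<epsilon>) \<longrightarrow>
               accept_prob n t E f \<le> 1 / 2 ^ card E + \<phi> \<epsilon>)"
  proof (intro exI[of _ \<phi>] conjI ballI allI impI)
    show "0 \<le> \<phi> \<epsilon>" for \<epsilon> by (rule \<phi>0)
    show "(\<phi> \<longlongrightarrow> 0) (at_right 0)"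
    proof (rule tendstoI)
      fix e :: real assume e: "0 < e"
      have "\<phi> \<epsilon> < e" if "\<epsilon> < c (e / 2)" for \<epsilon>
      proof -
        have "\<phi> \<epsilon> \<le> e / 2" unfolding \<phi>_def by (rule cInf_lower[OF _ bdd]) (use that e in \<open>auto simp: A_def\<close>)
        then show ?thesis using e by simp
      qed
      moreover have "eventually (\<lambda>\<epsilon>. \<epsilon> < c (e / 2)) (at_right 0)"
        using c[of "e / 2"] e by (auto simp: eventually_at_right_field)
      ultimately show "eventually (\<lambda>\<epsilon>. dist (\<phi> \<epsilon>) 0 < e) (at_right 0)"
        using \<phi>0 by (auto elim!: eventually_mono)
    qed
    fix n t E f and \<epsilon> :: real
    assume asm: "three_uniform t E" "\<forall>x\<in>cube n. f x = 1 \<or> f x = -1"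
      "\<forall>P. quad_poly n P \<longrightarrow> fdist n f (sgn_fun P) \<ge> 1/2 - \<epsilon>"
    have "accept_prob n t E f - 1 / 2 ^ card E \<le> \<eta>" if "\<eta> \<in> A \<epsilon>" for \<eta>
    proof (cases "\<eta> = 1")
      case True
      have "accept_prob n t E f \<le> 1"
        unfolding accept_prob_def using card_tuples_pos[of t n]
        by (simp add: divide_le_eq_1 card_mono card_ge_0_finite)
      then show ?thesis using True by (simp add: add_increasing2 algebra_simps)
    next
      case False
      then have \<eta>: "0 < \<eta>" "\<epsilon> < c \<eta>" using that by (auto simp: A_def)
      have "accept_prob n t E f \<le> 1 / 2 ^ card E + \<eta>"
        using good[OF \<eta>(1), unfolded good_def, rule_format, OF asm(1) \<eta>(2)] asm(2,3) by blast
      then show ?thesis by simp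
    qed
    then have "accept_prob n t E f - 1 / 2 ^ card E \<le> \<phi> \<epsilon>"
      unfolding \<phi>_def by (rule cInf_greatest[OF ne])
    then show "accept_prob n t E f \<le> 1 / 2 ^ card E + \<phi> \<epsilon>" by simp
  qed
qed

end
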